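(* Let $N$ be a connected and simply connected nilpotent graded Lie group (with a fixed grading and the associated action of $\mathbb R^*_+$ by automorphisms), and let $T$ be a unitary representation of $N$ in a Hilbert space $H$. Suppose $H$ does not contain nonzero invariant vectors. Then each nonzero vector of the Gårding space $H^*\subset H$ is almost invariant under $T$; thus the representation $T$ is summable.
   Context: Let $L$ be a nilpotent Lie algebra of class $n$, i.e. its lower central series $L=L_1\supset L_2\supset\cdots$, $L_{i+1}=[L,L_i]$, satisfies $L_n\neq0$, $L_{n+1}=0$. A grading of $L$ is a decomposition $L=\bigoplus_{k=1}^nR_k$ with $R_k\subset L_k$, $L_k=R_k\oplus L_{k+1}$, and $[R_i,R_j]\subset R_{i+j}$ (with $R_k=0$ for $k>n$). $L$ is graded if it has a grading. A connected simply connected nilpotent Lie group $N$ (real, finite-dimensional) is graded if its Lie algebra $L$ is. Via the diffeomorphism $\exp:L\to N$, elements of $N$ are written as $a=(a_1,\dots,a_n)$, $a_k\in R_k$ (canonical coordinates). The group $\mathbb R^*_+$ of positive reals acts on $N$ by automorphisms $a\mapsto a^r=(ra_1,r^2a_2,\dots,r^na_n)$. For a unitary representation $T$ of $N$ in $H$ put $T_r(a)=T(a^r)$, $r\in\mathbb R^*_+$. Let $d^*r=r^{-1}dr$ and let $u$ be a fixed function, smooth on $[0,\infty)$ and positive on $(0,\infty)$, with $\int_\epsilon^\infty e^{-u(r)/2}d^*r<\infty$ for every $\epsilon>0$. A nonzero vector $h\in H$ is almost invariant if $\int_0^\infty\|T_r(g)h-h\|\,e^{-u(r)/2}\,d^*r<\infty$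 for every $g\in N$. The representation $T$ is summable if $H$ has no nonzero invariant vectors and has at least one almost invariant vector. The Gårding space $H^*$ of $T$ is the subspace of all $h\in H$ such that the function $g\mapsto\langle T(g)h,h'\rangle$ is in $C^\infty(N)$ for all $h'\in H$. *)

theory Defs
  imports "HOL-Analysis.Analysis" "HOL-Algebra.Group" "HOL-Library.Function_Algebras"
begin

section \<open>Functions as a real vector space\<close>

instantiation "fun" :: (type, real_vector) real_vector
begin

definition scaleR_fun :: "real \<Rightarrow> ('a \<Rightarrow> 'b) \<Rightarrow> 'a \<Rightarrow> 'b"
  where "scaleR_fun c f = (\<lambda>x. c *\<^sub>R f x)"

instance
  by standard (simp_all add: scaleR_fun_def fun_eq_iff scaleR_add_right scaleR_add_left)

end


section \<open>Complex Hilbert spaces\<close>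

text \<open>The real inner product (hence the norm and the topology) of the class is the real part of
  the complex one, which is linear in its first argument.\<close>

class complex_hilbert_space = real_inner + complete_space +
  fixes scaleC :: "complex \<Rightarrow> 'a \<Rightarrow> 'a"
    and cinner :: "'a \<Rightarrow> 'a \<Rightarrow> complex"
  assumes scaleC_add_right: "scaleC c (x + y) = scaleC c x + scaleC c y"
    and scaleC_add_left: "scaleC (c + d) x = scaleC c x + scaleC d x"
    and scaleC_scaleC: "scaleC c (scaleC d x) = scaleC (c * d) x"
    and scaleC_of_real: "scaleC (of_real r) x = scaleR r x"
    and cinner_commute: "cinner x y = cnj (cinner y x)"
    and cinner_add_left: "cinner (x + y) z = cinner x z + cinner y z"
    and cinner_scaleC_left: "cinner (scaleC c x) y = c * cinner x y"
    and inner_eq_Re_cinner: "inner x y = Re (cinner x y)"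


section \<open>Smooth manifolds and smooth maps\<close>

text \<open>Continuous differentiability of order \<open>k\<close>; used for open subsets of Euclidean spaces only.\<close>

primrec Ck_on :: "nat \<Rightarrow> 'a::real_normed_vector set \<Rightarrow> ('a \<Rightarrow> 'b::real_normed_vector) \<Rightarrow> bool" where
  "Ck_on 0 S f \<longleftrightarrow> continuous_on S f"
| "Ck_on (Suc k) S f \<longleftrightarrow> (\<forall>x\<in>S. f differentiable (at x)) \<and>
     (\<forall>v. Ck_on k S (\<lambda>x. frechet_derivative f (at x) v))"

definition smooth_on :: "'a::real_normed_vector set \<Rightarrow> ('a \<Rightarrow> 'b::real_normed_vector) \<Rightarrow> bool" where
  "smooth_on S f \<longleftrightarrow> (\<forall>k. Ck_on k S f)"

type_synonym ('p, 'a) chart_set = "('p set \<times> ('p \<Rightarrow> 'a)) set"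

definition smooth_atlas :: "'p topology \<Rightarrow> ('p, 'a::euclidean_space) chart_set \<Rightarrow> bool" where
  "smooth_atlas X A \<longleftrightarrow>
     (\<forall>(U, \<phi>)\<in>A. openin X U \<and> open (\<phi> ` U) \<and>
        homeomorphic_map (subtopology X U) (top_of_set (\<phi> ` U)) \<phi>) \<and>
     (\<Union>(U, \<phi>)\<in>A. U) = topspace X \<and>
     (\<forall>(U, \<phi>)\<in>A. \<forall>(V, \<psi>)\<in>A. smooth_on (\<phi> ` (U \<inter> V)) (\<psi> \<circ> inv_into U \<phi>))"

definition smooth_manifold :: "'p topology \<Rightarrow> ('p, 'a::euclidean_space) chart_set \<Rightarrow> bool" where
  "smooth_manifold X A \<longleftrightarrow> Hausdorff_space X \<and> second_countable X \<and> smooth_atlas X A"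

definition smooth_map ::
  "'p topology \<Rightarrow> ('p, 'a::euclidean_space) chart_set \<Rightarrow>
   'q topology \<Rightarrow> ('q, 'b::euclidean_space) chart_set \<Rightarrow> ('p \<Rightarrow> 'q) \<Rightarrow> bool" where
  "smooth_map X A Y B f \<longleftrightarrow> continuous_map X Y f \<and>
     (\<forall>(U, \<phi>)\<in>A. \<forall>(V, \<psi>)\<in>B. smooth_on (\<phi> ` (U \<inter> f -` V)) (\<psi> \<circ> f \<circ> inv_into U \<phi>))"

definition prod_charts ::
  "('p, 'a) chart_set \<Rightarrow> ('q, 'b) chart_set \<Rightarrow> ('p \<times> 'q, 'a \<times> 'b) chart_set" where
  "prod_charts A B = {(U \<times> V, map_prod \<phi> \<psi>) | U \<phi> V \<psi>. (U, \<phi>) \<in> A \<and> (V, \<psi>) \<in> B}"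

definition euclidean_charts :: "('a, 'a::euclidean_space) chart_set" where
  "euclidean_charts = {(UNIV, id)}"

text \<open>The analogue for abstract topologies of \<^const>\<open>simply_connected\<close>: any two loops are freely
  homotopic.\<close>

definition simply_connected_space :: "'p topology \<Rightarrow> bool" where
  "simply_connected_space X \<longleftrightarrow>
     (\<forall>p q. pathin X p \<and> p 1 = p 0 \<and> pathin X q \<and> q 1 = q 0 \<longrightarrow>
        homotopic_with (\<lambda>r. r 1 = r 0) (top_of_set {0..1}) X p q)"


section \<open>Lie groups\<close>

record ('g, 'a) lie_group_data = "'g monoid" +
  mtop :: "'g topology"
  charts :: "('g, 'a) chart_set"

definition lie_group :: "('g, 'a::euclidean_space) lie_group_data \<Rightarrow> bool" where
  "lie_group N \<longleftrightarrow> group N \<and> topspace (mtop N) = carrier N \<and>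
     smooth_manifold (mtop N) (charts N) \<and>
     smooth_map (prod_topology (mtop N) (mtop N)) (prod_charts (charts N) (charts N))
       (mtop N) (charts N) (\<lambda>(x, y). x \<otimes>\<^bsub>N\<^esub> y) \<and>
     smooth_map (mtop N) (charts N) (mtop N) (charts N) (\<lambda>x. inv\<^bsub>N\<^esub> x)"

definition smooth_function ::
  "('g, 'a::euclidean_space) lie_group_data \<Rightarrow> ('g \<Rightarrow> 'b::euclidean_space) \<Rightarrow> bool" where
  "smooth_function N f \<longleftrightarrow> smooth_map (mtop N) (charts N) euclidean euclidean_charts f"

definition smooth_curve :: "('g, 'a::euclidean_space) lie_group_data \<Rightarrow> (real \<Rightarrow> 'g) \<Rightarrow> bool" where
  "smooth_curve N c \<longleftrightarrow> smooth_map euclidean euclidean_charts (mtop N) (charts N) c"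

text \<open>A vector field is represented by its action on the smooth real functions of \<open>N\<close>; the
  operator is set to \<open>0\<close> on non-smooth functions and its values to \<open>0\<close> off the carrier, so that
  equal vector fields are equal as operators.
  For a curve \<open>c\<close> through the identity, \<open>velocity_field N c\<close> is the left-invariant vector field
  whose value at the identity is the velocity vector of \<open>c\<close> at time \<open>0\<close>.\<close>

type_synonym 'g vfield = "('g \<Rightarrow> real) \<Rightarrow> 'g \<Rightarrow> real"

definition velocity_field ::
  "('g, 'a::euclidean_space) lie_group_data \<Rightarrow> (real \<Rightarrow> 'g) \<Rightarrow> 'g vfield" where
  "velocity_field N c = (\<lambda>f x. if smooth_function N f \<and> x \<in> carrier N
     then deriv (\<lambda>t. f (x \<otimes>\<^bsub>N\<^esub> c t)) 0 else 0)"

definition lie_algebra :: "('g, 'a::euclidean_space) lie_group_data \<Rightarrow> 'g vfield set" where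
  "lie_algebra N = {velocity_field N c | c. smooth_curve N c \<and> c 0 = \<one>\<^bsub>N\<^esub>}"

definition lie_bracket :: "'g vfield \<Rightarrow> 'g vfield \<Rightarrow> 'g vfield" where
  "lie_bracket X Y = (\<lambda>f. X (Y f) - Y (X f))"

definition one_parameter_subgroup ::
  "('g, 'a::euclidean_space) lie_group_data \<Rightarrow> (real \<Rightarrow> 'g) \<Rightarrow> bool" where
  "one_parameter_subgroup N \<gamma> \<longleftrightarrow> smooth_curve N \<gamma> \<and> (\<forall>s t. \<gamma> (s + t) = \<gamma> s \<otimes>\<^bsub>N\<^esub> \<gamma> t)"

text \<open>The one-parameter subgroup with a given initial velocity exists and is unique, so the choice
  below is immaterial.\<close>

definition lie_exp :: "('g, 'a::euclidean_space) lie_group_data \<Rightarrow> 'g vfield \<Rightarrow> 'g" where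
  "lie_exp N X = (SOME \<gamma>. one_parameter_subgroup N \<gamma> \<and> velocity_field N \<gamma> = X) 1"


section \<open>Nilpotent and graded Lie algebras\<close>

text \<open>A Lie algebra is given by its underlying subspace \<open>L\<close> and its bracket \<open>br\<close>. The lower central
  series is indexed from \<open>1\<close>: \<open>L\<^sub>1 = L\<close> and \<open>L\<^sub>i\<^sub>+\<^sub>1 = [L, L\<^sub>i]\<close>.\<close>

definition lower_central :: "('v::real_vector \<Rightarrow> 'v \<Rightarrow> 'v) \<Rightarrow> 'v set \<Rightarrow> nat \<Rightarrow> 'v set" where
  "lower_central br L i = ((\<lambda>M. span {br x y | x y. x \<in> L \<and> y \<in> M}) ^^ (i - 1)) L"

definition nilpotent_of_class :: "('v::real_vector \<Rightarrow> 'v \<Rightarrow> 'v) \<Rightarrow> 'v set \<Rightarrow> nat \<Rightarrow> bool" where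
  "nilpotent_of_class br L n \<longleftrightarrow>
     n \<ge> 1 \<and> lower_central br L n \<noteq> {0} \<and> lower_central br L (n + 1) = {0}"

definition lie_grading ::
  "('v::real_vector \<Rightarrow> 'v \<Rightarrow> 'v) \<Rightarrow> 'v set \<Rightarrow> nat \<Rightarrow> (nat \<Rightarrow> 'v set) \<Rightarrow> bool" where
  "lie_grading br L n R \<longleftrightarrow>
     (\<forall>k\<in>{1..n}. subspace (R k) \<and> R k \<subseteq> lower_central br L k) \<and>
     (\<forall>k>n. R k = {0}) \<and>
     L = {\<Sum>k=1..n. a k | a. \<forall>k\<in>{1..n}. a k \<in> R k} \<and>
     (\<forall>a. (\<forall>k\<in>{1..n}. a k \<in> R k) \<and> (\<Sum>k=1..n. a k) = 0 \<longrightarrow> (\<forall>k\<in>{1..n}. a k = 0)) \<and>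
     (\<forall>k\<in>{1..n}.
        lower_central br L k = {x + y | x y. x \<in> R k \<and> y \<in> lower_central br L (k + 1)} \<and>
        R k \<inter> lower_central br L (k + 1) = {0}) \<and>
     (\<forall>i\<ge>1. \<forall>j\<ge>1. \<forall>x\<in>R i. \<forall>y\<in>R j. br x y \<in> R (i + j))"

text \<open>\<open>a\<close> is the tuple of canonical coordinates of \<open>g\<close> (only its entries \<open>1..n\<close> matter).\<close>

definition canonical_point ::
  "('g, 'a::euclidean_space) lie_group_data \<Rightarrow> nat \<Rightarrow> (nat \<Rightarrow> 'g vfield) \<Rightarrow> 'g" where
  "canonical_point N n a = lie_exp N (\<Sum>k=1..n. a k)"

definition canonical_coordinates ::
  "('g, 'a::euclidean_space) lie_group_data \<Rightarrow> nat \<Rightarrow> (nat \<Rightarrow> 'g vfield set) \<Rightarrow>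
   'g \<Rightarrow> (nat \<Rightarrow> 'g vfield) \<Rightarrow> bool" where
  "canonical_coordinates N n R g a \<longleftrightarrow> (\<forall>k\<in>{1..n}. a k \<in> R k) \<and> g = canonical_point N n a"

definition dilate :: "real \<Rightarrow> (nat \<Rightarrow> 'g vfield) \<Rightarrow> nat \<Rightarrow> 'g vfield" where
  "dilate r a = (\<lambda>k. r ^ k *\<^sub>R a k)"


section \<open>Unitary representations, almost invariant vectors, Garding space\<close>

definition unitary_representation ::
  "('g, 'a::euclidean_space) lie_group_data \<Rightarrow> ('g \<Rightarrow> 'h \<Rightarrow> 'h::complex_hilbert_space) \<Rightarrow> bool" where
  "unitary_representation N T \<longleftrightarrow>
     (\<forall>g\<in>carrier N. (\<forall>x y. T g (x + y) = T g x + T g y) \<and>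
        (\<forall>c x. T g (scaleC c x) = scaleC c (T g x)) \<and>
        (\<forall>x y. cinner (T g x) (T g y) = cinner x y) \<and> surj (T g)) \<and>
     (\<forall>g\<in>carrier N. \<forall>g'\<in>carrier N. T (g \<otimes>\<^bsub>N\<^esub> g') = T g \<circ> T g') \<and>
     (\<forall>x. continuous_map (mtop N) euclidean (\<lambda>g. T g x))"

definition invariant_vector ::
  "('g, 'a::euclidean_space) lie_group_data \<Rightarrow> ('g \<Rightarrow> 'h \<Rightarrow> 'h::complex_hilbert_space) \<Rightarrow> 'h \<Rightarrow> bool"
  where
  "invariant_vector N T h \<longleftrightarrow> (\<forall>g\<in>carrier N. T g h = h)"

definition garding_space ::
  "('g, 'a::euclidean_space) lie_group_data \<Rightarrow> ('g \<Rightarrow> 'h \<Rightarrow> 'h::complex_hilbert_space) \<Rightarrow> 'h set"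
  where
  "garding_space N T = {h. \<forall>h'. smooth_function N (\<lambda>g. cinner (T g h) h')}"

text \<open>The measure \<open>d\<^sup>*r = r\<^sup>-\<^sup>1 dr\<close> on the positive reals.\<close>

definition dstar :: "real measure" where
  "dstar = density lborel (\<lambda>r. ennreal (indicator {0<..} r / r))"

text \<open>One-sided smoothness on the closed half-line; \<open>D k\<close> is the \<open>k\<close>-th derivative.\<close>

definition smooth_half_line :: "(real \<Rightarrow> real) \<Rightarrow> bool" where
  "smooth_half_line u \<longleftrightarrow> (\<exists>D. D 0 = u \<and>
     (\<forall>k. \<forall>x\<ge>0. (D k has_real_derivative D (Suc k) x) (at x within {0..})))"

definition admissible_weight :: "(real \<Rightarrow> real) \<Rightarrow> bool" where
  "admissible_weight u \<longleftrightarrow> smooth_half_line u \<and> (\<forall>r>0. u r > 0) \<and>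
     (\<forall>\<epsilon>>0. (\<integral>\<^sup>+r\<in>{\<epsilon>..}. ennreal (exp (- u r / 2)) \<partial>dstar) < \<infinity>)"

text \<open>Every \<open>g\<close> in \<open>N\<close> has canonical coordinates \<open>a = (a\<^sub>1, \<dots>, a\<^sub>n)\<close>, and
  \<open>canonical_point N n (dilate r a)\<close> is the dilated element \<open>g\<^sup>r\<close>.\<close>

definition almost_invariant ::
  "('g, 'a::euclidean_space) lie_group_data \<Rightarrow> nat \<Rightarrow> (nat \<Rightarrow> 'g vfield set) \<Rightarrow> (real \<Rightarrow> real) \<Rightarrow>
   ('g \<Rightarrow> 'h \<Rightarrow> 'h::complex_hilbert_space) \<Rightarrow> 'h \<Rightarrow> bool" where
  "almost_invariant N n R u T h \<longleftrightarrow> h \<noteq> 0 \<and>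
     (\<forall>g\<in>carrier N. \<forall>a. canonical_coordinates N n R g a \<longrightarrow>
        (\<integral>\<^sup>+r\<in>{0<..}. ennreal (norm (T (canonical_point N n (dilate r a)) h - h) *
            exp (- u r / 2)) \<partial>dstar) < \<infinity>)"

definition summable_representation ::
  "('g, 'a::euclidean_space) lie_group_data \<Rightarrow> nat \<Rightarrow> (nat \<Rightarrow> 'g vfield set) \<Rightarrow> (real \<Rightarrow> real) \<Rightarrow>
   ('g \<Rightarrow> 'h \<Rightarrow> 'h::complex_hilbert_space) \<Rightarrow> bool" where
  "summable_representation N n R u T \<longleftrightarrow>
     (\<forall>h. invariant_vector N T h \<longrightarrow> h = 0) \<and> (\<exists>h. almost_invariant N n R u T h)"

end

theory Submission
  imports Defs
begin

text \<open>Call \<open>h\<close> a Lipschitz vector if \<open>\<parallel>T (\<gamma> 1) h - h\<parallel> \<le> C \<parallel>v\<parallel>\<close> for every one-parameter subgroup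
  \<open>\<gamma>\<close>, where \<open>v\<close> is its velocity at the identity in a fixed chart. The point
  \<open>exp (r a\<^sub>1 + r\<^sup>2 a\<^sub>2 + \<dots>)\<close> is the time-one value of a one-parameter subgroup of velocity \<open>O(r)\<close>, so for
  a Lipschitz vector the integrand is \<open>O(r)\<close> near \<open>0\<close>, which compensates \<open>r\<^sup>-\<^sup>1 dr\<close>; away from \<open>0\<close> the
  weight alone makes the integral converge.

  A vector of the Garding space is Lipschitz because its weak derivatives at the identity are bounded
  by the uniform boundedness principle, and the derivative of \<open>\<langle>T (\<gamma> t) h, h'\<rangle>\<close> at \<open>t\<close> is the one at
  \<open>0\<close> with \<open>h'\<close> replaced by \<open>T (\<gamma> (- t)) h'\<close>. A nonzero Lipschitz vector is obtained by averaging an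
  orbit \<open>y \<mapsto> T y h\<^sub>0\<close> in the chart against a bump function \<open>\<psi>\<close>: in these coordinates left translation by
  \<open>\<gamma>\<close> is the flow of a right-invariant field \<open>Z\<close>, and integration by parts moves the derivative of
  \<open>\<integral> \<psi> f (\<gamma>(s) y) dy\<close> in \<open>s\<close> onto \<open>\<psi> Z\<close>. This is done for polynomials \<open>f\<close> and extended by
  Stone--Weierstrass, so no change of variables formula is needed.\<close>

section \<open>Continuously differentiable maps\<close>

text \<open>The vector needed for summability is not sought in the Garding space: membership there
  demands smoothness of every matrix coefficient, whereas convergence at \<open>0\<close> asks only
  for a first-order bound. The Lipschitz property is the common weakening that Garding vectors and
  averaged vectors share.

  The obstacle for averages is that an orbit is merely continuous, so its matrix coefficients cannot
  be differentiated along the flow. The estimate obtained by parts contains the supremum of the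
  coefficient and the integral of the absolute value of a divergence, but no derivative of the
  coefficient; this is why it passes through uniform approximation by polynomials. The divergence is
  linear in the velocity of the subgroup, which yields a constant valid for all subgroups at once.

  Differential equations enter because \<open>lie_exp\<close> is defined by choice: its value
  carries information only once a one-parameter subgroup with the prescribed velocity is known to
  exist.\<close>

instance complex_hilbert_space \<subseteq> banach ..

lemma Ck_on_Suc_has_derivative:
  assumes "Ck_on (Suc k) S f" "x \<in> S"
  shows "(f has_derivative frechet_derivative f (at x)) (at x)"
  using assms by (simp add: frechet_derivative_works[symmetric])

lemma Ck_on_cong:
  assumes "open S" "\<And>x. x \<in> S \<Longrightarrow> f x = g x" "Ck_on k S f"
  shows "Ck_on k S g"
  using assms(2,3)
proof (induction k arbitrary: f g)
  case 0
  then show ?case by (auto cong: continuous_on_cong)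
next
  case (Suc k)
  have d: "(g has_derivative frechet_derivative f (at x)) (at x)" if "x \<in> S" for x
    using Ck_on_Suc_has_derivative[OF Suc.prems(2) that] \<open>open S\<close> that Suc.prems(1)
    by (rule has_derivative_transform_within_open)
  have "Ck_on k S (\<lambda>x. frechet_derivative g (at x) v)" for v
  proof (rule Suc.IH)
    show "frechet_derivative f (at x) v = frechet_derivative g (at x) v" if "x \<in> S" for x
      using frechet_derivative_at[OF d[OF that]] by simp
    show "Ck_on k S (\<lambda>x. frechet_derivative f (at x) v)" using Suc.prems(2) by simp
  qed
  then show ?case using d by (auto simp: differentiable_def)
qed

text \<open>\<open>frechet_derivative\<close> is a choice operator; this rule lets the derivative be
  exhibited by any formula \<open>D\<close>. The calculus rules below rest on it.\<close>

lemma Ck_on_SucI: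
  assumes "open S" "\<And>x. x \<in> S \<Longrightarrow> (f has_derivative D x) (at x)"
    "\<And>v. Ck_on k S (\<lambda>x. D x v)"
  shows "Ck_on (Suc k) S f"
proof -
  have "Ck_on k S (\<lambda>x. frechet_derivative f (at x) v)" for v
    by (rule Ck_on_cong[OF assms(1) _ assms(3)[of v]])
      (simp add: frechet_derivative_at[OF assms(2), symmetric])
  then show ?thesis using assms(2) by (auto simp: differentiable_def)
qed

lemma Ck_on_SucD: "Ck_on (Suc k) S f \<Longrightarrow> Ck_on k S f"
proof (induction k arbitrary: f)
  case 0
  then show ?case
    by (auto intro!: continuous_at_imp_continuous_on differentiable_imp_continuous_within)
next
  case (Suc k)
  then show ?case by simp
qed

lemma Ck_on_mono: "Ck_on k S f \<Longrightarrow> j \<le> k \<Longrightarrow> Ck_on j S f"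
  by (induction k) (auto simp: le_Suc_eq dest: Ck_on_SucD simp del: Ck_on.simps(2))

lemma Ck_on_continuous: "Ck_on k S f \<Longrightarrow> continuous_on S f"
  using Ck_on_mono[of k S f 0] by simp

lemma Ck_on_subset: "Ck_on k S f \<Longrightarrow> T \<subseteq> S \<Longrightarrow> Ck_on k T f"
  by (induction k arbitrary: f) (auto intro: continuous_on_subset)

lemma Ck_on_local:
  assumes "\<And>x. x \<in> S \<Longrightarrow> \<exists>T. open T \<and> x \<in> T \<and> Ck_on k T f"
  shows "Ck_on k S f"
  using assms
proof (induction k arbitrary: f)
  case 0
  show ?case unfolding Ck_on.simps
  proof (intro continuous_at_imp_continuous_on ballI)
    fix x assume "x \<in> S"
    then obtain T where "open T" "x \<in> T" "continuous_on T f" using 0 by auto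
    then show "isCont f x" by (simp add: continuous_on_eq_continuous_at)
  qed
next
  case (Suc k)
  show ?case unfolding Ck_on.simps
  proof (intro conjI ballI allI)
    show "f differentiable (at x)" if "x \<in> S" for x
      using Suc.prems[OF that] by auto
    show "Ck_on k S (\<lambda>x. frechet_derivative f (at x) v)" for v
      by (rule Suc.IH) (use Suc.prems in fastforce)
  qed
qed

lemma Ck_on_const: "open S \<Longrightarrow> Ck_on k S (\<lambda>x. c)"
proof (induction k arbitrary: c)
  case (Suc k)
  then show ?case by (intro Ck_on_SucI[where D = "\<lambda>_ _. 0"]) auto
qed simp

lemma Ck_on_bounded_linear: "bounded_linear L \<Longrightarrow> open S \<Longrightarrow> Ck_on k S L"
proof (cases k)
  case 0
  assume "bounded_linear L" then show ?thesis
    using 0 by (auto simp: linear_continuous_on)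
next
  case (Suc j)
  assume "bounded_linear L" "open S"
  then show ?thesis unfolding Suc
    by (intro Ck_on_SucI[where D = "\<lambda>_. L"]) (auto intro: bounded_linear_imp_has_derivative Ck_on_const)
qed

lemma Ck_on_add:
  assumes "open S"
  shows "Ck_on k S f \<Longrightarrow> Ck_on k S g \<Longrightarrow> Ck_on k S (\<lambda>x. f x + g x)"
proof (induction k arbitrary: f g)
  case 0
  then show ?case by (auto intro: continuous_on_add)
next
  case (Suc k)
  show ?case
    by (rule Ck_on_SucI[OF \<open>open S\<close> has_derivative_add[OF Ck_on_Suc_has_derivative[OF Suc.prems(1)]
              Ck_on_Suc_has_derivative[OF Suc.prems(2)]]])
      (use Suc in auto)
qed

lemma Ck_on_sum:
  assumes "open S" "\<And>i. i \<in> I \<Longrightarrow> Ck_on k S (f i)"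
  shows "Ck_on k S (\<lambda>x. \<Sum>i\<in>I. f i x)"
  using assms(2)
  by (induction I rule: infinite_finite_induct) (auto intro: Ck_on_const Ck_on_add assms(1))

lemma Ck_on_bilinear:
  assumes "open S" "bounded_bilinear B"
  shows "Ck_on k S f \<Longrightarrow> Ck_on k S g \<Longrightarrow> Ck_on k S (\<lambda>x. B (f x) (g x))"
proof (induction k arbitrary: f g)
  case 0
  then show ?case by (auto intro: bounded_bilinear.continuous_on[OF assms(2)])
next
  case (Suc k)
  have k: "Ck_on k S f" "Ck_on k S g" using Suc.prems by (blast dest: Ck_on_SucD)+
  show ?case
    by (rule Ck_on_SucI[OF \<open>open S\<close> bounded_bilinear.FDERIV[OF assms(2)
              Ck_on_Suc_has_derivative[OF Suc.prems(1)] Ck_on_Suc_has_derivative[OF Suc.prems(2)]]])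
      (use Suc k in \<open>auto intro!: Ck_on_add \<open>open S\<close>\<close>)
qed

lemmas Ck_on_scaleR = Ck_on_bilinear[OF _ bounded_bilinear_scaleR]
lemmas Ck_on_mult = Ck_on_bilinear[OF _ bounded_bilinear_mult]
lemmas Ck_on_inner = Ck_on_bilinear[OF _ bounded_bilinear_inner]

lemma Ck_on_compose_linear:
  assumes "open S" "bounded_linear L"
  shows "Ck_on k S f \<Longrightarrow> Ck_on k S (\<lambda>x. L (f x))"
proof (induction k arbitrary: f)
  case 0
  then show ?case by (auto intro: bounded_linear.continuous_on[OF assms(2)])
next
  case (Suc k)
  show ?case
    by (rule Ck_on_SucI[OF \<open>open S\<close> bounded_linear.has_derivative[OF assms(2)
              Ck_on_Suc_has_derivative[OF Suc.prems(1)]]])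
      (use Suc in auto)
qed

lemma Ck_on_Pair:
  fixes f :: "'a::real_normed_vector \<Rightarrow> 'c::real_normed_vector"
    and g :: "'a \<Rightarrow> 'd::real_normed_vector"
  assumes "open S" "Ck_on k S f" "Ck_on k S g"
  shows "Ck_on k S (\<lambda>x. (f x, g x))"
proof -
  have "bounded_linear (\<lambda>x::'c. (x, 0::'d))" "bounded_linear (\<lambda>x::'d. (0::'c, x))"
    by (intro bounded_linear_Pair bounded_linear_ident bounded_linear_zero)+
  from this[THEN Ck_on_compose_linear[OF assms(1)]] assms(2,3)
  have "Ck_on k S (\<lambda>x. (f x, 0) + (0, g x))"
    by (intro Ck_on_add assms(1)) blast+
  then show ?thesis by simp
qed

lemma linear_sum_Basis:
  fixes D :: "'a::euclidean_space \<Rightarrow> 'b::real_vector"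
  assumes "linear D"
  shows "D w = (\<Sum>i\<in>Basis. (w \<bullet> i) *\<^sub>R D i)"
proof -
  have "D w = D (\<Sum>i\<in>Basis. (w \<bullet> i) *\<^sub>R i)" by (simp add: euclidean_representation)
  also have "\<dots> = (\<Sum>i\<in>Basis. (w \<bullet> i) *\<^sub>R D i)"
    using assms by (simp add: linear_sum linear_cmul)
  finally show ?thesis .
qed

text \<open>The derivative of the composite evaluates \<open>frechet_derivative g\<close> in a
  direction that moves with \<open>x\<close>, while \<open>Ck_on\<close> speaks of fixed directions.
  Expanding that direction in the basis of the middle space leaves products of coordinates with
  fixed-direction derivatives composed with \<open>f\<close>, to which the induction hypothesis
  applies.\<close>

lemma Ck_on_compose:
  fixes f :: "'a::real_normed_vector \<Rightarrow> 'b::euclidean_space" and g :: "'b \<Rightarrow> 'c::real_normed_vector"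
  assumes "open S" "open T" "f ` S \<subseteq> T"
  shows "Ck_on k S f \<Longrightarrow> Ck_on k T g \<Longrightarrow> Ck_on k S (\<lambda>x. g (f x))"
proof (induction k arbitrary: g)
  case 0
  then show ?case using assms by (auto intro: continuous_on_compose2)
next
  case (Suc k)
  have d: "((\<lambda>x. g (f x)) has_derivative
      (\<lambda>v. frechet_derivative g (at (f x)) (frechet_derivative f (at x) v))) (at x)" if "x \<in> S" for x
    using assms(3) that
    by (intro has_derivative_compose[OF Ck_on_Suc_has_derivative[OF Suc.prems(1)]
          Ck_on_Suc_has_derivative[OF Suc.prems(2)]]) auto
  show ?case
  proof (rule Ck_on_SucI[OF \<open>open S\<close> d], assumption)
    fix v
    have eq: "(\<Sum>i\<in>Basis. (frechet_derivative f (at x) v \<bullet> i) *\<^sub>R frechet_derivative g (at (f x)) i)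
        = frechet_derivative g (at (f x)) (frechet_derivative f (at x) v)" if "x \<in> S" for x
      using assms(3) that Ck_on_Suc_has_derivative[OF Suc.prems(2), of "f x"]
      by (auto intro!: linear_sum_Basis[symmetric] dest: has_derivative_linear)
    have ck: "Ck_on k S (\<lambda>x. \<Sum>i\<in>Basis. (frechet_derivative f (at x) v \<bullet> i) *\<^sub>R frechet_derivative g (at (f x)) i)"
      using Suc.prems
      by (intro Ck_on_sum Ck_on_scaleR Ck_on_inner Ck_on_const \<open>open S\<close> Suc.IH Ck_on_SucD[of k S f]) auto
    show "Ck_on k S (\<lambda>x. frechet_derivative g (at (f x)) (frechet_derivative f (at x) v))"
      by (rule Ck_on_cong[OF \<open>open S\<close> _ ck]) (rule eq)
  qed
qed

text \<open>Base point and direction both vary here; this is what makes the invariant fields of a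
  Lie group regular in the chart.\<close>

lemma Ck_on_frechet_derivative:
  fixes f :: "'a::euclidean_space \<Rightarrow> 'b::real_normed_vector" and h :: "'d::real_normed_vector \<Rightarrow> 'a"
  assumes "open S" "open T" "Ck_on (Suc k) T f" "Ck_on k S h" "Ck_on k S g" "h ` S \<subseteq> T"
  shows "Ck_on k S (\<lambda>x. frechet_derivative f (at (h x)) (g x))"
proof -
  have ck: "Ck_on k S (\<lambda>x. \<Sum>i\<in>Basis. (g x \<bullet> i) *\<^sub>R frechet_derivative f (at (h x)) i)"
  proof (intro Ck_on_sum Ck_on_scaleR \<open>open S\<close>)
    fix i :: 'a
    show "Ck_on k S (\<lambda>x. g x \<bullet> i)"
      using assms by (intro Ck_on_inner Ck_on_const)
    show "Ck_on k S (\<lambda>x. frechet_derivative f (at (h x)) i)"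
      by (rule Ck_on_compose[OF assms(1,2,6,4)]) (use assms(3) in simp)
  qed
  show ?thesis
  proof (rule Ck_on_cong[OF \<open>open S\<close> _ ck])
    fix x assume "x \<in> S"
    then have "linear (frechet_derivative f (at (h x)))"
      using assms(6) Ck_on_Suc_has_derivative[OF assms(3)] by (blast intro: has_derivative_linear)
    then show "(\<Sum>i\<in>Basis. (g x \<bullet> i) *\<^sub>R frechet_derivative f (at (h x)) i) =
        frechet_derivative f (at (h x)) (g x)"
      by (rule linear_sum_Basis[symmetric])
  qed
qed

text \<open>Raises the regularity by one order; it drives the bootstrap for solutions of
  differential equations and for \<open>flat_exp\<close>.\<close>

lemma Ck_on_vector_derivative:
  fixes f :: "real \<Rightarrow> 'b::real_normed_vector"
  assumes "open S" "\<And>t. t \<in> S \<Longrightarrow> (f has_vector_derivative f' t) (at t)" "Ck_on k S f'"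
  shows "Ck_on (Suc k) S f"
  by (rule Ck_on_SucI[OF assms(1), where D = "\<lambda>t v. v *\<^sub>R f' t"])
    (use assms in \<open>auto simp: has_vector_derivative_def intro!: Ck_on_scaleR Ck_on_const\<close>)

lemma smooth_on_cong:
  "open S \<Longrightarrow> (\<And>x. x \<in> S \<Longrightarrow> f x = g x) \<Longrightarrow> smooth_on S f \<Longrightarrow> smooth_on S g"
  unfolding smooth_on_def by (blast intro: Ck_on_cong)

lemma smooth_on_subset: "smooth_on S f \<Longrightarrow> T \<subseteq> S \<Longrightarrow> smooth_on T f"
  unfolding smooth_on_def by (blast intro: Ck_on_subset)

lemma smooth_on_local:
  "(\<And>x. x \<in> S \<Longrightarrow> \<exists>T. open T \<and> x \<in> T \<and> smooth_on T f) \<Longrightarrow> smooth_on S f"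
  unfolding smooth_on_def by (meson Ck_on_local)

lemma smooth_on_compose:
  fixes f :: "'a::real_normed_vector \<Rightarrow> 'b::euclidean_space" and g :: "'b \<Rightarrow> 'c::real_normed_vector"
  assumes "open S" "open T" "f ` S \<subseteq> T" "smooth_on S f" "smooth_on T g"
  shows "smooth_on S (\<lambda>x. g (f x))"
  unfolding smooth_on_def
proof
  show "Ck_on k S (\<lambda>x. g (f x))" for k
    using assms(4,5) by (auto simp: smooth_on_def Ck_on_compose[OF assms(1-3)])
qed

lemma smooth_on_has_derivative:
  "smooth_on S f \<Longrightarrow> x \<in> S \<Longrightarrow> (f has_derivative frechet_derivative f (at x)) (at x)"
  unfolding smooth_on_def using Ck_on_Suc_has_derivative by blast

lemma smooth_on_Pair:
  "open S \<Longrightarrow> smooth_on S f \<Longrightarrow> smooth_on S g \<Longrightarrow> smooth_on S (\<lambda>x. (f x, g x))"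
  unfolding smooth_on_def by (blast intro: Ck_on_Pair)

lemma smooth_on_const: "open S \<Longrightarrow> smooth_on S (\<lambda>x. c)"
  unfolding smooth_on_def by (blast intro: Ck_on_const)

lemma smooth_on_ident: "open S \<Longrightarrow> smooth_on S (\<lambda>x. x)"
  unfolding smooth_on_def by (blast intro: Ck_on_bounded_linear bounded_linear_ident)


section \<open>Existence and uniqueness for autonomous differential equations\<close>

text \<open>Partial derivatives are bounded on the compact ball, and convexity turns that bound into
  a Lipschitz constant.\<close>

lemma Ck_on_lipschitz_cball:
  fixes V :: "'a::euclidean_space \<Rightarrow> 'b::euclidean_space"
  assumes "Ck_on 1 S V" "cball p \<rho> \<subseteq> S"
  obtains L where "L \<ge> 0" "\<And>x y. x \<in> cball p \<rho> \<Longrightarrow> y \<in> cball p \<rho> \<Longrightarrow> dist (V x) (V y) \<le> L * dist x y"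
proof -
  have "\<exists>K. \<forall>x\<in>cball p \<rho>. norm (frechet_derivative V (at x) i) \<le> K" for i
  proof -
    have "continuous_on (cball p \<rho>) (\<lambda>x. frechet_derivative V (at x) i)"
      using assms by (auto intro: continuous_on_subset)
    then have "bounded ((\<lambda>x. frechet_derivative V (at x) i) ` cball p \<rho>)"
      by (intro compact_imp_bounded compact_continuous_image compact_cball)
    then show ?thesis by (auto simp: bounded_iff)
  qed
  then obtain K where K: "\<And>i x. x \<in> cball p \<rho> \<Longrightarrow> norm (frechet_derivative V (at x) i) \<le> K i"
    by metis
  \<comment> \<open>The ball may be empty, in which case \<open>K\<close> is arbitrary; the absolute
    values keep \<open>L\<close> nonnegative.\<close>
  define L where "L = (\<Sum>i\<in>Basis. \<bar>K i\<bar>)"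
  have L0: "L \<ge> 0" by (auto simp: L_def intro: sum_nonneg)
  have on: "onorm (frechet_derivative V (at x)) \<le> L" if "x \<in> cball p \<rho>" for x
  proof (rule onorm_le)
    fix w
    have "linear (frechet_derivative V (at x))"
      using has_derivative_linear[OF Ck_on_Suc_has_derivative[of 0 S V x]] assms that by auto
    then have "norm (frechet_derivative V (at x) w) =
        norm (\<Sum>i\<in>Basis. (w \<bullet> i) *\<^sub>R frechet_derivative V (at x) i)"
      by (subst linear_sum_Basis) auto
    also have "\<dots> \<le> (\<Sum>i\<in>Basis. norm w * \<bar>K i\<bar>)"
      using K[OF that]
      by (intro sum_norm_le) (auto intro!: mult_mono simp: Basis_le_norm intro: order_trans[OF _ abs_ge_self])
    also have "\<dots> = L * norm w" by (simp add: L_def sum_distrib_left mult.commute)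
    finally show "norm (frechet_derivative V (at x) w) \<le> L * norm w" .
  qed
  show ?thesis
  proof (rule that[OF L0])
    fix x y assume xy: "x \<in> cball p \<rho>" "y \<in> cball p \<rho>"
    have "(V has_derivative frechet_derivative V (at x)) (at x within cball p \<rho>)" if "x \<in> cball p \<rho>" for x
      using has_derivative_at_withinI[OF Ck_on_Suc_has_derivative[of 0 S V]] assms that by auto
    then have "norm (V x - V y) \<le> L * norm (x - y)"
      by (rule differentiable_bound[OF convex_cball _ on xy])
    then show "dist (V x) (V y) \<le> L * dist x y" by (simp add: dist_norm)
  qed
qed

text \<open>At a point \<open>m\<close> where the two solutions are farthest apart, the mean value
  estimate gives \<open>?D \<le> L * ?D * \<eta>\<close>, and \<open>L * \<eta> < 1\<close> forces
  \<open>?D = 0\<close>.\<close>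

lemma lipschitz_flow_unique:
  fixes V :: "'a::real_normed_vector \<Rightarrow> 'a"
  assumes V: "\<And>x y. x \<in> B \<Longrightarrow> y \<in> B \<Longrightarrow> dist (V x) (V y) \<le> L * dist x y"
    and L: "L \<ge> 0" "L * \<eta> < 1" and t: "\<bar>t\<bar> < \<eta>"
    and y: "\<And>s. \<bar>s\<bar> < \<eta> \<Longrightarrow> y s \<in> B" "\<And>s. \<bar>s\<bar> < \<eta> \<Longrightarrow> (y has_vector_derivative V (y s)) (at s)"
    and z: "\<And>s. \<bar>s\<bar> < \<eta> \<Longrightarrow> z s \<in> B" "\<And>s. \<bar>s\<bar> < \<eta> \<Longrightarrow> (z has_vector_derivative V (z s)) (at s)"
    and "y 0 = z 0"
  shows "y t = z t"
proof -
  define J where "J = {-\<bar>t\<bar>..\<bar>t\<bar>}"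
  have J: "\<bar>s\<bar> < \<eta>" "\<bar>s\<bar> \<le> \<bar>t\<bar>" if "s \<in> J" for s using that t by (auto simp: J_def)
  have d: "((\<lambda>s. y s - z s) has_vector_derivative V (y s) - V (z s)) (at s within J)" if "s \<in> J" for s
    using y(2) z(2) J(1)[OF that] by (auto intro!: has_vector_derivative_diff intro: has_vector_derivative_at_within)
  then have "continuous_on J (\<lambda>s. y s - z s)"
    by (auto simp: continuous_on_eq_continuous_within intro: has_vector_derivative_continuous)
  then have "continuous_on J (\<lambda>s. norm (y s - z s))"
    by (rule continuous_on_norm)
  then obtain m where m: "m \<in> J" "\<And>s. s \<in> J \<Longrightarrow> norm (y s - z s) \<le> norm (y m - z m)"
    using continuous_attains_sup[of J "\<lambda>s. norm (y s - z s)"] by (auto simp: J_def)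
  let ?D = "norm (y m - z m)"
  have "norm ((y m - z m) - (y 0 - z 0)) \<le> (L * ?D) * norm (m - 0)"
  proof (rule differentiable_bound[of J _ "\<lambda>s x. x *\<^sub>R (V (y s) - V (z s))"])
    show "onorm (\<lambda>x. x *\<^sub>R (V (y s) - V (z s))) \<le> L * ?D" if "s \<in> J" for s
    proof (rule onorm_le)
      fix x :: real
      have "norm (V (y s) - V (z s)) \<le> L * norm (y s - z s)"
        using V[OF y(1) z(1), of s s] J[OF that] by (simp add: dist_norm)
      also have "\<dots> \<le> L * ?D" using m(2)[OF that] L by (auto intro: mult_left_mono)
      finally have "\<bar>x\<bar> * norm (V (y s) - V (z s)) \<le> \<bar>x\<bar> * (L * ?D)" by (rule mult_left_mono) simp
      then show "norm (x *\<^sub>R (V (y s) - V (z s))) \<le> L * ?D * norm x"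
        by (simp add: mult.commute)
    qed
    show "((\<lambda>s. y s - z s) has_derivative (\<lambda>x. x *\<^sub>R (V (y s) - V (z s)))) (at s within J)"
      if "s \<in> J" for s using d[OF that] by (simp add: has_vector_derivative_def)
  qed (use m in \<open>auto simp: J_def\<close>)
  then have "?D \<le> (L * ?D) * \<bar>m\<bar>" using \<open>y 0 = z 0\<close> by simp
  also have "\<dots> \<le> (L * ?D) * \<eta>" using J(1)[OF m(1)] L by (intro mult_left_mono) auto
  finally have "?D * (1 - L * \<eta>) \<le> 0" by (simp add: algebra_simps)
  then have "?D = 0" using L(2) by (auto simp: mult_le_0_iff)
  moreover have "norm (y t - z t) \<le> ?D" by (rule m) (auto simp: J_def)
  ultimately show ?thesis by simp
qed

text \<open>Picard iteration as a contraction of the bounded continuous functions on the whole line;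
  the field and the time are both cut off so that the operator acts on that space.\<close>

lemma picard_lindelof_local:
  fixes V :: "'a::euclidean_space \<Rightarrow> 'a"
  assumes V: "\<And>x y. x \<in> cball p \<rho> \<Longrightarrow> y \<in> cball p \<rho> \<Longrightarrow> dist (V x) (V y) \<le> L * dist x y"
    and L: "L \<ge> 0" and \<rho>: "\<rho> > 0"
  obtains \<delta> y where "\<delta> > 0" "y 0 = p" "\<And>t. \<bar>t\<bar> < \<delta> \<Longrightarrow> y t \<in> cball p \<rho>"
    "\<And>t. \<bar>t\<bar> < \<delta> \<Longrightarrow> (y has_vector_derivative V (y t)) (at t)"
proof -
  \<comment> \<open>Composing with the nearest-point projection, which does not increase distances,
    makes the field globally Lipschitz and bounded. Along a curve inside the ball nothing
    changes.\<close>
  define W where "W x = V (closest_point (cball p \<rho>) x)" for x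
  have ne: "cball p \<rho> \<noteq> {}" using \<rho> by auto
  have clp: "closest_point (cball p \<rho>) x \<in> cball p \<rho>" for x
    by (rule closest_point_in_set[OF closed_cball ne])
  have W: "dist (W x) (W y) \<le> L * dist x y" for x y
    unfolding W_def using V[OF clp clp] closest_point_lipschitz[OF convex_cball closed_cball ne] L
    by (meson mult_left_mono order_trans)
  have contW: "continuous_on UNIV W"
  proof -
    have "L-lipschitz_on UNIV W" using W L by (auto simp: lipschitz_on_def)
    then show ?thesis by (rule lipschitz_on_continuous_on)
  qed
  define M where "M = norm (V p) + L * \<rho>"
  have M: "norm (W x) \<le> M" for x
  proof -
    have "dist (W x) (V p) \<le> L * dist (closest_point (cball p \<rho>) x) p"
      unfolding W_def using clp[of x] \<rho> by (intro V) auto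
    also have "\<dots> \<le> L * \<rho>" using clp[of x] L by (intro mult_left_mono) (auto simp: dist_commute)
    finally show ?thesis using norm_triangle_ineq2[of "W x" "V p"] by (simp add: M_def dist_norm)
  qed
  have M0: "M \<ge> 0" using M[of p] norm_ge_zero order_trans by blast
  \<comment> \<open>The integral from \<open>0\<close> will be a difference of two integrals over
    lengths at most \<open>2 * \<delta>\<close>, hence the factor \<open>4 * \<delta>\<close> below.
    The first bound makes the operator contract by \<open>1/2\<close>, the second keeps the curve
    within \<open>\<rho>\<close> of \<open>p\<close>; the added \<open>1\<close> keeps the
    denominators positive.\<close>
  define \<delta> where "\<delta> = min (1 / (8 * L + 1)) (\<rho> / (4 * M + 1))"
  have \<delta>: "\<delta> > 0" using L \<rho> M0 by (auto simp: \<delta>_def)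
  have \<delta>L: "4 * \<delta> * L \<le> 1/2"
  proof -
    have "\<delta> \<le> 1 / (8 * L + 1)" by (simp add: \<delta>_def)
    then have "\<delta> * (8 * L + 1) \<le> 1" using L by (simp add: field_simps)
    then show ?thesis using \<delta> by (simp add: algebra_simps)
  qed
  have \<delta>M: "4 * \<delta> * M \<le> \<rho>"
  proof -
    have "\<delta> \<le> \<rho> / (4 * M + 1)" by (simp add: \<delta>_def)
    then have "\<delta> * (4 * M + 1) \<le> \<rho>" using M0 by (simp add: field_simps)
    then show ?thesis using \<delta> by (simp add: algebra_simps)
  qed
  define c where "c t = max (-\<delta>) (min \<delta> t)" for t
  have c: "c t \<in> {-\<delta>..\<delta>}" for t using \<delta> by (auto simp: c_def)
  have cc: "continuous_on UNIV c" unfolding c_def by (intro continuous_intros)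
  \<comment> \<open>A fixed left end gives one formula on both sides of \<open>0\<close>;
    subtracting \<open>I f 0\<close> in \<open>J\<close> restores the initial value.\<close>
  define I where "I f t = integral {-\<delta>..t} f" for f :: "real \<Rightarrow> 'a" and t
  have I: "norm (I f t) \<le> 2 * \<delta> * K"
    if "continuous_on UNIV f" "\<And>s. norm (f s) \<le> K" "t \<in> {-\<delta>..\<delta>}" for f K t
  proof -
    have "norm (I f t) \<le> K * (t - (-\<delta>))"
      unfolding I_def using that by (intro integral_bound) (auto intro: continuous_on_subset)
    also have "\<dots> \<le> K * (2 * \<delta>)"
      using that(3) order_trans[OF norm_ge_zero that(2)] by (intro mult_left_mono) auto
    finally show ?thesis by (simp add: mult_ac)
  qed
  define J where "J f t = p + (I f (c t) - I f 0)" for f t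
  have contWy: "continuous_on UNIV (\<lambda>t. W (apply_bcontfun y t))" for y
    by (rule continuous_on_compose2[OF contW]) auto
  have J: "J (\<lambda>t. W (apply_bcontfun y t)) \<in> bcontfun" for y
  proof (rule bcontfun_normI)
    have "continuous_on {-\<delta>..\<delta>} (I (\<lambda>t. W (apply_bcontfun y t)))" unfolding I_def
      by (intro indefinite_integral_continuous_1 integrable_continuous_real continuous_on_subset[OF contWy]) auto
    then have "continuous_on UNIV (\<lambda>t. I (\<lambda>t. W (apply_bcontfun y t)) (c t))"
      using c by (intro continuous_on_compose2[OF _ cc]) auto
    then show "continuous_on UNIV (J (\<lambda>t. W (apply_bcontfun y t)))"
      unfolding J_def by (intro continuous_intros)
    have "norm (J (\<lambda>t. W (apply_bcontfun y t)) t) \<le> norm p + (2 * \<delta> * M + 2 * \<delta> * M)" for t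
      unfolding J_def using \<delta> c
      by (intro norm_triangle_le add_left_mono norm_triangle_le_diff add_mono I[OF contWy M] order_refl) auto
    then show "norm (J (\<lambda>t. W (apply_bcontfun y t)) t) \<le> norm p + (2 * \<delta> * M + 2 * \<delta> * M)" for t .
  qed
  define \<Phi> where "\<Phi> y = Bcontfun (J (\<lambda>t. W (apply_bcontfun y t)))" for y
  have \<Phi>: "apply_bcontfun (\<Phi> y) = J (\<lambda>t. W (apply_bcontfun y t))" for y
    unfolding \<Phi>_def by (rule Bcontfun_inverse[OF J])
  have "\<exists>!y. \<Phi> y = y"
  proof (rule banach_fix_type[of "1/2"])
    show "\<forall>y z. dist (\<Phi> y) (\<Phi> z) \<le> 1/2 * dist y z"
    proof (intro allI dist_bound)
      fix y z :: "real \<Rightarrow>\<^sub>C 'a" and t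
      let ?f = "\<lambda>t. W (apply_bcontfun y t)" and ?g = "\<lambda>t. W (apply_bcontfun z t)"
      have diff: "I ?f s - I ?g s = I (\<lambda>t. ?f t - ?g t) s" for s
        unfolding I_def
        by (rule integral_diff[symmetric]) (intro integrable_continuous_real continuous_on_subset[OF contWy] subset_UNIV)+
      have b: "norm (?f s - ?g s) \<le> L * dist y z" for s
        using order_trans[OF W[of "apply_bcontfun y s" "apply_bcontfun z s"] mult_left_mono[OF dist_bounded L]]
        by (simp add: dist_norm)
      have ct: "continuous_on UNIV (\<lambda>s. ?f s - ?g s)" by (intro continuous_intros contWy)
      have "J ?f t - J ?g t = (I ?f (c t) - I ?g (c t)) - (I ?f 0 - I ?g 0)" by (simp add: J_def)
      also have "\<dots> = I (\<lambda>s. ?f s - ?g s) (c t) - I (\<lambda>s. ?f s - ?g s) 0" by (simp only: diff)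
      also have "norm \<dots> \<le> 2 * \<delta> * (L * dist y z) + 2 * \<delta> * (L * dist y z)"
        using \<delta> c by (intro norm_triangle_le_diff add_mono I[OF ct b]) auto
      also have "\<dots> = (4 * \<delta> * L) * dist y z" by (simp add: algebra_simps)
      also have "\<dots> \<le> 1/2 * dist y z" by (intro mult_right_mono \<delta>L) auto
      finally show "dist (\<Phi> y t) (\<Phi> z t) \<le> 1/2 * dist y z" by (simp add: \<Phi> dist_norm)
    qed
  qed auto
  then obtain y where y: "\<Phi> y = y" by blast
  let ?f = "\<lambda>t. W (apply_bcontfun y t)"
  have yt: "apply_bcontfun y t = J ?f t" for t using \<Phi>[of y] y by simp
  have yin: "apply_bcontfun y t \<in> cball p \<rho>" for t
  proof -
    have "norm (I ?f (c t) - I ?f 0) \<le> 2 * \<delta> * M + 2 * \<delta> * M"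
      using \<delta> c by (intro norm_triangle_le_diff add_mono I[OF contWy M]) auto
    moreover have "apply_bcontfun y t - p = I ?f (c t) - I ?f 0"
      using yt[of t] unfolding J_def by (metis add_diff_cancel_left')
    ultimately have "norm (apply_bcontfun y t - p) \<le> 2 * \<delta> * M + 2 * \<delta> * M"
      by metis
    also have "\<dots> \<le> \<rho>" using \<delta>M by (simp add: mult_ac)
    finally have "norm (apply_bcontfun y t - p) \<le> \<rho>" .
    then show ?thesis by (simp add: dist_norm norm_minus_commute)
  qed
  have yJ: "apply_bcontfun y s = p + (I ?f s - I ?f 0)" if "s \<in> {-\<delta><..<\<delta>}" for s
  proof -
    have "c s = s" using that by (simp add: c_def)
    then show ?thesis using yt[of s] unfolding J_def by metis
  qed
  have "(apply_bcontfun y has_vector_derivative V (apply_bcontfun y t)) (at t)" if t: "\<bar>t\<bar> < \<delta>" for t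
  proof -
    have "(I ?f has_vector_derivative ?f t) (at t within {-\<delta>..\<delta>})"
      unfolding I_def using t
      by (intro integral_has_vector_derivative continuous_on_subset[OF contWy]) auto
    then have "(I ?f has_vector_derivative ?f t) (at t)"
      using t at_within_Icc_at[of "-\<delta>" t \<delta>] by auto
    then have "((\<lambda>s. p + (I ?f s - I ?f 0)) has_vector_derivative ?f t) (at t)"
      by (auto intro!: derivative_eq_intros)
    then have "(apply_bcontfun y has_vector_derivative ?f t) (at t)"
      by (rule has_vector_derivative_transform_within_open[where S = "{-\<delta><..<\<delta>}"])
        (use t yJ in auto)
    moreover have "?f t = V (apply_bcontfun y t)" by (simp add: W_def closest_point_self[OF yin])
    ultimately show ?thesis by simp
  qed
  moreover have "apply_bcontfun y 0 = p" using \<delta> yJ[of 0] by simp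
  ultimately show ?thesis using that[of \<delta> "apply_bcontfun y"] \<delta> yin by blast
qed

text \<open>Uniqueness is stated for any two solutions in \<open>B\<close>, because it will be
  applied to translates of the constructed curve. \<open>B\<close> is open so that membership in it
  persists under small changes.\<close>

lemma picard_lindelof:
  fixes V :: "'a::euclidean_space \<Rightarrow> 'a"
  assumes "open S" "p \<in> S" "Ck_on 1 S V"
  obtains \<delta> B y where "\<delta> > 0" "open B" "p \<in> B" "B \<subseteq> S" "y 0 = p"
    "\<And>t. \<bar>t\<bar> < \<delta> \<Longrightarrow> y t \<in> B" "\<And>t. \<bar>t\<bar> < \<delta> \<Longrightarrow> (y has_vector_derivative V (y t)) (at t)"
    "\<And>\<eta> y z t. \<eta> \<le> \<delta> \<Longrightarrow> \<bar>t\<bar> < \<eta> \<Longrightarrow> y 0 = z 0 \<Longrightarrow>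
       (\<And>s. \<bar>s\<bar> < \<eta> \<Longrightarrow> y s \<in> B \<and> (y has_vector_derivative V (y s)) (at s)) \<Longrightarrow>
       (\<And>s. \<bar>s\<bar> < \<eta> \<Longrightarrow> z s \<in> B \<and> (z has_vector_derivative V (z s)) (at s)) \<Longrightarrow> y t = z t"
proof -
  obtain \<rho> where \<rho>: "\<rho> > 0" "cball p \<rho> \<subseteq> S" using assms open_contains_cball by blast
  obtain L where L: "L \<ge> 0" "\<And>x y. x \<in> cball p \<rho> \<Longrightarrow> y \<in> cball p \<rho> \<Longrightarrow> dist (V x) (V y) \<le> L * dist x y"
    using Ck_on_lipschitz_cball[OF assms(3) \<rho>(2)] by blast
  \<comment> \<open>Half the radius, so that the solution stays in the open ball that will serve as
    \<open>B\<close>.\<close>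
  obtain \<delta> y where y: "\<delta> > 0" "y 0 = p" "\<And>t. \<bar>t\<bar> < \<delta> \<Longrightarrow> y t \<in> cball p (\<rho>/2)"
    "\<And>t. \<bar>t\<bar> < \<delta> \<Longrightarrow> (y has_vector_derivative V (y t)) (at t)"
    using picard_lindelof_local[of p "\<rho>/2" V L] L \<rho> by auto
  define \<delta>' where "\<delta>' = min \<delta> (1 / (L + 1))"
  have "\<delta>' > 0" using y(1) L by (simp add: \<delta>'_def)
  moreover have "L * \<eta> < 1" if "\<eta> \<le> \<delta>'" for \<eta>
  proof -
    have "\<eta> \<le> 1 / (L + 1)" using that by (simp add: \<delta>'_def)
    then have "\<eta> * (L + 1) \<le> 1" using L by (simp add: field_simps)
    moreover have "L * \<eta> < 1" if "\<eta> \<le> 0" using that L mult_nonneg_nonpos[of L \<eta>] by linarith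
    ultimately show ?thesis by (cases "\<eta> \<le> 0") (auto simp: algebra_simps)
  qed
  moreover have "y t \<in> ball p \<rho>" if "\<bar>t\<bar> < \<delta>'" for t
    using y(3)[of t] that \<rho> by (simp add: \<delta>'_def)
  moreover have "(y has_vector_derivative V (y t)) (at t)" if "\<bar>t\<bar> < \<delta>'" for t
    using y(4)[of t] that by (simp add: \<delta>'_def)
  moreover have "ball p \<rho> \<subseteq> S" using \<rho>(2) ball_subset_cball by blast
  ultimately show ?thesis
    using \<rho>(1) y(2) L
    by (intro that[of \<delta>' "ball p \<rho>" y])
      (auto intro!: lipschitz_flow_unique[where B = "ball p \<rho>" and V = V and L = L])
qed


section \<open>Bump functions, uniform boundedness, and averages along a flow\<close>

definition flat_exp :: "nat \<Rightarrow> real \<Rightarrow> real" where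
  "flat_exp n t = (if t > 0 then exp (- inverse t) * inverse t ^ n else 0)"

lemma flat_exp_tendsto_0: "(flat_exp n \<longlongrightarrow> 0) (at 0)"
proof (rule filterlim_split_at)
  show "(flat_exp n \<longlongrightarrow> 0) (at_left 0)"
    by (rule tendsto_eventually)
      (auto simp: flat_exp_def eventually_at_left_field intro!: exI[of _ "-1"])
  have "((\<lambda>t. inverse t ^ n / exp (inverse t)) \<longlongrightarrow> 0) (at_right (0::real))"
    by (rule filterlim_compose[OF tendsto_power_div_exp_0 filterlim_inverse_at_top_right])
  then show "(flat_exp n \<longlongrightarrow> 0) (at_right 0)"
    by (rule Lim_transform_eventually)
      (auto simp: eventually_at_right_field flat_exp_def exp_minus field_simps intro!: exI[of _ 1])
qed

lemma flat_exp_has_derivative: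
  "(flat_exp n has_real_derivative flat_exp (n + 2) t - real n * flat_exp (n + 1) t) (at t)"
proof -
  consider "t > 0" | "t < 0" | "t = 0" by linarith
  then show ?thesis
  proof cases
    case 1
    have "((\<lambda>t. exp (- inverse t) * inverse t ^ n) has_real_derivative
        flat_exp (n + 2) t - real n * flat_exp (n + 1) t) (at t)"
    proof (rule DERIV_cong)
      show "((\<lambda>t. exp (- inverse t) * inverse t ^ n) has_real_derivative
          exp (- inverse t) * (inverse t * inverse t) * inverse t ^ n +
          real n * (- (inverse t * inverse t) * inverse t ^ (n - Suc 0)) * exp (- inverse t)) (at t)"
        using 1 by (intro DERIV_mult DERIV_power) (auto intro!: derivative_eq_intros)
      show "exp (- inverse t) * (inverse t * inverse t) * inverse t ^ n +
          real n * (- (inverse t * inverse t) * inverse t ^ (n - Suc 0)) * exp (- inverse t) =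
          flat_exp (n + 2) t - real n * flat_exp (n + 1) t"
        using 1 by (cases n) (simp_all add: flat_exp_def algebra_simps)
    qed
    then show ?thesis
      by (rule has_field_derivative_transform_within_open[where S = "{0<..}"])
        (use 1 in \<open>auto simp: flat_exp_def\<close>)
  next
    case 2
    have "((\<lambda>t. 0) has_real_derivative flat_exp (n + 2) t - real n * flat_exp (n + 1) t) (at t)"
      using 2 by (auto simp: flat_exp_def)
    then show ?thesis
      by (rule has_field_derivative_transform_within_open[where S = "{..<0}"])
        (use 2 in \<open>auto simp: flat_exp_def\<close>)
  next
    case 3
    \<comment> \<open>The difference quotient at \<open>0\<close> is the next member
      \<open>flat_exp (Suc n)\<close> of the family, since \<open>flat_exp n 0 = 0\<close>.\<close>
    have "((\<lambda>y. (flat_exp n y - flat_exp n 0) / (y - 0)) \<longlongrightarrow> 0) (at 0)"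
      by (rule Lim_transform_eventually[OF flat_exp_tendsto_0[of "Suc n"]])
        (auto simp: flat_exp_def field_simps)
    then show ?thesis using 3
      by (simp add: has_field_derivative_iff flat_exp_def)
  qed
qed

text \<open>The powers of \<open>inverse t\<close> are there to make the family closed under
  differentiation up to linear combinations, so one induction, over all \<open>n\<close> together,
  suffices.\<close>

lemma Ck_on_flat_exp: "Ck_on k UNIV (flat_exp n)"
proof (induction k arbitrary: n)
  case 0
  show ?case
    by (auto intro!: continuous_at_imp_continuous_on DERIV_isCont flat_exp_has_derivative)
next
  case (Suc k)
  have "Ck_on k UNIV (\<lambda>t. flat_exp (n + 2) t + (- real n) * flat_exp (n + 1) t)"
    using Suc by (intro Ck_on_add Ck_on_mult Ck_on_const) auto
  then show ?case
    using flat_exp_has_derivative[of n]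
    by (intro Ck_on_vector_derivative[where f' = "\<lambda>t. flat_exp (n + 2) t - real n * flat_exp (n + 1) t"])
      (auto simp: has_real_derivative_iff_has_vector_derivative)
qed

text \<open>The squared distance keeps the inner argument polynomial, hence smooth at the centre as
  well.\<close>

definition ball_bump :: "'a::euclidean_space \<Rightarrow> real \<Rightarrow> 'a \<Rightarrow> real" where
  "ball_bump p \<rho> y = flat_exp 0 (\<rho>\<^sup>2 - (y - p) \<bullet> (y - p))"

lemma Ck_on_ball_bump: "Ck_on k UNIV (ball_bump p \<rho>)"
proof -
  have id: "Ck_on k UNIV (\<lambda>y. y + - p)" 
    by (intro Ck_on_add Ck_on_const Ck_on_bounded_linear bounded_linear_ident open_UNIV)
  have "Ck_on k UNIV (\<lambda>y. \<rho>\<^sup>2 + (-1) * ((y + - p) \<bullet> (y + - p)))"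
    by (intro Ck_on_add[OF _ Ck_on_const] Ck_on_mult[OF _ Ck_on_const] Ck_on_inner id open_UNIV)
  from Ck_on_compose[OF _ _ _ this Ck_on_flat_exp, of 0]
  show ?thesis by (simp add: ball_bump_def[abs_def])
qed

lemma ball_bump_pos: "y \<in> ball p \<rho> \<Longrightarrow> ball_bump p \<rho> y > 0"
proof -
  assume "y \<in> ball p \<rho>"
  then have "norm (y - p) < \<rho>" by (simp add: dist_norm norm_minus_commute)
  then have "(norm (y - p))\<^sup>2 < \<rho>\<^sup>2" by (intro power_strict_mono) auto
  then show ?thesis by (simp add: ball_bump_def flat_exp_def power2_norm_eq_inner)
qed

lemma ball_bump_eq_0: "y \<notin> cball p \<rho> \<Longrightarrow> \<rho> > 0 \<Longrightarrow> ball_bump p \<rho> y = 0"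
proof -
  assume "y \<notin> cball p \<rho>" "\<rho> > 0"
  then have "\<rho> < norm (y - p)" by (simp add: dist_norm norm_minus_commute)
  then have "\<rho>\<^sup>2 < (norm (y - p))\<^sup>2" using \<open>\<rho> > 0\<close> by (intro power_strict_mono) auto
  then show ?thesis by (simp add: ball_bump_def flat_exp_def power2_norm_eq_inner)
qed

lemma ball_bump_nonneg: "ball_bump p \<rho> y \<ge> 0"
  by (simp add: ball_bump_def flat_exp_def)

section \<open>Uniform boundedness by Baire category\<close>

lemma weakly_bounded_imp_bounded:
  fixes w :: "nat \<Rightarrow> 'h::{real_inner,complete_space}"
  assumes "\<And>x. bounded (range (\<lambda>k. w k \<bullet> x))"
  shows "bounded (range w)"
proof -
  \<comment> \<open>These closed sets cover the space, so one of them contains a ball; there all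
    functionals share the bound \<open>n\<close>.\<close>
  define F where "F n = {x. \<forall>k. \<bar>w k \<bullet> x\<bar> \<le> real n}" for n
  have F: "closed (F n)" for n
    unfolding F_def by (intro closed_Collect_all closed_Collect_le continuous_intros)
  have UN: "\<Union>(range F) = UNIV"
  proof -
    have "\<exists>n. x \<in> F n" for x
    proof -
      obtain B where B: "\<And>k. \<bar>w k \<bullet> x\<bar> \<le> B" using assms[of x] by (auto simp: bounded_iff)
      obtain n where "B \<le> real n" using real_arch_simple by blast
      then show ?thesis using B order_trans by (auto simp: F_def intro!: exI[of _ n])
    qed
    then show ?thesis by auto
  qed
  have "\<exists>n. interior (F n) \<noteq> {}"
  proof (rule ccontr)
    assume "\<not> ?thesis"
    then have "euclidean interior_of \<Union>(range F) = ({} :: 'h set)"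
      using F by (intro Baire_category_alt disjI1 completely_metrizable_space_euclidean)
        (auto simp: euclidean_interior_of)
    then show False using UN by (simp add: euclidean_interior_of)
  qed
  then obtain n x r where r: "r > 0" "ball x r \<subseteq> F n" by (auto simp: mem_interior)
  have "norm (w k) \<le> 4 * real n / r" for k
  proof (cases "w k = 0")
    case False
    \<comment> \<open>Half the radius in the direction of \<open>w k\<close>. The value
      \<open>w k \<bullet> z\<close> is a difference of two values bounded by \<open>n\<close>,
      whence \<open>2 * real n\<close>.\<close>
    define z where "z = (r / (2 * norm (w k))) *\<^sub>R w k"
    have "norm z < r" using False r by (simp add: z_def)
    then have "x + z \<in> F n" "x \<in> F n" using r by (auto simp: dist_norm)
    then have "\<bar>w k \<bullet> (x + z)\<bar> \<le> n" "\<bar>w k \<bullet> x\<bar> \<le> n" by (auto simp: F_def)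
    then have "w k \<bullet> z \<le> 2 * real n" by (simp add: inner_add_right)
    moreover have "w k \<bullet> z = (r / 2) * norm (w k)"
      using False by (simp add: z_def dot_square_norm power2_eq_square)
    ultimately show ?thesis using r by (simp add: field_simps)
  qed (use r in auto)
  then show ?thesis by (auto simp: bounded_iff)
qed

section \<open>Integration by parts for compactly supported fields\<close>

lemma integral_directional_derivative_eq_0:
  fixes g :: "'a::euclidean_space \<Rightarrow> real"
  assumes g: "Ck_on 1 UNIV g" and z: "\<And>y. y \<notin> cbox a b \<Longrightarrow> g y = 0"
  shows "integral (cbox a b) (\<lambda>y. frechet_derivative g (at y) e) = 0"
proof -
  \<comment> \<open>One box is to contain the translates of the support box for all \<open>t\<close>
    in \<open>{-1..1}\<close>. Over it the integral of the translated function does not depend on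
    \<open>t\<close>, and differentiating under the integral at \<open>0\<close> gives the
    claim.\<close>
  have "bounded ((\<lambda>(t, x). x - t *\<^sub>R e) ` ({-1..1} \<times> cbox a b))"
    by (intro compact_imp_bounded compact_continuous_image compact_Times compact_cbox compact_Icc)
      (auto simp: split_beta intro!: continuous_intros)
  then obtain a' b' where sub: "(\<lambda>(t, x). x - t *\<^sub>R e) ` ({-1..1} \<times> cbox a b) \<subseteq> cbox a' b'"
    using bounded_subset_cbox_symmetric by metis
  define g' where "g' y = frechet_derivative g (at y) e" for y
  have cg: "continuous_on UNIV g" "continuous_on UNIV g'"
    using Ck_on_continuous[OF g] g by (auto simp: g'_def)
  have gd: "(g has_derivative frechet_derivative g (at y)) (at y)" for y
    using Ck_on_Suc_has_derivative[of 0 UNIV g y] g by simp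
  define I where "I = integral (cbox a b) g"
  have I: "((\<lambda>y. g (y + t *\<^sub>R e)) has_integral I) (cbox a' b')" if t: "t \<in> {-1..1}" for t
  proof (rule has_integral_on_superset)
    have "(g has_integral I) (cbox a b)"
      unfolding I_def by (intro integrable_integral integrable_continuous continuous_on_subset[OF cg(1)]) auto
    then have "(g has_integral I) (cbox ((a - t *\<^sub>R e) + t *\<^sub>R e) ((b - t *\<^sub>R e) + t *\<^sub>R e))" by simp
    then show "((\<lambda>y. g (y + t *\<^sub>R e)) has_integral I) (cbox (a - t *\<^sub>R e) (b - t *\<^sub>R e))"
      by (subst (asm) has_integral_shift_cbox_iff[symmetric]) (simp add: o_def add.commute)
    have shift: "y \<in> cbox (a - t *\<^sub>R e) (b - t *\<^sub>R e) \<longleftrightarrow> y + t *\<^sub>R e \<in> cbox a b" for y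
      by (auto simp: mem_box inner_simps)
    show "g (y + t *\<^sub>R e) = 0" if "y \<notin> cbox (a - t *\<^sub>R e) (b - t *\<^sub>R e)" for y
      using that z by (simp add: shift)
    show "cbox (a - t *\<^sub>R e) (b - t *\<^sub>R e) \<subseteq> cbox a' b'"
    proof
      fix y assume "y \<in> cbox (a - t *\<^sub>R e) (b - t *\<^sub>R e)"
      then have "(\<lambda>(t, x). x - t *\<^sub>R e) (t, y + t *\<^sub>R e) \<in> cbox a' b'"
        using sub t shift by blast
      then show "y \<in> cbox a' b'" by simp
    qed
  qed
  have "((\<lambda>t. integral (cbox a' b') (\<lambda>y. g (y + t *\<^sub>R e))) has_vector_derivative
      integral (cbox a' b') (\<lambda>y. g' (y + 0 *\<^sub>R e))) (at 0 within {-1..1})"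
  proof (rule leibniz_rule_vector_derivative)
    fix t y assume "t \<in> {-1..1::real}" "y \<in> cbox a' b'"
    have "((\<lambda>t. y + t *\<^sub>R e) has_derivative (\<lambda>s. s *\<^sub>R e)) (at t within {-1..1})"
      by (auto intro!: derivative_eq_intros)
    from has_derivative_compose[OF this gd]
    show "((\<lambda>t. g (y + t *\<^sub>R e)) has_vector_derivative g' (y + t *\<^sub>R e)) (at t within {-1..1})"
      by (simp add: has_vector_derivative_def g'_def linear_cmul[OF has_derivative_linear[OF gd]])
  next
    show "continuous_on ({-1..1} \<times> cbox a' b') (\<lambda>(t, y). g' (y + t *\<^sub>R e))"
      unfolding split_beta by (rule continuous_on_compose2[OF cg(2)]) (auto intro!: continuous_intros)
  qed (use I in auto)
  moreover have "((\<lambda>t. integral (cbox a' b') (\<lambda>y. g (y + t *\<^sub>R e))) has_vector_derivative 0) (at 0 within {-1..1})"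
    by (rule has_vector_derivative_transform[where f = "\<lambda>_. I"]) (use I in \<open>auto simp: integral_unique\<close>)
  ultimately have eq: "integral (cbox a' b') g' = 0"
    using vector_derivative_unique_within[of 0 "{-1..1::real}"]
    by (auto simp: trivial_limit_within islimpt_Icc) 
  have g'0: "g' y = 0" if "y \<notin> cbox a b" for y
  proof -
    have "(g has_derivative (\<lambda>_. 0)) (at y)"
      by (rule has_derivative_transform_within_open[of "\<lambda>_. 0" _ _ _ "- cbox a b"])
        (use that z in \<open>auto simp: closed_cbox open_Compl\<close>)
    from has_derivative_unique[OF this gd] show ?thesis by (metis g'_def)
  qed
  have "(g' has_integral integral (cbox a b) g') (cbox a b)"
    by (intro integrable_integral integrable_continuous continuous_on_subset[OF cg(2)]) auto
  then have "(g' has_integral integral (cbox a b) g') (cbox a' b')"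
  proof (rule has_integral_on_superset[OF _ g'0])
    show "cbox a b \<subseteq> cbox a' b'"
    proof
      fix y assume "y \<in> cbox a b"
      then have "(\<lambda>(t, x). x - t *\<^sub>R e) (0, y) \<in> cbox a' b'"
        by (intro subsetD[OF sub] imageI) auto
      then show "y \<in> cbox a' b'" by simp
    qed
  qed
  then show ?thesis using eq by (simp add: g'_def[abs_def] integral_unique)
qed

definition divergence :: "('a::euclidean_space \<Rightarrow> 'a) \<Rightarrow> 'a \<Rightarrow> real" where
  "divergence X y = (\<Sum>i\<in>Basis. frechet_derivative X (at y) i \<bullet> i)"

lemma continuous_on_divergence:
  "Ck_on 1 S X \<Longrightarrow> continuous_on S (divergence X)"
  unfolding divergence_def by (intro continuous_on_sum continuous_on_inner continuous_on_const) simp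

text \<open>Each component of the field \<open>F X\<close> has a directional derivative of integral
  zero; the product rule splits the sum of these over the basis into the two integrands.\<close>

lemma integral_by_parts_divergence:
  fixes X :: "'a::euclidean_space \<Rightarrow> 'a" and F :: "'a \<Rightarrow> real"
  assumes "open S" "cbox a b \<subseteq> S" "Ck_on 1 S X" "Ck_on 1 S F"
    and K: "closed K" "K \<subseteq> cbox a b" "\<And>y. y \<in> S - K \<Longrightarrow> X y = 0"
  shows "integral (cbox a b) (\<lambda>y. frechet_derivative F (at y) (X y)) =
    - integral (cbox a b) (\<lambda>y. F y * divergence X y)"
proof -
  have dX: "(X has_derivative frechet_derivative X (at y)) (at y)" if "y \<in> S" for y
    using Ck_on_Suc_has_derivative[of 0 S X y] assms that by simp
  have dF: "(F has_derivative frechet_derivative F (at y)) (at y)" if "y \<in> S" for y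
    using Ck_on_Suc_has_derivative[of 0 S F y] assms that by simp
  \<comment> \<open>The extension by zero vanishes on the open set \<open>- K\<close>, and
    \<open>S\<close> and \<open>- K\<close> cover the space because \<open>K\<close> lies in
    \<open>S\<close>; hence it is continuously differentiable everywhere.\<close>
  define g where "g i y = (if y \<in> S then F y * (X y \<bullet> i) else 0)" for i y
  have g: "Ck_on 1 UNIV (g i)" for i
  proof (rule Ck_on_local)
    fix y
    show "\<exists>T. open T \<and> y \<in> T \<and> Ck_on 1 T (g i)"
    proof (cases "y \<in> S")
      case True
      have "Ck_on 1 S (\<lambda>y. F y * (X y \<bullet> i))"
        using assms by (intro Ck_on_mult Ck_on_inner Ck_on_const)
      then have "Ck_on 1 S (g i)"
        by (rule Ck_on_cong[OF \<open>open S\<close>, rotated]) (simp add: g_def)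
      then show ?thesis using True \<open>open S\<close> by blast
    next
      case False
      have "Ck_on 1 (- K) (\<lambda>_. 0 :: real)" using K by (intro Ck_on_const) (simp add: open_Compl)
      then have "Ck_on 1 (- K) (g i)"
        by (rule Ck_on_cong[rotated 2]) (use K in \<open>auto simp: g_def open_Compl\<close>)
      moreover have "y \<in> - K" using False K assms(2) by auto
      ultimately show ?thesis using K(1) by (blast intro: open_Compl)
    qed
  qed
  have g0: "g i y = 0" if "y \<notin> cbox a b" for i y
  proof (cases "y \<in> S")
    case True
    then have "X y = 0" using that K by blast
    then show ?thesis by (simp add: g_def)
  qed (simp add: g_def)
  have gd: "frechet_derivative (g i) (at y) i =
      F y * (frechet_derivative X (at y) i \<bullet> i) + frechet_derivative F (at y) i * (X y \<bullet> i)"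
    if "y \<in> S" for i y
  proof -
    have "((\<lambda>y. F y * (X y \<bullet> i)) has_derivative
      (\<lambda>v. F y * (frechet_derivative X (at y) v \<bullet> i) + frechet_derivative F (at y) v * (X y \<bullet> i))) (at y)"
      by (rule has_derivative_eq_rhs, rule has_derivative_mult[OF dF[OF that]])
        (auto intro!: has_derivative_inner_left dX[OF that])
    then have "(g i has_derivative
      (\<lambda>v. F y * (frechet_derivative X (at y) v \<bullet> i) + frechet_derivative F (at y) v * (X y \<bullet> i))) (at y)"
      by (rule has_derivative_transform_within_open[OF _ \<open>open S\<close> that]) (simp add: g_def)
    from frechet_derivative_at[OF this] show ?thesis by metis
  qed
  have sum: "(\<Sum>i\<in>Basis. frechet_derivative (g i) (at y) i) =
      F y * divergence X y + frechet_derivative F (at y) (X y)" if "y \<in> S" for y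
  proof -
    have "frechet_derivative F (at y) (X y) = (\<Sum>i\<in>Basis. (X y \<bullet> i) *\<^sub>R frechet_derivative F (at y) i)"
      by (rule linear_sum_Basis[OF has_derivative_linear[OF dF[OF that]]])
    then show ?thesis
      by (simp add: gd[OF that] divergence_def sum.distrib sum_distrib_left mult.commute)
  qed
  have c1: "continuous_on (cbox a b) (\<lambda>y. frechet_derivative (g i) (at y) i)" for i
    using g[of i] by (auto intro: continuous_on_subset)
  have c2: "continuous_on (cbox a b) (\<lambda>y. F y * divergence X y)"
    using assms by (intro continuous_on_mult continuous_on_subset[OF _ assms(2)]
        continuous_on_divergence Ck_on_continuous)
  have "Ck_on 0 S (\<lambda>y. frechet_derivative F (at y) (X y))"
    by (rule Ck_on_frechet_derivative[where T = S and h = "\<lambda>y. y"])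
      (use assms Ck_on_mono[OF assms(3), of 0] in \<open>auto intro: Ck_on_bounded_linear bounded_linear_ident\<close>)
  then have c3: "continuous_on (cbox a b) (\<lambda>y. frechet_derivative F (at y) (X y))"
    using assms(2) by (auto intro: continuous_on_subset)
  have "0 = (\<Sum>i\<in>Basis. integral (cbox a b) (\<lambda>y. frechet_derivative (g i) (at y) i))"
    using integral_directional_derivative_eq_0[OF g g0] by simp
  also have "\<dots> = integral (cbox a b) (\<lambda>y. \<Sum>i\<in>Basis. frechet_derivative (g i) (at y) i)"
    by (rule integral_sum[symmetric]) (auto intro: integrable_continuous c1)
  also have "\<dots> = integral (cbox a b) (\<lambda>y. F y * divergence X y + frechet_derivative F (at y) (X y))"
    by (rule integral_cong) (use sum assms(2) in auto)
  also have "\<dots> = integral (cbox a b) (\<lambda>y. F y * divergence X y) +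
      integral (cbox a b) (\<lambda>y. frechet_derivative F (at y) (X y))"
    by (rule integral_add) (auto intro: integrable_continuous c2 c3)
  finally show ?thesis by simp
qed

text \<open>The hypothesis \<open>transport\<close> trades the time derivative for a derivative
  along \<open>Z\<close>, which integration by parts then takes off \<open>E\<close>. Only the
  supremum \<open>B\<close> of \<open>E\<close> remains, so the estimate survives uniform
  limits.\<close>

lemma flow_average_estimate:
  fixes E :: "real \<times> 'a::euclidean_space \<Rightarrow> real" and Z :: "'a \<Rightarrow> 'a" and \<psi> :: "'a \<Rightarrow> real"
  assumes W: "open W" "Ck_on 1 W E" "{0..s0} \<times> cbox a b \<subseteq> W"
    and S: "open S" "cbox a b \<subseteq> S" "Ck_on 1 S Z" "Ck_on 1 S \<psi>"
    and K: "closed K" "K \<subseteq> cbox a b" "\<And>y. y \<in> S - K \<Longrightarrow> \<psi> y = 0"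
    and transport: "\<And>s y. s \<in> {0..s0} \<Longrightarrow> y \<in> cbox a b \<Longrightarrow>
      frechet_derivative E (at (s, y)) (1, 0) = frechet_derivative E (at (s, y)) (0, Z y)"
    and B: "\<And>s y. s \<in> {0..s0} \<Longrightarrow> y \<in> cbox a b \<Longrightarrow> \<bar>E (s, y)\<bar> \<le> B"
    and s: "s \<in> {0..s0}"
  shows "\<bar>integral (cbox a b) (\<lambda>y. \<psi> y * E (s, y)) - integral (cbox a b) (\<lambda>y. \<psi> y * E (0, y))\<bar>
    \<le> s * (B * integral (cbox a b) (\<lambda>y. \<bar>divergence (\<lambda>y. \<psi> y *\<^sub>R Z y) y\<bar>))"
proof -
  define X where "X y = \<psi> y *\<^sub>R Z y" for y
  have X: "Ck_on 1 S X" unfolding X_def using S by (intro Ck_on_scaleR)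
  have contE: "continuous_on ({0..s0} \<times> cbox a b) E"
    using Ck_on_continuous[OF W(2)] W(3) by (rule continuous_on_subset)
  have cont\<psi>: "continuous_on (cbox a b) \<psi>"
    using Ck_on_continuous[OF S(4)] S(2) by (rule continuous_on_subset)
  have contd: "continuous_on (cbox a b) (divergence X)"
    using continuous_on_divergence[OF X] S(2) by (rule continuous_on_subset)
  define D where "D t y = frechet_derivative E (at (t, y)) (1, 0)" for t y
  have dE: "(E has_derivative frechet_derivative E (at (t, y))) (at (t, y))"
    if "t \<in> {0..s0}" "y \<in> cbox a b" for t y
  proof (rule Ck_on_Suc_has_derivative)
    show "Ck_on (Suc 0) W E" using W by simp
    show "(t, y) \<in> W" using W(3) that by blast
  qed
  have contEy: "continuous_on (cbox a b) (\<lambda>y. E (t, y))" if "t \<in> {0..s0}" for t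
    using that by (intro continuous_on_compose2[OF contE] continuous_intros) auto
  have D: "integral (cbox a b) (\<lambda>y. \<psi> y * D t y) = - integral (cbox a b) (\<lambda>y. E (t, y) * divergence X y)"
    if t: "t \<in> {0..s0}" for t
  proof -
    \<comment> \<open>The slice of \<open>W\<close> at time \<open>t\<close> within
      \<open>S\<close>: an open neighbourhood of the box on which \<open>E (t, y)\<close> is
      differentiable in \<open>y\<close>.\<close>
    define S' where "S' = S \<inter> {y. (t, y) \<in> W}"
    have S': "open S'" "cbox a b \<subseteq> S'"
    proof -
      have "open ((\<lambda>y. (t, y)) -` W)" by (intro open_vimage W continuous_intros)
      then show "open S'" using S(1) by (auto simp: S'_def vimage_def)
      show "cbox a b \<subseteq> S'" using S W t by (auto simp: S'_def)
    qed
    have pr: "Ck_on 1 S' (\<lambda>y. (t, y))"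
      using S' by (intro Ck_on_Pair Ck_on_const Ck_on_bounded_linear bounded_linear_ident)
    have F: "Ck_on 1 S' (\<lambda>y. E (t, y))"
      by (rule Ck_on_compose[OF S'(1) W(1) _ pr W(2)]) (auto simp: S'_def)
    have X': "Ck_on 1 S' X" using X by (rule Ck_on_subset) (auto simp: S'_def)
    have "integral (cbox a b) (\<lambda>y. \<psi> y * D t y) =
      integral (cbox a b) (\<lambda>y. frechet_derivative (\<lambda>y. E (t, y)) (at y) (X y))"
    proof (rule integral_cong)
      fix y assume y: "y \<in> cbox a b"
      have "((\<lambda>y. (t, y)) has_derivative (\<lambda>v. (0, v))) (at y)" by (auto intro!: derivative_eq_intros)
      from has_derivative_compose[OF this dE[OF t y]]
      have "((\<lambda>y. E (t, y)) has_derivative (\<lambda>v. frechet_derivative E (at (t, y)) (0, v))) (at y)" .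
      from frechet_derivative_at[OF this]
      have "frechet_derivative (\<lambda>y. E (t, y)) (at y) (X y) = frechet_derivative E (at (t, y)) (0, X y)"
        by metis
      also have "\<dots> = frechet_derivative E (at (t, y)) (\<psi> y *\<^sub>R (0, Z y))" by (simp add: X_def)
      also have "\<dots> = \<psi> y * D t y"
        using linear_cmul[OF has_derivative_linear[OF dE[OF t y]], of "\<psi> y" "(0, Z y)"] transport[OF t y]
        by (simp add: D_def)
      finally show "\<psi> y * D t y = frechet_derivative (\<lambda>y. E (t, y)) (at y) (X y)" by simp
    qed
    also have "\<dots> = - integral (cbox a b) (\<lambda>y. E (t, y) * divergence X y)"
      by (rule integral_by_parts_divergence[OF S' X' F K(1,2)]) (use K(3) in \<open>auto simp: X_def S'_def\<close>)
    finally show ?thesis .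
  qed
  let ?C = "B * integral (cbox a b) (\<lambda>y. \<bar>divergence X y\<bar>)"
  define G where "G t = integral (cbox a b) (\<lambda>y. \<psi> y * E (t, y))" for t
  have G: "(G has_vector_derivative integral (cbox a b) (\<lambda>y. \<psi> y * D t y)) (at t within {0..s0})"
    if t: "t \<in> {0..s0}" for t
    unfolding G_def
  proof (rule leibniz_rule_vector_derivative)
    fix r y assume ry: "r \<in> {0..s0}" "y \<in> cbox a b"
    have "((\<lambda>r. (r, y)) has_derivative (\<lambda>v. v *\<^sub>R (1, 0))) (at r within {0..s0})"
      by (auto intro!: derivative_eq_intros)
    from has_derivative_compose[OF this dE[OF ry]]
    have "((\<lambda>r. E (r, y)) has_derivative (\<lambda>v. frechet_derivative E (at (r, y)) (v *\<^sub>R (1, 0))))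
      (at r within {0..s0})" .
    moreover have "(\<lambda>v. frechet_derivative E (at (r, y)) (v *\<^sub>R (1, 0))) = (\<lambda>v. v *\<^sub>R D r y)"
      unfolding D_def by (rule ext) (rule linear_cmul[OF has_derivative_linear[OF dE[OF ry]]])
    ultimately have "((\<lambda>r. E (r, y)) has_vector_derivative D r y) (at r within {0..s0})"
      by (simp only: has_vector_derivative_def)
    then show "((\<lambda>r. \<psi> y * E (r, y)) has_vector_derivative \<psi> y * D r y) (at r within {0..s0})"
      by (rule has_vector_derivative_mult_right)
  next
    show "(\<lambda>y. \<psi> y * E (r, y)) integrable_on cbox a b" if "r \<in> {0..s0}" for r
      by (intro integrable_continuous continuous_on_mult cont\<psi> contEy that)
    have "continuous_on W (\<lambda>z. frechet_derivative E (at z) (1, 0))"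
      using W(2) by simp
    then have "continuous_on ({0..s0} \<times> cbox a b) (\<lambda>z. frechet_derivative E (at z) (1, 0))"
      using W(3) by (rule continuous_on_subset)
    moreover have "continuous_on ({0..s0} \<times> cbox a b) (\<lambda>z. \<psi> (snd z))"
      by (rule continuous_on_compose2[OF cont\<psi>]) (auto intro!: continuous_intros)
    ultimately show "continuous_on ({0..s0} \<times> cbox a b) (\<lambda>(r, y). \<psi> y * D r y)"
      by (auto simp: D_def split_beta intro: continuous_on_mult)
  qed (use t in auto)
  have bd: "norm (integral (cbox a b) (\<lambda>y. \<psi> y * D t y)) \<le> ?C" if t: "t \<in> {0..s0}" for t
  proof -
    have "norm (integral (cbox a b) (\<lambda>y. E (t, y) * divergence X y)) \<le>
        integral (cbox a b) (\<lambda>y. B * \<bar>divergence X y\<bar>)"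
      using B[OF t]
      by (intro integral_norm_bound_integral integrable_continuous continuous_intros contEy[OF t] contd)
        (auto simp: abs_mult intro: mult_right_mono)
    then show ?thesis by (simp add: D[OF t])
  qed
  have "norm (G s - G 0) \<le> ?C * norm (s - 0)"
  proof (rule differentiable_bound[of "{0..s0}" G "\<lambda>t r. r *\<^sub>R integral (cbox a b) (\<lambda>y. \<psi> y * D t y)"])
    show "onorm (\<lambda>r. r *\<^sub>R integral (cbox a b) (\<lambda>y. \<psi> y * D t y)) \<le> ?C" if "t \<in> {0..s0}" for t
      using mult_left_mono[OF bd[OF that]] by (intro onorm_le) (simp add: abs_mult mult.commute)
  qed (use G s in \<open>auto simp: has_vector_derivative_def\<close>)
  then show ?thesis using s by (simp add: G_def X_def[abs_def] mult.commute)
qed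


section \<open>Charts of a Lie group\<close>

locale lie_group_charts =
  fixes N :: "('g, 'a::euclidean_space) lie_group_data"
  assumes lie: "lie_group N"
begin

sublocale group N using lie by (simp add: lie_group_def)

lemma topspace_mtop: "topspace (mtop N) = carrier N"
  using lie by (simp add: lie_group_def)

lemma Hausdorff_mtop: "Hausdorff_space (mtop N)"
  using lie by (simp add: lie_group_def smooth_manifold_def)

lemma smooth_atlas_charts: "smooth_atlas (mtop N) (charts N)"
  using lie by (simp add: lie_group_def smooth_manifold_def)

lemma chart_at:
  assumes "g \<in> carrier N"
  obtains V \<psi> where "(V, \<psi>) \<in> charts N" "g \<in> V"
proof -
  have "g \<in> (\<Union>(V, \<psi>)\<in>charts N. V)"
    using smooth_atlas_charts assms by (simp add: smooth_atlas_def topspace_mtop)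
  then show ?thesis using that by auto
qed

lemma
  assumes "(V, \<psi>) \<in> charts N"
  shows chart_domain_open: "openin (mtop N) V"
    and chart_range_open: "open (\<psi> ` V)"
    and chart_homeo: "homeomorphic_map (subtopology (mtop N) V) (top_of_set (\<psi> ` V)) \<psi>"
  using smooth_atlas_charts assms by (auto simp: smooth_atlas_def)

lemma chart_domain_subset: "(V, \<psi>) \<in> charts N \<Longrightarrow> V \<subseteq> carrier N"
  using openin_subset[OF chart_domain_open] by (simp add: topspace_mtop)

lemma chart_inj: "(V, \<psi>) \<in> charts N \<Longrightarrow> inj_on \<psi> V"
  using homeomorphic_imp_injective_map[OF chart_homeo] chart_domain_subset
  by (simp add: topspace_mtop Int_absorb1)

lemma chart_image_open:
  assumes "(V, \<psi>) \<in> charts N" "openin (mtop N) W" "W \<subseteq> V"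
  shows "open (\<psi> ` W)"
proof -
  have "openin (subtopology (mtop N) V) W"
    using assms(2,3) by (auto simp: openin_subtopology)
  then have "openin (top_of_set (\<psi> ` V)) (\<psi> ` W)"
    using homeomorphic_imp_open_map[OF chart_homeo[OF assms(1)]] by (simp add: open_map_def)
  then show ?thesis using chart_range_open[OF assms(1)] openin_open_trans by blast
qed

lemma chart_inv_continuous:
  assumes "(V, \<psi>) \<in> charts N"
  shows "continuous_map (top_of_set (\<psi> ` V)) (mtop N) (inv_into V \<psi>)"
  unfolding continuous_map
proof (intro conjI allI impI)
  show "inv_into V \<psi> ` topspace (top_of_set (\<psi> ` V)) \<subseteq> topspace (mtop N)"
    using chart_domain_subset[OF assms] chart_inj[OF assms] by (auto simp: topspace_mtop)
  fix W assume W: "openin (mtop N) W"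
  have "{x \<in> topspace (top_of_set (\<psi> ` V)). inv_into V \<psi> x \<in> W} = \<psi> ` (V \<inter> W)"
    using chart_inj[OF assms] by auto
  moreover have "open (\<psi> ` (V \<inter> W))"
    by (rule chart_image_open[OF assms]) (use W chart_domain_open[OF assms] in auto)
  ultimately show "openin (top_of_set (\<psi> ` V)) {x \<in> topspace (top_of_set (\<psi> ` V)). inv_into V \<psi> x \<in> W}"
    by (auto simp: openin_open)
qed

lemma chart_transition_smooth:
  assumes "(V, \<psi>) \<in> charts N" "(V', \<psi>') \<in> charts N"
  shows "smooth_on (\<psi> ` (V \<inter> V')) (\<lambda>x. \<psi>' (inv_into V \<psi> x))"
  using smooth_atlas_charts assms unfolding smooth_atlas_def by (fastforce simp: o_def)

lemma mult_continuous:
  assumes "continuous_map Y (mtop N) f" "continuous_map Y (mtop N) g"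
  shows "continuous_map Y (mtop N) (\<lambda>z. f z \<otimes>\<^bsub>N\<^esub> g z)"
proof -
  have "continuous_map (prod_topology (mtop N) (mtop N)) (mtop N) (\<lambda>(x, y). x \<otimes>\<^bsub>N\<^esub> y)"
    using lie by (simp add: lie_group_def smooth_map_def)
  from continuous_map_compose[OF continuous_map_pairedI[OF assms] this]
  show ?thesis by (simp add: o_def)
qed

lemma continuous_map_constI: "g \<in> carrier N \<Longrightarrow> continuous_map Y (mtop N) (\<lambda>_. g)"
  by (simp add: topspace_mtop)

lemma open_continuous_preimage:
  assumes "open S" "continuous_map (top_of_set S) (mtop N) c" "openin (mtop N) W"
  shows "open {t \<in> S. c t \<in> W}"
  using openin_continuous_map_preimage[OF assms(2,3)] assms(1) openin_open_trans by fastforce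

text \<open>The coordinate domain on which the smoothness clause for multiplication speaks about
  these three charts, phrased through the inverse charts so that it is visibly an open
  preimage.\<close>

definition mult_domain ::
  "'g set \<Rightarrow> ('g \<Rightarrow> 'a) \<Rightarrow> 'g set \<Rightarrow> ('g \<Rightarrow> 'a) \<Rightarrow> 'g set \<Rightarrow> ('a \<times> 'a) set" where
  "mult_domain V1 \<psi>1 V2 \<psi>2 V3 = {z. fst z \<in> \<psi>1 ` V1 \<and> snd z \<in> \<psi>2 ` V2 \<and>
     inv_into V1 \<psi>1 (fst z) \<otimes>\<^bsub>N\<^esub> inv_into V2 \<psi>2 (snd z) \<in> V3}"

lemma
  assumes c1: "(V1, \<psi>1) \<in> charts N" and c2: "(V2, \<psi>2) \<in> charts N" and c3: "(V3, \<psi>3) \<in> charts N"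
  shows open_mult_domain: "open (mult_domain V1 \<psi>1 V2 \<psi>2 V3)"
    and mult_smooth: "smooth_on (mult_domain V1 \<psi>1 V2 \<psi>2 V3)
      (\<lambda>z. \<psi>3 (inv_into V1 \<psi>1 (fst z) \<otimes>\<^bsub>N\<^esub> inv_into V2 \<psi>2 (snd z)))"
proof -
  let ?S = "\<psi>1 ` V1 \<times> \<psi>2 ` V2"
  have S: "open ?S" using chart_range_open c1 c2 by (intro open_Times)
  have "continuous_map (top_of_set ?S) (top_of_set (\<psi>1 ` V1)) fst"
    "continuous_map (top_of_set ?S) (top_of_set (\<psi>2 ` V2)) snd"
    by (auto intro: continuous_on_fst continuous_on_snd continuous_on_id)
  from continuous_map_compose[OF this(1) chart_inv_continuous[OF c1]]
    continuous_map_compose[OF this(2) chart_inv_continuous[OF c2]]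
  have "continuous_map (top_of_set ?S) (mtop N)
      (\<lambda>z. inv_into V1 \<psi>1 (fst z) \<otimes>\<^bsub>N\<^esub> inv_into V2 \<psi>2 (snd z))"
    by (intro mult_continuous) (simp_all add: o_def)
  from open_continuous_preimage[OF S this chart_domain_open[OF c3]]
  have eq: "open {z \<in> ?S. inv_into V1 \<psi>1 (fst z) \<otimes>\<^bsub>N\<^esub> inv_into V2 \<psi>2 (snd z) \<in> V3}" .
  also have "{z \<in> ?S. inv_into V1 \<psi>1 (fst z) \<otimes>\<^bsub>N\<^esub> inv_into V2 \<psi>2 (snd z) \<in> V3} = mult_domain V1 \<psi>1 V2 \<psi>2 V3"
    by (auto simp: mult_domain_def)
  finally show op: "open (mult_domain V1 \<psi>1 V2 \<psi>2 V3)" .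
  have inj: "inj_on (map_prod \<psi>1 \<psi>2) (V1 \<times> V2)"
    using chart_inj c1 c2 by (intro map_prod_inj_on)
  have inv: "inv_into (V1 \<times> V2) (map_prod \<psi>1 \<psi>2) z = (inv_into V1 \<psi>1 (fst z), inv_into V2 \<psi>2 (snd z))"
    if "z \<in> ?S" for z
    by (rule inv_into_f_eq[OF inj]) (use that in \<open>auto simp: inv_into_into f_inv_into_f\<close>)
  have dom: "map_prod \<psi>1 \<psi>2 ` (V1 \<times> V2 \<inter> (\<lambda>(x, y). x \<otimes>\<^bsub>N\<^esub> y) -` V3) = mult_domain V1 \<psi>1 V2 \<psi>2 V3"
  proof (intro subset_antisym subsetI)
    fix z assume "z \<in> mult_domain V1 \<psi>1 V2 \<psi>2 V3"
    then show "z \<in> map_prod \<psi>1 \<psi>2 ` (V1 \<times> V2 \<inter> (\<lambda>(x, y). x \<otimes>\<^bsub>N\<^esub> y) -` V3)"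
      by (intro image_eqI[where x = "(inv_into V1 \<psi>1 (fst z), inv_into V2 \<psi>2 (snd z))"])
        (auto simp: mult_domain_def inv_into_into f_inv_into_f prod_eq_iff)
  qed (use chart_inj[OF c1] chart_inj[OF c2] in \<open>auto simp: mult_domain_def\<close>)
  have "(V1 \<times> V2, map_prod \<psi>1 \<psi>2) \<in> prod_charts (charts N) (charts N)"
    using c1 c2 by (auto simp: prod_charts_def)
  then have "smooth_on (map_prod \<psi>1 \<psi>2 ` (V1 \<times> V2 \<inter> (\<lambda>(x, y). x \<otimes>\<^bsub>N\<^esub> y) -` V3))
      (\<psi>3 \<circ> (\<lambda>(x, y). x \<otimes>\<^bsub>N\<^esub> y) \<circ> inv_into (V1 \<times> V2) (map_prod \<psi>1 \<psi>2))"
    using lie c3 unfolding lie_group_def smooth_map_def by fastforce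
  then show "smooth_on (mult_domain V1 \<psi>1 V2 \<psi>2 V3)
      (\<lambda>z. \<psi>3 (inv_into V1 \<psi>1 (fst z) \<otimes>\<^bsub>N\<^esub> inv_into V2 \<psi>2 (snd z)))"
    unfolding dom by (rule smooth_on_cong[OF op, rotated]) (auto simp: mult_domain_def inv)
qed

text \<open>Freezing the first factor at the coordinate of \<open>g\<close> in some chart reduces
  left translation to multiplication.\<close>

lemma
  assumes g: "g \<in> carrier N" and c2: "(V2, \<psi>2) \<in> charts N" and c3: "(V3, \<psi>3) \<in> charts N"
  shows open_left_translation_domain: "open {y \<in> \<psi>2 ` V2. g \<otimes>\<^bsub>N\<^esub> inv_into V2 \<psi>2 y \<in> V3}"
    and left_translation_smooth: "smooth_on {y \<in> \<psi>2 ` V2. g \<otimes>\<^bsub>N\<^esub> inv_into V2 \<psi>2 y \<in> V3}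
      (\<lambda>y. \<psi>3 (g \<otimes>\<^bsub>N\<^esub> inv_into V2 \<psi>2 y))"
proof -
  obtain V1 \<psi>1 where c1: "(V1, \<psi>1) \<in> charts N" and gV: "g \<in> V1" using chart_at[OF g] .
  let ?S = "{y \<in> \<psi>2 ` V2. g \<otimes>\<^bsub>N\<^esub> inv_into V2 \<psi>2 y \<in> V3}"
  show op: "open ?S"
    by (rule open_continuous_preimage[OF chart_range_open[OF c2]
          mult_continuous[OF continuous_map_constI[OF g] chart_inv_continuous[OF c2]] chart_domain_open[OF c3]])
  have sub: "(\<lambda>y. (\<psi>1 g, y)) ` ?S \<subseteq> mult_domain V1 \<psi>1 V2 \<psi>2 V3"
    using gV chart_inj[OF c1] by (auto simp: mult_domain_def)
  have "smooth_on ?S (\<lambda>y. (\<psi>1 g, y))"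
    using op by (intro smooth_on_Pair smooth_on_const smooth_on_ident)
  from smooth_on_compose[OF op open_mult_domain[OF c1 c2 c3] sub this mult_smooth[OF c1 c2 c3]]
  show "smooth_on ?S (\<lambda>y. \<psi>3 (g \<otimes>\<^bsub>N\<^esub> inv_into V2 \<psi>2 y))"
    using gV chart_inj[OF c1] by simp
qed

lemma smooth_function_chart:
  "smooth_function N f \<Longrightarrow> (V, \<psi>) \<in> charts N \<Longrightarrow> smooth_on (\<psi> ` V) (\<lambda>x. f (inv_into V \<psi> x))"
  by (fastforce simp: smooth_function_def smooth_map_def euclidean_charts_def o_def)

lemma smooth_function_left_translate:
  fixes f :: "'g \<Rightarrow> 'b::euclidean_space"
  assumes f: "smooth_function N f" and g: "g \<in> carrier N" and c: "(V, \<psi>) \<in> charts N"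
  shows "smooth_on (\<psi> ` V) (\<lambda>y. f (g \<otimes>\<^bsub>N\<^esub> inv_into V \<psi> y))"
proof (rule smooth_on_local)
  fix y assume y: "y \<in> \<psi> ` V"
  then have "inv_into V \<psi> y \<in> carrier N" using chart_domain_subset[OF c] inv_into_into[OF y] by blast
  then have "g \<otimes>\<^bsub>N\<^esub> inv_into V \<psi> y \<in> carrier N" using g by simp
  from chart_at[OF this] obtain V' \<psi>' where c': "(V', \<psi>') \<in> charts N" and gy: "g \<otimes>\<^bsub>N\<^esub> inv_into V \<psi> y \<in> V'" .
  let ?S = "{y \<in> \<psi> ` V. g \<otimes>\<^bsub>N\<^esub> inv_into V \<psi> y \<in> V'}"
  have op: "open ?S" by (rule open_left_translation_domain[OF g c c'])
  have "smooth_on ?S (\<lambda>y. f (inv_into V' \<psi>' (\<psi>' (g \<otimes>\<^bsub>N\<^esub> inv_into V \<psi> y))))"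
    by (rule smooth_on_compose[OF op chart_range_open[OF c'] _
          left_translation_smooth[OF g c c'] smooth_function_chart[OF f c']]) auto
  then have "smooth_on ?S (\<lambda>y. f (g \<otimes>\<^bsub>N\<^esub> inv_into V \<psi> y))"
    by (rule smooth_on_cong[OF op, rotated]) (use chart_inj[OF c'] in simp)
  then show "\<exists>T. open T \<and> y \<in> T \<and> smooth_on T (\<lambda>y. f (g \<otimes>\<^bsub>N\<^esub> inv_into V \<psi> y))"
    using op y gy by blast
qed

lemma smooth_curve_iff:
  "smooth_curve N c \<longleftrightarrow> continuous_map euclidean (mtop N) c \<and>
     (\<forall>(V, \<psi>)\<in>charts N. smooth_on {t. c t \<in> V} (\<lambda>t. \<psi> (c t)))"
  by (simp add: smooth_curve_def smooth_map_def euclidean_charts_def o_def vimage_def)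

lemma smooth_curve_carrier: "smooth_curve N c \<Longrightarrow> c t \<in> carrier N"
  using continuous_map_image_subset_topspace[of euclidean "mtop N" c]
  by (auto simp: smooth_curve_iff topspace_mtop)

end

text \<open>The extension is \<open>f (t / real m) [^] m\<close> for \<open>m\<close> so large that
  \<open>t / real m\<close> lies in the interval. The common refinement \<open>m * n\<close> shows
  independence of \<open>m\<close>, and small values of \<open>f\<close> commute because addition
  does, so powers of products split.\<close>

lemma (in group) extend_local_homomorphism:
  fixes f :: "real \<Rightarrow> 'a"
  assumes \<eta>: "\<eta> > 0" and f: "\<And>t. \<bar>t\<bar> < \<eta> \<Longrightarrow> f t \<in> carrier G"
    and add: "\<And>s t. \<bar>s\<bar> < \<eta> \<Longrightarrow> \<bar>t\<bar> < \<eta> \<Longrightarrow> \<bar>s + t\<bar> < \<eta> \<Longrightarrow> f (s + t) = f s \<otimes> f t"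
  obtains \<gamma> where "\<And>t. \<gamma> t \<in> carrier G" "\<And>s t. \<gamma> (s + t) = \<gamma> s \<otimes> \<gamma> t"
    "\<And>t. \<bar>t\<bar> < \<eta> \<Longrightarrow> \<gamma> t = f t"
proof -
  have f0: "f 0 = \<one>" 
  proof -
    have "f 0 = f 0 \<otimes> f 0" using add[of 0 0] \<eta> by simp
    then show ?thesis using f[of 0] \<eta> by (simp add: r_cancel_one')
  qed
  have mult: "f (real j * t) = f t [^] j" if "\<bar>real j * t\<bar> < \<eta>" for j t
    using that
  proof (induction j)
    case (Suc j)
    have "\<bar>real j * t\<bar> \<le> \<bar>real (Suc j) * t\<bar>" "\<bar>t\<bar> \<le> \<bar>real (Suc j) * t\<bar>"
      by (auto simp: abs_mult intro: mult_right_mono) (use mult_right_mono[of 1 "1 + real j" "\<bar>t\<bar>"] in simp)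
    then have "\<bar>real j * t\<bar> < \<eta>" "\<bar>t\<bar> < \<eta>" using Suc.prems by linarith+
    then show ?case using Suc add[of "real j * t" t] by (simp add: algebra_simps)
  qed (simp add: f0)
  have indep: "f (t / real m) [^] m = f (t / real n) [^] n"
    if "m > 0" "n > 0" "\<bar>t / real m\<bar> < \<eta>" "\<bar>t / real n\<bar> < \<eta>" for m n t
  proof -
    have half: "f (t / real m) [^] m = f (t / real (m * n)) [^] (m * n)"
      if "m > 0" "n > 0" "\<bar>t / real m\<bar> < \<eta>" for m n
    proof -
      have eq: "real n * (t / real (m * n)) = t / real m" using that by simp
      have "\<bar>t / real (m * n)\<bar> \<le> \<bar>t / real m\<bar>"
        using that by (simp add: field_simps mult_le_cancel_left1 mult_le_cancel_right1)
      then have c: "f (t / real (m * n)) \<in> carrier G" using that by (intro f) linarith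
      have "f (t / real m) = f (t / real (m * n)) [^] n"
        using mult[of n "t / real (m * n)"] that unfolding eq by simp
      then show ?thesis using nat_pow_pow[OF c, of n m] mult.commute[of n m] by simp
    qed
    show ?thesis using half[of m n] half[of n m] that by (simp add: mult.commute)
  qed
  \<comment> \<open>\<open>Suc\<close> makes the number of pieces positive and strictly larger than
    \<open>\<bar>t\<bar> / \<eta>\<close>, as the open interval requires.\<close>
  define k where "k t = Suc (nat \<lceil>\<bar>t\<bar> / \<eta>\<rceil>)" for t
  have k0: "k t > 0" for t by (simp add: k_def)
  have k: "\<bar>t / real m\<bar> < \<eta>" if "m \<ge> k t" for t m
  proof -
    have "\<bar>t\<bar> / \<eta> < real (k t)" unfolding k_def by linarith
    also have "\<dots> \<le> real m" using that by simp
    finally have "\<bar>t\<bar> / \<eta> < real m" .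
    moreover from this have "real m > 0" using \<eta> by (smt (verit) divide_nonneg_pos)
    ultimately show "\<bar>t / real m\<bar> < \<eta>" using \<eta> by (simp add: field_simps)
  qed
  define \<gamma> where "\<gamma> t = f (t / real (k t)) [^] k t" for t
  have \<gamma>: "\<gamma> t = f (t / real m) [^] m" if "m > 0" "\<bar>t / real m\<bar> < \<eta>" for t m
    unfolding \<gamma>_def using that k0[of t] k[of t "k t"] by (intro indep) auto
  show ?thesis
  proof (rule that)
    show "\<gamma> t \<in> carrier G" for t
      unfolding \<gamma>_def using k[of t "k t"] by (intro nat_pow_closed f) auto
    show "\<gamma> t = f t" if "\<bar>t\<bar> < \<eta>" for t
      using \<gamma>[of 1 t] f[of t] that by simp
    show "\<gamma> (s + t) = \<gamma> s \<otimes> \<gamma> t" for s t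
    proof -
      define m where "m = max (k s) (max (k t) (k (s + t)))"
      have m: "m > 0" "\<bar>s / real m\<bar> < \<eta>" "\<bar>t / real m\<bar> < \<eta>" "\<bar>(s + t) / real m\<bar> < \<eta>"
        using k0[of s] k[of s m] k[of t m] k[of "s + t" m] unfolding m_def by (simp_all add: less_max_iff_disj)
      have "\<gamma> (s + t) = f (s / real m + t / real m) [^] m"
        using \<gamma>[OF m(1,4)] by (simp add: add_divide_distrib)
      also have "f (s / real m + t / real m) = f (s / real m) \<otimes> f (t / real m)"
        using m by (intro add) (auto simp: add_divide_distrib)
      also have "(f (s / real m) \<otimes> f (t / real m)) [^] m = f (s / real m) [^] m \<otimes> f (t / real m) [^] m"
      proof (rule pow_mult_distrib)
        show "f (s / real m) \<otimes> f (t / real m) = f (t / real m) \<otimes> f (s / real m)"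
          using add[OF m(2,3)] add[OF m(3,2)] m(4) by (simp add: add_divide_distrib add.commute)
      qed (use m f in auto)
      finally show ?thesis using \<gamma>[OF m(1,2)] \<gamma>[OF m(1,3)] by simp
    qed
  qed
qed


section \<open>Invariant vector fields in a chart at the identity\<close>

locale lie_group_chart = lie_group_charts N
  for N :: "('g, 'a::euclidean_space) lie_group_data" +
  fixes U :: "'g set" and \<phi> :: "'g \<Rightarrow> 'a"
  assumes chart: "(U, \<phi>) \<in> charts N" and one_in: "\<one>\<^bsub>N\<^esub> \<in> U"
begin

definition param :: "'a \<Rightarrow> 'g" where "param = inv_into U \<phi>"
definition origin :: 'a where "origin = \<phi> \<one>\<^bsub>N\<^esub>"
definition mu :: "'a \<times> 'a \<Rightarrow> 'a" where "mu z = \<phi> (param (fst z) \<otimes>\<^bsub>N\<^esub> param (snd z))"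
definition mu_domain :: "('a \<times> 'a) set" where
  "mu_domain = {z. fst z \<in> \<phi> ` U \<and> snd z \<in> \<phi> ` U \<and> param (fst z) \<otimes>\<^bsub>N\<^esub> param (snd z) \<in> U}"

lemma param_in: "y \<in> \<phi> ` U \<Longrightarrow> param y \<in> U"
  by (simp add: param_def inv_into_into)

lemma param_carrier: "y \<in> \<phi> ` U \<Longrightarrow> param y \<in> carrier N"
  using param_in chart_domain_subset[OF chart] by blast

lemma chart_param: "y \<in> \<phi> ` U \<Longrightarrow> \<phi> (param y) = y"
  by (simp add: param_def f_inv_into_f)

lemma param_chart: "g \<in> U \<Longrightarrow> param (\<phi> g) = g"
  using chart_inj[OF chart] by (simp add: param_def)

lemma param_origin: "param origin = \<one>\<^bsub>N\<^esub>"
  using one_in by (simp add: origin_def param_chart)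

lemma origin_in: "origin \<in> \<phi> ` U"
  using one_in by (simp add: origin_def)

lemma open_range: "open (\<phi> ` U)"
  by (rule chart_range_open[OF chart])

lemma param_continuous: "continuous_map (top_of_set (\<phi> ` U)) (mtop N) param"
  unfolding param_def by (rule chart_inv_continuous[OF chart])

lemma mu_domain_eq: "mu_domain = mult_domain U \<phi> U \<phi> U"
  by (simp add: mu_domain_def mult_domain_def param_def)

lemma open_mu_domain: "open mu_domain"
  unfolding mu_domain_eq by (rule open_mult_domain[OF chart chart chart])

lemma mu_smooth: "smooth_on mu_domain mu"
  unfolding mu_domain_eq mu_def[abs_def] param_def by (rule mult_smooth[OF chart chart chart])

lemma mu_in: "(x, y) \<in> mu_domain \<Longrightarrow> mu (x, y) \<in> \<phi> ` U"
  by (auto simp: mu_domain_def mu_def)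

lemma param_mu: "(x, y) \<in> mu_domain \<Longrightarrow> param (mu (x, y)) = param x \<otimes>\<^bsub>N\<^esub> param y"
  by (simp add: mu_domain_def mu_def param_chart)

lemma origin_mu_domain:
  assumes "y \<in> \<phi> ` U"
  shows "(origin, y) \<in> mu_domain" "(y, origin) \<in> mu_domain"
  using assms param_carrier[OF assms] param_in[OF assms] origin_in
  by (auto simp: mu_domain_def param_origin)

lemma mu_origin:
  assumes "y \<in> \<phi> ` U"
  shows "mu (origin, y) = y" "mu (y, origin) = y"
  using param_carrier[OF assms] chart_param[OF assms] by (auto simp: mu_def param_origin)

lemma mu_has_derivative:
  assumes "z \<in> mu_domain"
  shows "(mu has_derivative frechet_derivative mu (at z)) (at z)"
  by (rule smooth_on_has_derivative[OF mu_smooth assms])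

lemma mu_right_has_derivative:
  assumes "(x, y) \<in> mu_domain"
  shows "((\<lambda>y. mu (x, y)) has_derivative (\<lambda>v. frechet_derivative mu (at (x, y)) (0, v))) (at y)"
proof -
  have "((\<lambda>y. (x, y)) has_derivative (\<lambda>v. (0, v))) (at y)" by (auto intro!: derivative_eq_intros)
  from has_derivative_compose[OF this mu_has_derivative[OF assms]] show ?thesis .
qed

text \<open>The left-invariant field with value \<open>v\<close> at the identity: the velocity of
  \<open>x w\<close> as \<open>w\<close> leaves the identity with velocity \<open>v\<close>. It
  generates right translations.\<close>

definition left_field :: "'a \<Rightarrow> 'a \<Rightarrow> 'a" where
  "left_field v x = frechet_derivative mu (at (x, origin)) (0, v)"

text \<open>The right-invariant counterpart, the velocity of \<open>w y\<close>; it generates left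
  translations.\<close>

definition right_field :: "'a \<Rightarrow> 'a \<Rightarrow> 'a" where
  "right_field v y = frechet_derivative mu (at (origin, y)) (v, 0)"

lemma Ck_on_left_field: "Ck_on k (\<phi> ` U) (left_field v)"
  unfolding left_field_def[abs_def]
proof (rule Ck_on_frechet_derivative[OF open_range open_mu_domain])
  show "Ck_on (Suc k) mu_domain mu" using mu_smooth by (simp add: smooth_on_def del: Ck_on.simps)
  show "Ck_on k (\<phi> ` U) (\<lambda>x. (x, origin))"
    by (intro Ck_on_Pair Ck_on_const Ck_on_bounded_linear bounded_linear_ident open_range)
qed (auto intro: Ck_on_const open_range origin_mu_domain)

lemma Ck_on_right_field: "Ck_on k (\<phi> ` U) (right_field v)"
  unfolding right_field_def[abs_def]
proof (rule Ck_on_frechet_derivative[OF open_range open_mu_domain])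
  show "Ck_on (Suc k) mu_domain mu" using mu_smooth by (simp add: smooth_on_def del: Ck_on.simps)
  show "Ck_on k (\<phi> ` U) (\<lambda>x. (origin, x))"
    by (intro Ck_on_Pair Ck_on_const Ck_on_bounded_linear bounded_linear_ident open_range)
qed (auto intro: Ck_on_const open_range origin_mu_domain)

lemma left_field_origin: "left_field v origin = v"
proof -
  have "((\<lambda>y. mu (origin, y)) has_derivative (\<lambda>v. v)) (at origin)"
    by (rule has_derivative_transform_within_open[OF has_derivative_ident open_range origin_in])
      (simp add: mu_origin)
  from has_derivative_unique[OF this mu_right_has_derivative[OF origin_mu_domain(1)[OF origin_in]]]
  show ?thesis by (metis left_field_def)
qed

text \<open>Differentiate \<open>x (y w) = (x y) w\<close> in \<open>w\<close> at the identity.\<close>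

lemma left_field_invariant:
  assumes xy: "(x, y) \<in> mu_domain"
  shows "frechet_derivative mu (at (x, y)) (0, left_field v y) = left_field v (mu (x, y))"
proof -
  have y: "y \<in> \<phi> ` U" and x: "x \<in> \<phi> ` U" using xy by (auto simp: mu_domain_def)
  let ?S = "(\<lambda>w. (y, w)) -` mu_domain"
  have S: "open ?S" by (intro open_vimage open_mu_domain continuous_intros)
  have oS: "origin \<in> ?S" using origin_mu_domain[OF y] by simp
  have "((\<lambda>w. mu (x, mu (y, w))) has_derivative
     (\<lambda>v. frechet_derivative mu (at (x, mu (y, origin))) (0, frechet_derivative mu (at (y, origin)) (0, v)))) (at origin)"
    by (rule has_derivative_compose[OF mu_right_has_derivative mu_right_has_derivative])
      (use xy origin_mu_domain[OF y] mu_origin[OF y] in auto)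
  then have "((\<lambda>w. mu (mu (x, y), w)) has_derivative
     (\<lambda>v. frechet_derivative mu (at (x, y)) (0, left_field v y))) (at origin)"
    unfolding mu_origin(2)[OF y] left_field_def[symmetric]
  proof (rule has_derivative_transform_within_open[OF _ S oS])
    fix w assume w: "w \<in> ?S"
    then have "w \<in> \<phi> ` U" by (auto simp: mu_domain_def)
    then have "param x \<otimes>\<^bsub>N\<^esub> param (mu (y, w)) = param (mu (x, y)) \<otimes>\<^bsub>N\<^esub> param w"
      using w xy x y by (simp add: param_mu m_assoc param_carrier)
    then show "mu (x, mu (y, w)) = mu (mu (x, y), w)" by (simp add: mu_def)
  qed
  moreover have "((\<lambda>w. mu (mu (x, y), w)) has_derivative
     (\<lambda>v. frechet_derivative mu (at (mu (x, y), origin)) (0, v))) (at origin)"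
    by (rule mu_right_has_derivative) (rule origin_mu_domain[OF mu_in[OF xy]])
  ultimately have "(\<lambda>v. frechet_derivative mu (at (x, y)) (0, left_field v y)) =
      (\<lambda>v. frechet_derivative mu (at (mu (x, y), origin)) (0, v))"
    by (rule has_derivative_unique)
  then show ?thesis unfolding left_field_def by metis
qed

section \<open>Velocities of curves and the vector fields they define\<close>

definition velocity :: "(real \<Rightarrow> 'g) \<Rightarrow> 'a" where
  "velocity c = vector_derivative (\<lambda>t. \<phi> (c t)) (at 0)"

lemma open_curve_domain:
  assumes "smooth_curve N c"
  shows "open {t. c t \<in> U}"
proof -
  have "continuous_map (top_of_set UNIV) (mtop N) c" using assms by (simp add: smooth_curve_iff)
  from open_continuous_preimage[OF open_UNIV this chart_domain_open[OF chart]] show ?thesis by simp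
qed

lemma curve_coordinates_smooth:
  assumes "smooth_curve N c"
  shows "smooth_on {t. c t \<in> U} (\<lambda>t. \<phi> (c t))"
  using assms chart by (auto simp: smooth_curve_iff)

lemma velocity_has_vector_derivative:
  assumes "smooth_curve N c" "c 0 = \<one>\<^bsub>N\<^esub>"
  shows "((\<lambda>t. \<phi> (c t)) has_vector_derivative velocity c) (at 0)"
  unfolding velocity_def vector_derivative_works[symmetric]
  using smooth_on_has_derivative[OF curve_coordinates_smooth[OF assms(1)], of 0] assms(2) one_in
  by (auto simp: differentiable_def)

text \<open>Differentiability is asked only at \<open>origin\<close>, so the rule serves both smooth
  functions and matrix coefficients of a representation.\<close>

lemma has_derivative_along_curve:
  fixes F :: "'g \<Rightarrow> 'b::real_normed_vector"
  assumes c: "smooth_curve N c" "c 0 = \<one>\<^bsub>N\<^esub>"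
    and F: "((\<lambda>y. F (param y)) has_derivative D) (at origin)"
  shows "((\<lambda>t. F (c t)) has_vector_derivative D (velocity c)) (at 0)"
proof -
  have v: "((\<lambda>t. \<phi> (c t)) has_derivative (\<lambda>s. s *\<^sub>R velocity c)) (at 0)"
    using velocity_has_vector_derivative[OF c] by (simp add: has_vector_derivative_def)
  have "((\<lambda>y. F (param y)) has_derivative D) (at (\<phi> (c 0)))"
    using F c(2) by (simp add: origin_def)
  from has_derivative_compose[OF v this]
  have "((\<lambda>t. F (param (\<phi> (c t)))) has_derivative (\<lambda>s. s *\<^sub>R D (velocity c))) (at 0)"
    by (simp add: linear_cmul[OF has_derivative_linear[OF F]])
  then have "((\<lambda>t. F (c t)) has_derivative (\<lambda>s. s *\<^sub>R D (velocity c))) (at 0)"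
    by (rule has_derivative_transform_within_open[OF _ open_curve_domain[OF c(1)]])
      (use c(2) one_in in \<open>auto simp: param_chart\<close>)
  then show ?thesis by (simp add: has_vector_derivative_def)
qed

text \<open>The field sees the curve only through its velocity, which permits replacing any curve by
  a one-parameter subgroup.\<close>

lemma velocity_field_eq:
  assumes c: "smooth_curve N c" "c 0 = \<one>\<^bsub>N\<^esub>" and f: "smooth_function N f" and x: "x \<in> carrier N"
  shows "velocity_field N c f x =
    frechet_derivative (\<lambda>y. f (x \<otimes>\<^bsub>N\<^esub> param y)) (at origin) (velocity c)"
proof -
  have "((\<lambda>y. f (x \<otimes>\<^bsub>N\<^esub> param y)) has_derivative
      frechet_derivative (\<lambda>y. f (x \<otimes>\<^bsub>N\<^esub> param y)) (at origin)) (at origin)"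
    unfolding param_def
    by (rule smooth_on_has_derivative[OF smooth_function_left_translate[OF f x chart] origin_in])
  from has_derivative_along_curve[OF c this]
  have "((\<lambda>t. f (x \<otimes>\<^bsub>N\<^esub> c t)) has_real_derivative
      frechet_derivative (\<lambda>y. f (x \<otimes>\<^bsub>N\<^esub> param y)) (at origin) (velocity c)) (at 0)"
    by (simp add: has_real_derivative_iff_has_vector_derivative)
  then show ?thesis using f x by (simp add: velocity_field_def DERIV_imp_deriv)
qed

lemma velocity_field_cong:
  assumes "smooth_curve N c" "c 0 = \<one>\<^bsub>N\<^esub>" "smooth_curve N c'" "c' 0 = \<one>\<^bsub>N\<^esub>" "velocity c = velocity c'"
  shows "velocity_field N c = velocity_field N c'"
proof (intro ext)
  fix f x
  show "velocity_field N c f x = velocity_field N c' f x"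
  proof (cases "smooth_function N f \<and> x \<in> carrier N")
    case True
    then show ?thesis using assms by (simp add: velocity_field_eq)
  qed (auto simp: velocity_field_def)
qed

text \<open>The velocity must be a linear function of the operator \<^const>\<open>velocity_field\<close>, as the
  grading only describes sums of such operators; globally smooth functions supported in the chart
  read it off.\<close>

lemma exists_probe_function:
  obtains \<beta> f where "\<beta> > (0::real)" "\<And>w. smooth_function N (f w)"
    "\<And>c w. smooth_curve N c \<Longrightarrow> c 0 = \<one>\<^bsub>N\<^esub> \<Longrightarrow>
       velocity_field N c (f w) \<one>\<^bsub>N\<^esub> = \<beta> * (velocity c \<bullet> w)"
proof -
  obtain \<rho> where \<rho>: "\<rho> > 0" "cball origin \<rho> \<subseteq> \<phi> ` U"
    using open_range origin_in open_contains_cball by blast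
  \<comment> \<open>A linear coordinate cut off by a bump. The coordinate vanishes at
    \<open>origin\<close>, so there the derivative of the bump drops out and only its value
    \<open>\<beta>\<close> remains.\<close>
  define B where "B w y = ball_bump origin \<rho> y * ((y - origin) \<bullet> w)" for w y
  define f where "f w g = (if g \<in> U then B w (\<phi> g) else 0)" for w g
  define \<beta> where "\<beta> = ball_bump origin \<rho> origin"
  have \<beta>: "\<beta> > 0" unfolding \<beta>_def using \<rho> by (intro ball_bump_pos) simp
  have B_Ck: "Ck_on k UNIV (B w)" for k w
  proof -
    have id: "Ck_on k UNIV (\<lambda>y. y + - origin)" 
      by (intro Ck_on_add Ck_on_const Ck_on_bounded_linear bounded_linear_ident open_UNIV)
    have "Ck_on k UNIV (\<lambda>y. ball_bump origin \<rho> y * ((y + - origin) \<bullet> w))"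
      by (intro Ck_on_mult Ck_on_ball_bump Ck_on_inner[OF _ id] Ck_on_const open_UNIV)
    then show ?thesis by (simp add: B_def[abs_def])
  qed
  then have B_smooth: "smooth_on UNIV (B w)" for w by (simp add: smooth_on_def)
  \<comment> \<open>A compact set in a Hausdorff space is closed, so every chart domain
    \<open>V\<close> is covered by the open pieces \<open>V \<inter> U\<close> and
    \<open>V - K\<close>; on the second piece \<open>f w\<close> is zero.\<close>
  define K where "K = param ` cball origin \<rho>"
  have "compactin (mtop N) K"
    unfolding K_def
  proof (rule image_compactin[OF _ param_continuous])
    show "compactin (top_of_set (\<phi> ` U)) (cball origin \<rho>)"
      using \<rho> by (simp add: compactin_subtopology)
  qed
  then have K: "closedin (mtop N) K" using Hausdorff_mtop by (rule compactin_imp_closedin[rotated])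
  have KU: "K \<subseteq> U" using \<rho> by (auto simp: K_def param_in)
  have f0: "f w g = 0" if "g \<notin> K" for w g
  proof (cases "g \<in> U")
    case True
    have "\<phi> g \<notin> cball origin \<rho>"
    proof
      assume "\<phi> g \<in> cball origin \<rho>"
      then have "param (\<phi> g) \<in> K" unfolding K_def by blast
      then show False using that True by (simp add: param_chart)
    qed
    then have "ball_bump origin \<rho> (\<phi> g) = 0" using \<rho>(1) by (rule ball_bump_eq_0)
    then show ?thesis by (simp add: f_def B_def)
  qed (simp add: f_def)
  have loc: "\<exists>S. open S \<and> x \<in> S \<and> S \<subseteq> \<psi> ` V \<and> smooth_on S (\<lambda>x. f w (inv_into V \<psi> x))"
    if c: "(V, \<psi>) \<in> charts N" and x: "x \<in> \<psi> ` V" for V \<psi> w x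
  proof (cases "inv_into V \<psi> x \<in> U")
    case True
    have op: "open (\<psi> ` (V \<inter> U))"
      by (rule chart_image_open[OF c]) (use chart_domain_open[OF c] chart_domain_open[OF chart] in auto)
    have "smooth_on (\<psi> ` (V \<inter> U)) (\<lambda>x. B w (\<phi> (inv_into V \<psi> x)))"
      by (rule smooth_on_compose[OF op open_UNIV _ chart_transition_smooth[OF c chart] B_smooth]) simp
    then have "smooth_on (\<psi> ` (V \<inter> U)) (\<lambda>x. f w (inv_into V \<psi> x))"
      by (rule smooth_on_cong[OF op, rotated]) (use chart_inj[OF c] in \<open>auto simp: f_def\<close>)
    moreover have "x \<in> \<psi> ` (V \<inter> U)"
      using True x by (intro image_eqI[of _ _ "inv_into V \<psi> x"]) (auto simp: f_inv_into_f inv_into_into)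
    ultimately show ?thesis using op by blast
  next
    case False
    have eq: "V - K = V \<inter> (topspace (mtop N) - K)"
      using chart_domain_subset[OF c] by (auto simp: topspace_mtop)
    have "openin (mtop N) (V - K)"
      unfolding eq using K chart_domain_open[OF c] by (intro openin_Int) auto
    then have op: "open (\<psi> ` (V - K))"
      by (rule chart_image_open[OF c]) auto
    have "smooth_on (\<psi> ` (V - K)) (\<lambda>x. f w (inv_into V \<psi> x))"
      by (rule smooth_on_cong[OF op _ smooth_on_const[OF op, of 0]]) (use chart_inj[OF c] f0 in auto)
    moreover have "x \<in> \<psi> ` (V - K)"
      using False x KU by (intro image_eqI[of _ _ "inv_into V \<psi> x"]) (auto simp: f_inv_into_f inv_into_into)
    ultimately show ?thesis using op by blast
  qed
  have smooth_chart: "smooth_on (\<psi> ` V) (\<lambda>x. f w (inv_into V \<psi> x))" if "(V, \<psi>) \<in> charts N" for V \<psi> w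
    by (rule smooth_on_local) (use loc[OF that] in blast)
  have cont: "continuous_map (mtop N) euclidean (f w)" for w
  proof (rule continuous_map_openin_preimage_eq[THEN iffD2], intro conjI allI impI)
    show "f w \<in> topspace (mtop N) \<rightarrow> topspace euclidean" by simp
    fix W :: "real set" assume W: "openin euclidean W"
    show "openin (mtop N) (topspace (mtop N) \<inter> f w -` W)"
    proof (subst openin_subopen, intro ballI)
      fix g assume g: "g \<in> topspace (mtop N) \<inter> f w -` W"
      then obtain V \<psi> where c: "(V, \<psi>) \<in> charts N" and gV: "g \<in> V"
        using chart_at by (metis Int_iff topspace_mtop)
      have "continuous_on (\<psi> ` V) (\<lambda>x. f w (inv_into V \<psi> x))"
        using smooth_chart[OF c] Ck_on_continuous unfolding smooth_on_def by blast
      then have "continuous_map (top_of_set (\<psi> ` V)) euclidean (\<lambda>x. f w (inv_into V \<psi> x))" by simp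
      from continuous_map_compose[OF homeomorphic_imp_continuous_map[OF chart_homeo[OF c]] this]
      have "continuous_map (subtopology (mtop N) V) euclidean (\<lambda>g. f w (inv_into V \<psi> (\<psi> g)))"
        by (simp add: o_def)
      then have "continuous_map (subtopology (mtop N) V) euclidean (f w)"
        by (rule continuous_map_eq) (use chart_inj[OF c] in simp)
      from openin_continuous_map_preimage[OF this W]
      have "openin (subtopology (mtop N) V) {x \<in> V. f w x \<in> W}"
        using chart_domain_subset[OF c] by (simp add: topspace_mtop Int_absorb1)
      then have "openin (mtop N) {x \<in> V. f w x \<in> W}"
        using chart_domain_open[OF c] openin_trans_full by blast
      moreover have "{x \<in> V. f w x \<in> W} \<subseteq> topspace (mtop N) \<inter> f w -` W"
        using chart_domain_subset[OF c] by (auto simp: topspace_mtop)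
      ultimately show "\<exists>T. openin (mtop N) T \<and> g \<in> T \<and> T \<subseteq> topspace (mtop N) \<inter> f w -` W"
        using g gV by blast
    qed
  qed
  have smooth_f: "smooth_function N (f w)" for w
    unfolding smooth_function_def smooth_map_def
    using cont smooth_chart by (auto simp: euclidean_charts_def o_def)
  have read: "velocity_field N c (f w) \<one>\<^bsub>N\<^esub> = \<beta> * (velocity c \<bullet> w)"
    if c: "smooth_curve N c" "c 0 = \<one>\<^bsub>N\<^esub>" for c w
  proof -
    have dB: "(ball_bump origin \<rho> has_derivative frechet_derivative (ball_bump origin \<rho>) (at origin)) (at origin)"
      using Ck_on_Suc_has_derivative[OF Ck_on_ball_bump[of "Suc 0"]] by blast
    have "(B w has_derivative (\<lambda>v. \<beta> * (v \<bullet> w))) (at origin)"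
      unfolding B_def
      by (rule has_derivative_eq_rhs, rule has_derivative_mult[OF dB])
        (auto intro!: derivative_eq_intros simp: \<beta>_def)
    then have "((\<lambda>y. f w (\<one>\<^bsub>N\<^esub> \<otimes>\<^bsub>N\<^esub> param y)) has_derivative (\<lambda>v. \<beta> * (v \<bullet> w))) (at origin)"
      by (rule has_derivative_transform_within_open[OF _ open_range origin_in])
        (simp add: f_def param_in param_carrier chart_param)
    from frechet_derivative_at[OF this] show ?thesis
      by (subst velocity_field_eq[OF c smooth_f one_closed]) metis
  qed
  show ?thesis by (rule that[OF \<beta> smooth_f read])
qed

end


section \<open>One-parameter subgroups\<close>

context lie_group_charts
begin

lemma one_parameter_subgroup_zero:
  assumes "one_parameter_subgroup N \<gamma>"
  shows "\<gamma> 0 = \<one>\<^bsub>N\<^esub>"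
proof -
  have "\<gamma> 0 = \<gamma> 0 \<otimes>\<^bsub>N\<^esub> \<gamma> 0"
    using assms unfolding one_parameter_subgroup_def by (metis add_0)
  moreover have "\<gamma> 0 \<in> carrier N"
    using assms by (simp add: one_parameter_subgroup_def smooth_curve_carrier)
  ultimately show ?thesis by (simp add: r_cancel_one')
qed

text \<open>Near any \<open>t0\<close> the curve is the left translate by \<open>\<gamma> t0\<close>
  of its piece near \<open>0\<close>, and left translations are smooth.\<close>

lemma smooth_curve_of_local_homomorphism:
  assumes carrier: "\<And>t. \<gamma> t \<in> carrier N" and hom: "\<And>s t. \<gamma> (s + t) = \<gamma> s \<otimes>\<^bsub>N\<^esub> \<gamma> t"
    and \<eta>: "\<eta> > 0" and c: "(U, \<phi>) \<in> charts N"
    and y: "smooth_on {-\<eta><..<\<eta>} y" "\<And>t. \<bar>t\<bar> < \<eta> \<Longrightarrow> y t \<in> \<phi> ` U"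
    and \<gamma>: "\<And>t. \<bar>t\<bar> < \<eta> \<Longrightarrow> \<gamma> t = inv_into U \<phi> (y t)"
  shows "smooth_curve N \<gamma>"
  unfolding smooth_curve_iff
proof (intro conjI ballI)
  have conty: "continuous_on {-\<eta><..<\<eta>} y"
    using y(1) Ck_on_continuous unfolding smooth_on_def by blast
  define I where "I t0 = {t0 - \<eta><..<t0 + \<eta>}" for t0
  have I: "open (I t0)" "t0 \<in> I t0" for t0 using \<eta> by (auto simp: I_def)
  have local: "\<gamma> t = \<gamma> t0 \<otimes>\<^bsub>N\<^esub> inv_into U \<phi> (y (t - t0))" if "t \<in> I t0" for t t0
  proof -
    have "\<gamma> t = \<gamma> t0 \<otimes>\<^bsub>N\<^esub> \<gamma> (t - t0)" using hom[of t0 "t - t0"] by simp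
    moreover have "\<bar>t - t0\<bar> < \<eta>" using that by (simp add: I_def abs_diff_less_iff)
    ultimately show ?thesis using \<gamma>[of "t - t0"] by simp
  qed
  have cont_I: "continuous_map (top_of_set (I t0)) (mtop N) \<gamma>" for t0
  proof (rule continuous_map_eq)
    have "continuous_map (top_of_set (I t0)) (top_of_set (\<phi> ` U)) (\<lambda>t. y (t - t0))"
      using y(2) by (auto simp: I_def intro!: continuous_on_compose2[OF conty] continuous_intros)
    from continuous_map_compose[OF this chart_inv_continuous[OF c]]
    show "continuous_map (top_of_set (I t0)) (mtop N) (\<lambda>t. \<gamma> t0 \<otimes>\<^bsub>N\<^esub> inv_into U \<phi> (y (t - t0)))"
      by (intro mult_continuous continuous_map_constI carrier) (simp add: o_def)
  qed (use local in simp)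
  show "continuous_map euclidean (mtop N) \<gamma>"
    unfolding continuous_map
  proof (intro conjI allI impI)
    show "\<gamma> ` topspace euclidean \<subseteq> topspace (mtop N)" using carrier by (auto simp: topspace_mtop)
    fix W assume W: "openin (mtop N) W"
    have "open (\<Union>t0. {t \<in> I t0. \<gamma> t \<in> W})"
      by (intro open_UN ballI open_continuous_preimage[OF I(1) cont_I W])
    moreover have "(\<Union>t0. {t \<in> I t0. \<gamma> t \<in> W}) = {t \<in> topspace euclidean. \<gamma> t \<in> W}"
      using I(2) by auto
    ultimately show "openin euclidean {t \<in> topspace euclidean. \<gamma> t \<in> W}" by simp
  qed
  fix z assume "z \<in> charts N"
  then obtain V \<psi> where z: "z = (V, \<psi>)" and c': "(V, \<psi>) \<in> charts N" by (cases z) auto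
  have "smooth_on {t. \<gamma> t \<in> V} (\<lambda>t. \<psi> (\<gamma> t))"
  proof (rule smooth_on_local)
    fix t0 assume t0: "t0 \<in> {t. \<gamma> t \<in> V}"
    let ?T = "{t \<in> I t0. \<gamma> t \<in> V}"
    have op: "open ?T" by (rule open_continuous_preimage[OF I(1) cont_I chart_domain_open[OF c']])
    have sh: "smooth_on ?T (\<lambda>t. t + - t0)"
      unfolding smooth_on_def
      by (intro allI Ck_on_add Ck_on_const Ck_on_bounded_linear bounded_linear_ident op)
    have "smooth_on ?T (\<lambda>t. y (t + - t0))"
      by (rule smooth_on_compose[OF op _ _ sh y(1)]) (auto simp: I_def)
    then have "smooth_on ?T (\<lambda>t. \<psi> (\<gamma> t0 \<otimes>\<^bsub>N\<^esub> inv_into U \<phi> (y (t + - t0))))"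
      by (rule smooth_on_compose[OF op open_left_translation_domain[OF carrier c c'] _ _
            left_translation_smooth[OF carrier c c'], rotated])
        (use y(2) local in \<open>auto simp: I_def\<close>)
    then have "smooth_on ?T (\<lambda>t. \<psi> (\<gamma> t))"
      by (rule smooth_on_cong[OF op, rotated]) (use local in auto)
    then show "\<exists>T. open T \<and> t0 \<in> T \<and> smooth_on T (\<lambda>t. \<psi> (\<gamma> t))"
      using op t0 I(2) by blast
  qed
  then show "case z of (V, \<psi>) \<Rightarrow> smooth_on {t. \<gamma> t \<in> V} (\<lambda>t. \<psi> (\<gamma> t))" by (simp add: z)
qed

end

context lie_group_chart
begin

text \<open>The subgroup starts as the integral curve through \<open>origin\<close> of the
  left-invariant field of \<open>v\<close>. Uniqueness of integral curves makes it locally additive,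
  and the local homomorphism extends to all times.\<close>

lemma exists_one_parameter_subgroup:
  obtains \<gamma> where "one_parameter_subgroup N \<gamma>" "velocity \<gamma> = v"
proof -
  obtain \<delta> B y where \<delta>: "\<delta> > 0" and B: "open B" "origin \<in> B" "B \<subseteq> \<phi> ` U" and y0: "y 0 = origin"
    and y: "\<And>t. \<bar>t\<bar> < \<delta> \<Longrightarrow> y t \<in> B"
      "\<And>t. \<bar>t\<bar> < \<delta> \<Longrightarrow> (y has_vector_derivative left_field v (y t)) (at t)"
    and unique: "\<And>\<eta> y z t. \<eta> \<le> \<delta> \<Longrightarrow> \<bar>t\<bar> < \<eta> \<Longrightarrow> y 0 = z 0 \<Longrightarrow>
       (\<And>s. \<bar>s\<bar> < \<eta> \<Longrightarrow> y s \<in> B \<and> (y has_vector_derivative left_field v (y s)) (at s)) \<Longrightarrow>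
       (\<And>s. \<bar>s\<bar> < \<eta> \<Longrightarrow> z s \<in> B \<and> (z has_vector_derivative left_field v (z s)) (at s)) \<Longrightarrow> y t = z t"
  proof (rule picard_lindelof[OF open_range origin_in Ck_on_left_field[of 1 v]], goal_cases)
    case (1 \<delta> B y)
    show ?case by (rule 1(1)[OF 1(2-8)]) (assumption | rule 1(9); blast)+
  qed
  have yU: "y t \<in> \<phi> ` U" if "\<bar>t\<bar> < \<delta>" for t using y(1)[OF that] B(3) by blast
  have y_cont: "isCont y t" if "\<bar>t\<bar> < \<delta>" for t
    by (rule has_vector_derivative_continuous[OF y(2)[OF that]])
  \<comment> \<open>Bootstrap: if \<open>y\<close> has \<open>k\<close> continuous derivatives, so
    has its derivative \<open>left_field v (y t)\<close>.\<close>
  have y_Ck: "Ck_on k {-\<delta><..<\<delta>} y" for k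
  proof (induction k)
    case 0
    show ?case using y_cont by (auto intro!: continuous_at_imp_continuous_on)
  next
    case (Suc k)
    have "Ck_on k {-\<delta><..<\<delta>} (\<lambda>t. left_field v (y t))"
      by (rule Ck_on_compose[OF _ open_range _ Suc Ck_on_left_field]) (use yU in auto)
    then show ?case using y(2) by (intro Ck_on_vector_derivative) auto
  qed
  \<comment> \<open>Pairs whose product is defined and stays in \<open>B\<close>, where uniqueness
    holds. The condition \<open>2 * \<eta> \<le> \<delta>\<close> below keeps \<open>s + t\<close>
    in the interval of existence.\<close>
  define \<Omega> where "\<Omega> = mu_domain \<inter> mu -` B"
  have "continuous_on mu_domain mu"
    using mu_smooth Ck_on_continuous unfolding smooth_on_def by blast
  then have \<Omega>: "open \<Omega>" unfolding \<Omega>_def by (rule continuous_open_preimage[OF _ open_mu_domain B(1)])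
  obtain \<eta> where \<eta>: "\<eta> > 0" "2 * \<eta> \<le> \<delta>" "\<And>s t. \<bar>s\<bar> < \<eta> \<Longrightarrow> \<bar>t\<bar> < \<eta> \<Longrightarrow> (y s, y t) \<in> \<Omega>"
  proof -
    have "isCont y 0" using y_cont \<delta> by simp
    then have yt: "(y \<longlongrightarrow> origin) (nhds 0)" by (simp add: isCont_def y0 tendsto_nhds_iff)
    have "((\<lambda>z. (y (fst z), y (snd z))) \<longlongrightarrow> (origin, origin)) (nhds 0 \<times>\<^sub>F nhds 0)"
      by (intro tendsto_Pair filterlim_compose[OF yt] filterlim_fst filterlim_snd)
    moreover have "(origin, origin) \<in> \<Omega>"
      using origin_mu_domain[OF origin_in] mu_origin[OF origin_in] B by (simp add: \<Omega>_def)
    ultimately have "eventually (\<lambda>z. (y (fst z), y (snd z)) \<in> \<Omega>) (nhds 0 \<times>\<^sub>F nhds 0)"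
      using \<Omega> by (simp add: topological_tendstoD)
    then obtain P Q where PQ: "eventually P (nhds 0)" "eventually Q (nhds 0)"
      "\<And>s t. P s \<Longrightarrow> Q t \<Longrightarrow> (y s, y t) \<in> \<Omega>"
      by (auto simp: eventually_prod_filter)
    obtain d1 d2 where d: "d1 > 0" "\<And>s. \<bar>s\<bar> < d1 \<Longrightarrow> P s" "d2 > 0" "\<And>s. \<bar>s\<bar> < d2 \<Longrightarrow> Q s"
      using PQ(1,2) by (auto simp: eventually_nhds_metric dist_real_def)
    show ?thesis
      by (rule that[of "min (\<delta> / 2) (min d1 d2)"]) (use \<delta> d PQ in auto)
  qed
  have small: "\<bar>s + t\<bar> < \<delta>" if "\<bar>s\<bar> < \<eta>" "\<bar>t\<bar> < \<eta>" for s t using that \<eta> by linarith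
  \<comment> \<open>As functions of \<open>t\<close> both sides solve the same equation with the
    same value at \<open>0\<close>; for the right side this is the invariance of the field under
    left translation.\<close>
  have add: "y (s + t) = mu (y s, y t)" if st: "\<bar>s\<bar> < \<eta>" "\<bar>t\<bar> < \<eta>" for s t
  proof (rule unique[of \<eta> t "\<lambda>t. y (s + t)" "\<lambda>t. mu (y s, y t)"])
    have "y s \<in> \<phi> ` U" using yU[of s] st \<eta> by linarith
    then show "y (s + 0) = mu (y s, y 0)" by (simp add: y0 mu_origin)
  next
    fix t assume t: "\<bar>t\<bar> < \<eta>"
    have "((\<lambda>t. s + t) has_real_derivative 1) (at t)" by (auto intro!: derivative_eq_intros)
    then have "((y \<circ> (\<lambda>t. s + t)) has_vector_derivative 1 *\<^sub>R left_field v (y (s + t))) (at t)"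
      by (intro vector_diff_chain_at y(2)[OF small[OF st(1) t]])
        (simp add: has_real_derivative_iff_has_vector_derivative)
    then show "y (s + t) \<in> B \<and> ((\<lambda>t. y (s + t)) has_vector_derivative left_field v (y (s + t))) (at t)"
      using y(1)[OF small[OF st(1) t]] by (simp add: o_def)
  next
    fix t assume t: "\<bar>t\<bar> < \<eta>"
    have in\<Omega>: "(y s, y t) \<in> mu_domain" "mu (y s, y t) \<in> B"
      using \<eta>(3)[OF st(1) t] by (auto simp: \<Omega>_def)
    have yt: "(y has_derivative (\<lambda>r. r *\<^sub>R left_field v (y t))) (at t)"
      using y(2)[of t] t \<eta> by (simp add: has_vector_derivative_def)
    have lin: "linear (\<lambda>w. frechet_derivative mu (at (y s, y t)) (0, w))"
      by (rule has_derivative_linear[OF mu_right_has_derivative[OF in\<Omega>(1)]])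
    have "((\<lambda>t. mu (y s, y t)) has_derivative
       (\<lambda>r. frechet_derivative mu (at (y s, y t)) (0, r *\<^sub>R left_field v (y t)))) (at t)"
      by (rule has_derivative_compose[OF yt mu_right_has_derivative[OF in\<Omega>(1)]])
    then show "mu (y s, y t) \<in> B \<and>
        ((\<lambda>t. mu (y s, y t)) has_vector_derivative left_field v (mu (y s, y t))) (at t)"
      using in\<Omega>(2) by (simp add: has_vector_derivative_def linear_cmul[OF lin] left_field_invariant[OF in\<Omega>(1)])
  qed (use \<eta> \<delta> st in auto)
  have y\<eta>: "y t \<in> \<phi> ` U" if "\<bar>t\<bar> < \<eta>" for t using yU[of t] that \<eta> by linarith
  obtain \<gamma> where \<gamma>: "\<And>t. \<gamma> t \<in> carrier N" "\<And>s t. \<gamma> (s + t) = \<gamma> s \<otimes>\<^bsub>N\<^esub> \<gamma> t"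
    "\<And>t. \<bar>t\<bar> < \<eta> \<Longrightarrow> \<gamma> t = param (y t)"
  proof (rule extend_local_homomorphism[OF \<eta>(1)])
    show "param (y t) \<in> carrier N" if "\<bar>t\<bar> < \<eta>" for t by (rule param_carrier[OF y\<eta>[OF that]])
    show "param (y (s + t)) = param (y s) \<otimes>\<^bsub>N\<^esub> param (y t)" if "\<bar>s\<bar> < \<eta>" "\<bar>t\<bar> < \<eta>" for s t
      using \<eta>(3)[OF that] by (simp add: add[OF that] param_mu \<Omega>_def)
  qed blast
  have sub: "{-\<eta><..<\<eta>} \<subseteq> {-\<delta><..<\<delta>}" using \<eta> by auto
  have smooth: "smooth_curve N \<gamma>"
    by (rule smooth_curve_of_local_homomorphism[OF \<gamma>(1,2) \<eta>(1) chart, of y])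
      (use y_Ck Ck_on_subset[OF _ sub] y\<eta> \<gamma>(3) in \<open>auto simp: smooth_on_def param_def\<close>)
  then have "one_parameter_subgroup N \<gamma>"
    using \<gamma>(2) by (simp add: one_parameter_subgroup_def)
  moreover have "velocity \<gamma> = v"
  proof -
    have "(y has_vector_derivative v) (at 0)" using y(2)[of 0] \<delta> by (simp add: y0 left_field_origin)
    then have "((\<lambda>t. \<phi> (\<gamma> t)) has_vector_derivative v) (at 0)"
      by (rule has_vector_derivative_transform_within_open[where S = "{-\<eta><..<\<eta>}"])
        (use \<eta> y\<eta> \<gamma>(3) in \<open>auto simp: chart_param\<close>)
    then show ?thesis unfolding velocity_def by (rule vector_derivative_at)
  qed
  ultimately show ?thesis by (rule that)
qed

text \<open>Elements of \<open>lie_algebra\<close> come from arbitrary smooth curves; a subgroup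
  with the same velocity shows that the choice in \<open>lie_exp\<close> is made from a nonempty
  set.\<close>

lemma lie_exp_one_parameter_subgroup:
  assumes "X \<in> lie_algebra N"
  obtains \<gamma> where "one_parameter_subgroup N \<gamma>" "velocity_field N \<gamma> = X" "lie_exp N X = \<gamma> 1"
proof -
  obtain c where c: "X = velocity_field N c" "smooth_curve N c" "c 0 = \<one>\<^bsub>N\<^esub>"
    using assms by (auto simp: lie_algebra_def)
  obtain \<gamma> where \<gamma>: "one_parameter_subgroup N \<gamma>" "velocity \<gamma> = velocity c"
    using exists_one_parameter_subgroup .
  have "velocity_field N \<gamma> = X"
    unfolding c(1) using c(2,3) \<gamma> one_parameter_subgroup_zero[OF \<gamma>(1)]
    by (intro velocity_field_cong) (auto simp: one_parameter_subgroup_def)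
  then have "\<exists>\<gamma>. one_parameter_subgroup N \<gamma> \<and> velocity_field N \<gamma> = X" using \<gamma>(1) by blast
  from someI_ex[OF this] show ?thesis
    by (intro that[of "SOME \<gamma>. one_parameter_subgroup N \<gamma> \<and> velocity_field N \<gamma> = X"])
      (auto simp: lie_exp_def)
qed

end


section \<open>Lipschitz vectors of a unitary representation\<close>

locale unitary_rep = lie_group_chart N U \<phi>
  for N :: "('g, 'a::euclidean_space) lie_group_data" and U \<phi> +
  fixes T :: "'g \<Rightarrow> 'h \<Rightarrow> 'h::complex_hilbert_space"
  assumes rep: "unitary_representation N T"
begin

lemma rep_add: "g \<in> carrier N \<Longrightarrow> T g (x + y) = T g x + T g y"
  using rep by (simp add: unitary_representation_def)

lemma rep_scaleR: "g \<in> carrier N \<Longrightarrow> T g (r *\<^sub>R x) = r *\<^sub>R T g x"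
  using rep by (simp add: unitary_representation_def scaleC_of_real[symmetric])

lemma rep_inner: "g \<in> carrier N \<Longrightarrow> T g x \<bullet> T g y = x \<bullet> y"
  using rep by (simp add: unitary_representation_def inner_eq_Re_cinner)

lemma rep_norm: "g \<in> carrier N \<Longrightarrow> norm (T g x) = norm x"
  by (simp add: norm_eq_sqrt_inner rep_inner)

lemma rep_bounded_linear: "g \<in> carrier N \<Longrightarrow> bounded_linear (T g)"
  by (rule bounded_linear_intro[of _ 1]) (simp_all add: rep_add rep_scaleR rep_norm)

lemma rep_diff: "g \<in> carrier N \<Longrightarrow> T g (x - y) = T g x - T g y"
  using rep_bounded_linear bounded_linear.linear linear_diff by blast

lemma rep_mult: "g \<in> carrier N \<Longrightarrow> g' \<in> carrier N \<Longrightarrow> T (g \<otimes>\<^bsub>N\<^esub> g') x = T g (T g' x)"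
  using rep by (simp add: unitary_representation_def)

text \<open>The identity acts by an idempotent isometry, which must fix every vector.\<close>

lemma rep_one: "T \<one>\<^bsub>N\<^esub> x = x"
proof -
  have "T \<one>\<^bsub>N\<^esub> (T \<one>\<^bsub>N\<^esub> x - x) = 0"
    using rep_mult[of "\<one>\<^bsub>N\<^esub>" "\<one>\<^bsub>N\<^esub>" x] by (simp add: rep_diff)
  then have "norm (T \<one>\<^bsub>N\<^esub> x - x) = 0" by (metis rep_norm one_closed norm_zero)
  then show ?thesis by simp
qed

lemma rep_continuous: "continuous_map (mtop N) euclidean (\<lambda>g. T g x)"
  using rep by (simp add: unitary_representation_def)

lemma rep_param_continuous: "continuous_on (\<phi> ` U) (\<lambda>y. T (param y) x)"
  using continuous_map_compose[OF param_continuous rep_continuous[of x]] by (simp add: o_def)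

lemma one_parameter_carrier: "one_parameter_subgroup N \<gamma> \<Longrightarrow> \<gamma> t \<in> carrier N"
  by (simp add: one_parameter_subgroup_def smooth_curve_carrier)

lemma one_parameter_add: "one_parameter_subgroup N \<gamma> \<Longrightarrow> \<gamma> (s + t) = \<gamma> s \<otimes>\<^bsub>N\<^esub> \<gamma> t"
  by (simp add: one_parameter_subgroup_def)

lemma rep_one_parameter_adjoint:
  assumes \<gamma>: "one_parameter_subgroup N \<gamma>"
  shows "T (\<gamma> t) x \<bullet> y = x \<bullet> T (\<gamma> (- t)) y"
proof -
  have "\<gamma> (- t) \<otimes>\<^bsub>N\<^esub> \<gamma> t = \<one>\<^bsub>N\<^esub>"
    using one_parameter_add[OF \<gamma>, of "- t" t] one_parameter_subgroup_zero[OF \<gamma>] by simp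
  then have "T (\<gamma> (- t)) (T (\<gamma> t) x) = x"
    using rep_mult[of "\<gamma> (- t)" "\<gamma> t" x] one_parameter_carrier[OF \<gamma>]
    by (simp add: rep_one)
  then show ?thesis
    using rep_inner[of "\<gamma> (- t)" "T (\<gamma> t) x" y] one_parameter_carrier[OF \<gamma>] by simp
qed

text \<open>The constant is uniform because the dilates of one group element may lie on different
  subgroups for different \<open>r\<close>. Quantifying over all subgroups covers whichever one
  \<open>lie_exp\<close> has chosen.\<close>

definition lipschitz_vector :: "'h \<Rightarrow> bool" where
  "lipschitz_vector h \<longleftrightarrow>
     (\<exists>C. \<forall>\<gamma>. one_parameter_subgroup N \<gamma> \<longrightarrow> norm (T (\<gamma> 1) h - h) \<le> C * norm (velocity \<gamma>))"

lemma garding_coefficient_has_derivative: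
  assumes "h \<in> garding_space N T"
  obtains D where "((\<lambda>y. T (param y) h \<bullet> h') has_derivative D) (at origin)"
proof -
  have "smooth_function N (\<lambda>g. cinner (T g h) h')" using assms by (simp add: garding_space_def)
  from smooth_on_has_derivative[OF smooth_function_chart[OF this chart] origin_in]
  have "((\<lambda>y. Re (cinner (T (param y) h) h')) has_derivative
      (\<lambda>v. Re (frechet_derivative (\<lambda>y. cinner (T (param y) h) h') (at origin) v))) (at origin)"
    unfolding param_def by (rule has_derivative_Re)
  then show ?thesis using that by (simp add: inner_eq_Re_cinner)
qed

text \<open>Difference quotients of the orbit in a coordinate direction converge when paired with
  any \<open>h'\<close>, hence are bounded in norm; the bound passes to the limit.\<close>

lemma garding_coefficient_derivative_bounded:
  assumes h: "h \<in> garding_space N T"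
  obtains C where "C \<ge> 0"
    "\<And>D h' w. ((\<lambda>y. T (param y) h \<bullet> h') has_derivative D) (at origin) \<Longrightarrow>
      \<bar>D w\<bar> \<le> C * norm w * norm h'"
proof -
  \<comment> \<open>For small \<open>k\<close> the point may leave the chart, where
    \<open>param\<close> is a default value. These finitely many terms do not affect the limits, and
    a convergent sequence is bounded as a whole.\<close>
  define w where "w i k = real (Suc k) *\<^sub>R (T (param (origin + inverse (real (Suc k)) *\<^sub>R i)) h - h)" for i k
  have lim: "(\<lambda>k. w i k \<bullet> h') \<longlonglongrightarrow> D i"
    if D: "((\<lambda>y. T (param y) h \<bullet> h') has_derivative D) (at origin)" for i h' D
  proof -
    have l: "((\<lambda>r. origin + r *\<^sub>R i) has_derivative (\<lambda>r. r *\<^sub>R i)) (at 0)"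
      by (auto intro!: derivative_eq_intros)
    have "((\<lambda>y. T (param y) h \<bullet> h') has_derivative D) (at (origin + 0 *\<^sub>R i))" using D by simp
    from has_derivative_compose[OF l this]
    have "((\<lambda>r. T (param (origin + r *\<^sub>R i)) h \<bullet> h') has_derivative (\<lambda>r. r * D i)) (at 0)"
      by (simp add: linear_cmul[OF has_derivative_linear[OF D]])
    then have "((\<lambda>r. T (param (origin + r *\<^sub>R i)) h \<bullet> h') has_real_derivative D i) (at 0)"
      by (simp add: has_real_derivative_iff_has_vector_derivative has_vector_derivative_def)
    then have "((\<lambda>r. (T (param (origin + r *\<^sub>R i)) h \<bullet> h' - h \<bullet> h') / r) \<longlongrightarrow> D i) (at 0)"
      by (simp add: DERIV_def param_origin rep_one)
    moreover have "filterlim (\<lambda>k. inverse (real (Suc k))) (at 0) sequentially"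
      using LIMSEQ_inverse_real_of_nat by (simp add: filterlim_at)
    ultimately have "(\<lambda>k. (T (param (origin + inverse (real (Suc k)) *\<^sub>R i)) h \<bullet> h' - h \<bullet> h') /
        inverse (real (Suc k))) \<longlonglongrightarrow> D i"
      by (rule filterlim_compose)
    then show ?thesis by (simp add: w_def inner_diff_left divide_inverse mult.commute)
  qed
  have "\<exists>M. \<forall>k. norm (w i k) \<le> M" for i
  proof -
    have "bounded (range (\<lambda>k. w i k \<bullet> h'))" for h'
      using garding_coefficient_has_derivative[OF h, of h'] lim convergent_imp_bounded by metis
    then have "bounded (range (w i))" by (rule weakly_bounded_imp_bounded)
    then show ?thesis by (auto simp: bounded_iff)
  qed
  then obtain M where M: "\<And>i k. norm (w i k) \<le> M i" by metis
  have M0: "M i \<ge> 0" for i using M[of i 0] norm_ge_zero order_trans by blast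
  show ?thesis
  proof (rule that)
    show "(\<Sum>i\<in>Basis. M i) \<ge> 0" by (intro sum_nonneg M0)
    fix D h' x
    assume D: "((\<lambda>y. T (param y) h \<bullet> h') has_derivative D) (at origin)"
    have Di: "\<bar>D i\<bar> \<le> M i * norm h'" for i
    proof (rule tendsto_upperbound[OF tendsto_rabs[OF lim[OF D]]])
      have "\<bar>w i k \<bullet> h'\<bar> \<le> M i * norm h'" for k
        using Cauchy_Schwarz_ineq2[of "w i k" h'] mult_right_mono[OF M[of i k], of "norm h'"] by simp
      then show "\<forall>\<^sub>F k in sequentially. \<bar>w i k \<bullet> h'\<bar> \<le> M i * norm h'" by simp
    qed simp
    have "\<bar>D x\<bar> = \<bar>\<Sum>i\<in>Basis. (x \<bullet> i) *\<^sub>R D i\<bar>"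
      by (subst linear_sum_Basis[OF has_derivative_linear[OF D]]) simp
    also have "\<dots> \<le> (\<Sum>i\<in>Basis. \<bar>(x \<bullet> i) *\<^sub>R D i\<bar>)" by (rule sum_abs)
    also have "\<dots> \<le> (\<Sum>i\<in>Basis. norm x * (M i * norm h'))"
      by (intro sum_mono) (auto simp: abs_mult intro!: mult_mono Basis_le_norm Di)
    also have "\<dots> = (\<Sum>i\<in>Basis. M i) * norm x * norm h'"
      by (simp add: sum_distrib_left sum_distrib_right mult_ac)
    finally show "\<bar>D x\<bar> \<le> (\<Sum>i\<in>Basis. M i) * norm x * norm h'" .
  qed
qed

lemma garding_lipschitz_vector:
  assumes h: "h \<in> garding_space N T"
  shows "lipschitz_vector h"
proof -
  obtain C where C: "C \<ge> 0"
    "\<And>D h' w. ((\<lambda>y. T (param y) h \<bullet> h') has_derivative D) (at origin) \<Longrightarrow>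
      \<bar>D w\<bar> \<le> C * norm w * norm h'"
    using garding_coefficient_derivative_bounded[OF h] by blast
  have "norm (T (\<gamma> 1) h - h) \<le> C * norm (velocity \<gamma>)" if \<gamma>: "one_parameter_subgroup N \<gamma>" for \<gamma>
  proof -
    have curve: "smooth_curve N \<gamma>" "\<gamma> 0 = \<one>\<^bsub>N\<^esub>"
      using \<gamma> one_parameter_subgroup_zero[OF \<gamma>] by (auto simp: one_parameter_subgroup_def)
    \<comment> \<open>Pairing with the displacement itself makes \<open>q 1 - q 0\<close> the square
      of its norm, so the mean value estimate can be divided by \<open>norm h'\<close>.\<close>
    define h' where "h' = T (\<gamma> 1) h - h"
    define q where "q t = T (\<gamma> t) h \<bullet> h'" for t
    have "\<exists>d. (q has_vector_derivative d) (at t) \<and> \<bar>d\<bar> \<le> C * norm (velocity \<gamma>) * norm h'" for t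
    proof -
      obtain D where D: "((\<lambda>y. T (param y) h \<bullet> T (\<gamma> (- t)) h') has_derivative D) (at origin)"
        using garding_coefficient_has_derivative[OF h] .
      have q: "q s = T (\<gamma> (s - t)) h \<bullet> T (\<gamma> (- t)) h'" for s
      proof -
        have "T (\<gamma> s) h = T (\<gamma> t) (T (\<gamma> (s - t)) h)"
          using one_parameter_add[OF \<gamma>, of t "s - t"] one_parameter_carrier[OF \<gamma>] by (simp add: rep_mult)
        then show ?thesis by (simp add: q_def rep_one_parameter_adjoint[OF \<gamma>, of t])
      qed
      have "((\<lambda>s. T (\<gamma> s) h \<bullet> T (\<gamma> (- t)) h') has_vector_derivative D (velocity \<gamma>)) (at 0)"
        by (rule has_derivative_along_curve[OF curve D])
      then have "((\<lambda>s. T (\<gamma> s) h \<bullet> T (\<gamma> (- t)) h') has_real_derivative D (velocity \<gamma>)) (at (t - t))"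
        by (simp add: has_real_derivative_iff_has_vector_derivative)
      moreover have "((\<lambda>s. s - t) has_real_derivative 1) (at t)" by (auto intro!: derivative_eq_intros)
      ultimately have "(q has_real_derivative D (velocity \<gamma>) * 1) (at t)"
        unfolding q[abs_def] by (rule DERIV_chain2)
      moreover have "\<bar>D (velocity \<gamma>)\<bar> \<le> C * norm (velocity \<gamma>) * norm h'"
        using C(2)[OF D, of "velocity \<gamma>"] one_parameter_carrier[OF \<gamma>] by (simp add: rep_norm)
      ultimately show ?thesis by (auto simp: has_real_derivative_iff_has_vector_derivative)
    qed
    then obtain q' where q': "\<And>t. (q has_vector_derivative q' t) (at t)"
      "\<And>t. \<bar>q' t\<bar> \<le> C * norm (velocity \<gamma>) * norm h'" by metis
    have "norm (q 1 - q 0) \<le> C * norm (velocity \<gamma>) * norm h' * norm (1 - 0 :: real)"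
    proof (rule differentiable_bound[of UNIV q "\<lambda>t r. r *\<^sub>R q' t"])
      show "(q has_derivative (\<lambda>r. r *\<^sub>R q' t)) (at t within UNIV)" for t
        using q'(1)[of t] by (simp add: has_vector_derivative_def)
      show "onorm (\<lambda>r. r *\<^sub>R q' t) \<le> C * norm (velocity \<gamma>) * norm h'" for t
        using mult_left_mono[OF q'(2)[of t]] by (intro onorm_le) (simp add: abs_mult mult.commute)
    qed auto
    moreover have "q 1 - q 0 = norm h' * norm h'"
      by (simp add: q_def h'_def curve(2) rep_one inner_diff_left[symmetric] power2_norm_eq_inner[symmetric] power2_eq_square)
    ultimately have "norm h' * norm h' \<le> C * norm (velocity \<gamma>) * norm h'" by simp
    then show ?thesis using C(1) by (cases "h' = 0") (auto simp: h'_def)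
  qed
  then show ?thesis by (auto simp: lipschitz_vector_def)
qed

text \<open>Time \<open>1\<close> is cut into equal short steps, and unitarity makes each contribute
  the same displacement. The range \<open>\<epsilon>\<close> may depend on the subgroup because only
  \<open>C\<close> enters the conclusion.\<close>

lemma lipschitz_vectorI:
  assumes "\<And>\<gamma>. one_parameter_subgroup N \<gamma> \<Longrightarrow>
    \<exists>\<epsilon>>0. \<forall>s. 0 < s \<longrightarrow> s < \<epsilon> \<longrightarrow> norm (T (\<gamma> s) h - h) \<le> s * (C * norm (velocity \<gamma>))"
  shows "lipschitz_vector h"
  unfolding lipschitz_vector_def
proof (intro exI allI impI)
  fix \<gamma> assume \<gamma>: "one_parameter_subgroup N \<gamma>"
  obtain \<epsilon> where \<epsilon>: "\<epsilon> > 0" "\<And>s. 0 < s \<Longrightarrow> s < \<epsilon> \<Longrightarrow> norm (T (\<gamma> s) h - h) \<le> s * (C * norm (velocity \<gamma>))"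
    using assms[OF \<gamma>] by blast
  have multiple: "norm (T (\<gamma> (real m * s)) h - h) \<le> real m * norm (T (\<gamma> s) h - h)" for m s
  proof (induction m)
    case 0
    show ?case by (simp add: one_parameter_subgroup_zero[OF \<gamma>] rep_one)
  next
    case (Suc m)
    have "T (\<gamma> (real (Suc m) * s)) h - h = T (\<gamma> s) (T (\<gamma> (real m * s)) h - h) + (T (\<gamma> s) h - h)"
      using one_parameter_add[OF \<gamma>, of s "real m * s"] one_parameter_carrier[OF \<gamma>]
      by (simp add: rep_mult rep_diff algebra_simps)
    also have "norm \<dots> \<le> norm (T (\<gamma> (real m * s)) h - h) + norm (T (\<gamma> s) h - h)"
      using norm_triangle_ineq one_parameter_carrier[OF \<gamma>] by (metis rep_norm)
    also have "\<dots> \<le> real (Suc m) * norm (T (\<gamma> s) h - h)" using Suc by (simp add: algebra_simps)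
    finally show ?case .
  qed
  obtain m where m: "inverse (real (Suc m)) < \<epsilon>" using reals_Archimedean[OF \<epsilon>(1)] by blast
  define s where "s = inverse (real (Suc m))"
  have s: "s > 0" "s < \<epsilon>" "real (Suc m) * s = 1" using m by (auto simp: s_def field_simps)
  have "norm (T (\<gamma> 1) h - h) \<le> real (Suc m) * norm (T (\<gamma> s) h - h)"
    using multiple[of "Suc m" s] unfolding s(3) .
  also have "\<dots> \<le> real (Suc m) * (s * (C * norm (velocity \<gamma>)))"
    by (intro mult_left_mono \<epsilon>(2) s) auto
  also have "\<dots> = (real (Suc m) * s) * (C * norm (velocity \<gamma>))" by (simp only: mult.assoc)
  also have "\<dots> = C * norm (velocity \<gamma>)" by (simp only: s(3) mult_1_left)
  finally show "norm (T (\<gamma> 1) h - h) \<le> C * norm (velocity \<gamma>)" .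
qed

end


section \<open>Existence of a Lipschitz vector\<close>

lemma Ck_on_real_polynomial_function:
  fixes q :: "'a::euclidean_space \<Rightarrow> real"
  assumes "real_polynomial_function q"
  shows "Ck_on k UNIV q"
  using assms
  by induction (auto intro: Ck_on_bounded_linear Ck_on_const Ck_on_add Ck_on_mult)

text \<open>Converts linear dependence of the field on \<open>v\<close> into a bound linear in
  \<open>norm v\<close>; this makes the constant for the average independent of the
  subgroup.\<close>

lemma integral_abs_divergence_sum_le:
  fixes X :: "'a::euclidean_space \<Rightarrow> 'a \<Rightarrow> 'a"
  assumes S: "open S" "cbox a b \<subseteq> S" and X: "\<And>i. Ck_on 1 S (X i)"
    and Y: "\<And>y. y \<in> S \<Longrightarrow> Y y = (\<Sum>i\<in>Basis. (v \<bullet> i) *\<^sub>R X i y)"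
  shows "integral (cbox a b) (\<lambda>y. \<bar>divergence Y y\<bar>)
    \<le> (\<Sum>i\<in>Basis. integral (cbox a b) (\<lambda>y. \<bar>divergence (X i) y\<bar>)) * norm v"
proof -
  have dX: "(X i has_derivative frechet_derivative (X i) (at y)) (at y)" if "y \<in> S" for i y
    using Ck_on_Suc_has_derivative[of 0 S "X i" y] X[of i] that by simp
  have div: "divergence Y y = (\<Sum>i\<in>Basis. (v \<bullet> i) * divergence (X i) y)" if y: "y \<in> S" for y
  proof -
    have "((\<lambda>y. \<Sum>i\<in>Basis. (v \<bullet> i) *\<^sub>R X i y) has_derivative
        (\<lambda>w. \<Sum>i\<in>Basis. (v \<bullet> i) *\<^sub>R frechet_derivative (X i) (at y) w)) (at y)"
      by (intro has_derivative_sum has_derivative_scaleR_right dX[OF y])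
    then have "(Y has_derivative
        (\<lambda>w. \<Sum>i\<in>Basis. (v \<bullet> i) *\<^sub>R frechet_derivative (X i) (at y) w)) (at y)"
      by (rule has_derivative_transform_within_open[OF _ S(1) y]) (simp add: Y)
    then have "frechet_derivative Y (at y) =
        (\<lambda>w. \<Sum>i\<in>Basis. (v \<bullet> i) *\<^sub>R frechet_derivative (X i) (at y) w)"
      by (rule frechet_derivative_at[symmetric])
    then have "divergence Y y = (\<Sum>j\<in>Basis. \<Sum>i\<in>Basis. (v \<bullet> i) * (frechet_derivative (X i) (at y) j \<bullet> j))"
      by (simp add: divergence_def inner_sum_left)
    also have "\<dots> = (\<Sum>i\<in>Basis. (v \<bullet> i) * divergence (X i) y)"
      by (subst sum.swap) (simp add: divergence_def sum_distrib_left)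
    finally show ?thesis .
  qed
  have cX: "continuous_on (cbox a b) (divergence (X i))" for i
    using continuous_on_divergence[OF X] S(2) by (rule continuous_on_subset)
  have "integral (cbox a b) (\<lambda>y. \<bar>divergence Y y\<bar>) =
      integral (cbox a b) (\<lambda>y. \<bar>\<Sum>i\<in>Basis. (v \<bullet> i) * divergence (X i) y\<bar>)"
    by (rule integral_cong) (use div S(2) in auto)
  also have "\<dots> \<le> integral (cbox a b) (\<lambda>y. \<Sum>i\<in>Basis. norm v * \<bar>divergence (X i) y\<bar>)"
  proof (rule integral_le)
    fix y
    have "\<bar>\<Sum>i\<in>Basis. (v \<bullet> i) * divergence (X i) y\<bar> \<le> (\<Sum>i\<in>Basis. \<bar>(v \<bullet> i) * divergence (X i) y\<bar>)"
      by (rule sum_abs)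
    also have "\<dots> \<le> (\<Sum>i\<in>Basis. norm v * \<bar>divergence (X i) y\<bar>)"
      by (intro sum_mono) (auto simp: abs_mult intro!: mult_right_mono Basis_le_norm)
    finally show "\<bar>\<Sum>i\<in>Basis. (v \<bullet> i) * divergence (X i) y\<bar> \<le> (\<Sum>i\<in>Basis. norm v * \<bar>divergence (X i) y\<bar>)" .
  qed (intro integrable_continuous continuous_intros cX)+
  also have "\<dots> = (\<Sum>i\<in>Basis. integral (cbox a b) (\<lambda>y. norm v * \<bar>divergence (X i) y\<bar>))"
    by (rule integral_sum) (auto intro!: integrable_continuous continuous_intros cX)
  also have "\<dots> = (\<Sum>i\<in>Basis. integral (cbox a b) (\<lambda>y. \<bar>divergence (X i) y\<bar>)) * norm v"
    by (simp add: sum_distrib_left mult.commute)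
  finally show ?thesis .
qed

lemma le_if_le_add_multiple:
  fixes x A B :: real
  assumes "\<And>e. e > 0 \<Longrightarrow> x \<le> A + e * B"
  shows "x \<le> A"
proof (rule tendsto_lowerbound)
  show "((\<lambda>e. A + e * B) \<longlongrightarrow> A) (at_right 0)" by (auto intro!: tendsto_eq_intros)
  show "\<forall>\<^sub>F e in at_right 0. x \<le> A + e * B"
    using assms by (auto simp: eventually_at_right_field intro!: exI[of _ 1])
qed simp

context lie_group_chart
begin

lemma right_field_sum: "y \<in> \<phi> ` U \<Longrightarrow> right_field v y = (\<Sum>i\<in>Basis. (v \<bullet> i) *\<^sub>R right_field i y)"
proof -
  assume y: "y \<in> \<phi> ` U"
  have lin: "linear (frechet_derivative mu (at (origin, y)))"
    by (rule has_derivative_linear[OF mu_has_derivative[OF origin_mu_domain(1)[OF y]]])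
  have "linear (\<lambda>v. right_field v y)"
    unfolding right_field_def using linear_compose[OF _ lin, of "\<lambda>v. (v, 0)"]
    by (auto simp: o_def linear_iff)
  then show ?thesis by (rule linear_sum_Basis)
qed

text \<open>In the chart, left translation by a one-parameter subgroup is the flow of a right-invariant
  field, so a function \<open>q\<close> composed with it is transported along that field.\<close>

lemma left_flow_transport:
  assumes \<gamma>: "one_parameter_subgroup N \<gamma>" and Q: "compact Q" "Q \<subseteq> \<phi> ` U"
  obtains s0 W where "s0 > 0" "open W" "{0..s0} \<times> Q \<subseteq> W"
    "continuous_on W (\<lambda>z. \<phi> (\<gamma> (fst z) \<otimes>\<^bsub>N\<^esub> param (snd z)))"
    "\<And>z. z \<in> W \<Longrightarrow> \<gamma> (fst z) \<otimes>\<^bsub>N\<^esub> param (snd z) \<in> U"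
    "\<And>q. Ck_on 1 UNIV q \<Longrightarrow> Ck_on 1 W (\<lambda>z. q (\<phi> (\<gamma> (fst z) \<otimes>\<^bsub>N\<^esub> param (snd z))) :: real)"
    "\<And>q s y. Ck_on 1 UNIV q \<Longrightarrow> (s, y) \<in> W \<Longrightarrow>
      frechet_derivative (\<lambda>z. q (\<phi> (\<gamma> (fst z) \<otimes>\<^bsub>N\<^esub> param (snd z))) :: real) (at (s, y)) (1, 0) =
      frechet_derivative (\<lambda>z. q (\<phi> (\<gamma> (fst z) \<otimes>\<^bsub>N\<^esub> param (snd z)))) (at (s, y)) (0, right_field (velocity \<gamma>) y)"
proof -
  have curve: "smooth_curve N \<gamma>" "\<gamma> 0 = \<one>\<^bsub>N\<^esub>" and hom: "\<And>s t. \<gamma> (s + t) = \<gamma> s \<otimes>\<^bsub>N\<^esub> \<gamma> t"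
    using \<gamma> one_parameter_subgroup_zero[OF \<gamma>] by (auto simp: one_parameter_subgroup_def)
  note carrier = smooth_curve_carrier[OF curve(1)]
  define \<kappa> where "\<kappa> z = (\<phi> (\<gamma> (fst z)), snd z)" for z :: "real \<times> 'a"
  define S where "S = {t. \<gamma> t \<in> U} \<times> (UNIV :: 'a set)"
  have S: "open S" unfolding S_def by (intro open_Times open_curve_domain[OF curve(1)] open_UNIV)
  have \<kappa>: "smooth_on S \<kappa>"
    unfolding \<kappa>_def[abs_def]
  proof (rule smooth_on_Pair[OF S])
    show "smooth_on S snd"
      unfolding smooth_on_def by (intro allI Ck_on_bounded_linear bounded_linear_snd S)
    have "smooth_on S fst"
      unfolding smooth_on_def by (intro allI Ck_on_bounded_linear bounded_linear_fst S)
    then show "smooth_on S (\<lambda>z. \<phi> (\<gamma> (fst z)))"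
      by (rule smooth_on_compose[OF S open_curve_domain[OF curve(1)] _ _ curve_coordinates_smooth[OF curve(1)], rotated])
        (auto simp: S_def)
  qed
  define W where "W = S \<inter> \<kappa> -` mu_domain"
  have "continuous_on S \<kappa>" using \<kappa> Ck_on_continuous unfolding smooth_on_def by blast
  then have W: "open W" unfolding W_def by (rule continuous_open_preimage[OF _ S open_mu_domain])
  define \<Lambda> where "\<Lambda> z = \<phi> (\<gamma> (fst z) \<otimes>\<^bsub>N\<^esub> param (snd z))" for z
  have W_iff: "(s, y) \<in> W \<longleftrightarrow> \<gamma> s \<in> U \<and> y \<in> \<phi> ` U \<and> \<gamma> s \<otimes>\<^bsub>N\<^esub> param y \<in> U" for s y
    by (cases "\<gamma> s \<in> U") (simp_all add: W_def S_def \<kappa>_def mu_domain_def param_chart)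
  have \<Lambda>_eq: "mu (\<kappa> z) = \<Lambda> z" if "z \<in> W" for z
    using that by (auto simp: W_def S_def \<kappa>_def mu_def \<Lambda>_def param_chart)
  have "smooth_on W (\<lambda>z. mu (\<kappa> z))"
    by (rule smooth_on_compose[OF W open_mu_domain _ smooth_on_subset[OF \<kappa>] mu_smooth]) (auto simp: W_def)
  then have \<Lambda>: "smooth_on W \<Lambda>" by (rule smooth_on_cong[OF W, rotated]) (rule \<Lambda>_eq)
  then have \<Lambda>_Ck: "Ck_on k W \<Lambda>" for k by (simp add: smooth_on_def)
  \<comment> \<open>The compact slice at time \<open>0\<close> lies in the open set
    \<open>W\<close>, so the tube lemma gives one time bound for all of \<open>Q\<close>.\<close>
  have "{0} \<times> Q \<subseteq> W"
    using Q(2) one_in by (auto simp: W_iff curve(2) param_in param_carrier subset_iff)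
  then obtain X0 where X0: "0 \<in> X0" "open X0" "X0 \<times> Q \<subseteq> W"
    using Elementary_Topology.tube_lemma[OF Q(1) W] by blast
  then obtain e where e: "e > 0" "ball 0 e \<subseteq> X0" by (auto simp: open_contains_ball)
  show ?thesis
  proof (rule that)
    show "e / 2 > 0" using e by simp
    show "open W" by (rule W)
    show "{0..e / 2} \<times> Q \<subseteq> W" using e X0(3) by (auto simp: dist_real_def subset_iff)
    show "continuous_on W (\<lambda>z. \<phi> (\<gamma> (fst z) \<otimes>\<^bsub>N\<^esub> param (snd z)))"
      using Ck_on_continuous[OF \<Lambda>_Ck[of 0]] by (simp add: \<Lambda>_def[abs_def])
    show "\<gamma> (fst z) \<otimes>\<^bsub>N\<^esub> param (snd z) \<in> U" if "z \<in> W" for z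
      using that W_iff[of "fst z" "snd z"] by simp
  next
    fix q :: "'a \<Rightarrow> real" assume q: "Ck_on 1 UNIV q"
    have E: "Ck_on 1 W (\<lambda>z. q (\<Lambda> z))"
      by (rule Ck_on_compose[OF W open_UNIV _ \<Lambda>_Ck q]) simp
    then show "Ck_on 1 W (\<lambda>z. q (\<phi> (\<gamma> (fst z) \<otimes>\<^bsub>N\<^esub> param (snd z))))"
      by (simp add: \<Lambda>_def del: Ck_on.simps)
    fix s y assume sy: "(s, y) \<in> W"
    then have y: "y \<in> \<phi> ` U" by (simp add: W_iff)
    let ?E = "\<lambda>z. q (\<Lambda> z)"
    have dE: "(?E has_derivative frechet_derivative ?E (at (s, y))) (at (s, y))"
      using Ck_on_Suc_has_derivative[of 0 W ?E] E sy by simp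
    have lin: "linear (frechet_derivative ?E (at (s, y)))" by (rule has_derivative_linear[OF dE])
    \<comment> \<open>The point \<open>\<gamma> (s + r) y\<close> equals
      \<open>\<gamma> s (\<gamma> r y)\<close>. One form varies the time, the other moves
      \<open>y\<close> with initial velocity \<open>right_field (velocity \<gamma>) y\<close>; the
      two derivatives in \<open>r\<close> at \<open>0\<close> must agree.\<close>
    have "((\<lambda>r. (s + r, y)) has_derivative (\<lambda>r. (r, 0))) (at 0)" by (auto intro!: derivative_eq_intros)
    then have "((\<lambda>r. ?E (s + r, y)) has_derivative (\<lambda>r. frechet_derivative ?E (at (s, y)) (r, 0))) (at 0)"
      by (rule has_derivative_compose) (simp add: dE)
    moreover have "((\<lambda>r. ?E (s + r, y)) has_derivative
        (\<lambda>r. frechet_derivative ?E (at (s, y)) (0, r *\<^sub>R right_field (velocity \<gamma>) y))) (at 0)"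
    proof -
      have v: "((\<lambda>r. \<phi> (\<gamma> r)) has_derivative (\<lambda>r. r *\<^sub>R velocity \<gamma>)) (at 0)"
        using velocity_has_vector_derivative[OF curve] by (simp add: has_vector_derivative_def)
      have "((\<lambda>r. (\<phi> (\<gamma> r), y)) has_derivative (\<lambda>r. (r *\<^sub>R velocity \<gamma>, 0))) (at 0)"
        by (intro has_derivative_Pair v has_derivative_const)
      then have "((\<lambda>r. mu (\<phi> (\<gamma> r), y)) has_derivative
          (\<lambda>r. frechet_derivative mu (at (origin, y)) (r *\<^sub>R velocity \<gamma>, 0))) (at 0)"
        by (rule has_derivative_compose)
          (simp add: curve(2) origin_def[symmetric] mu_has_derivative origin_mu_domain[OF y])
      moreover have "frechet_derivative mu (at (origin, y)) (r *\<^sub>R velocity \<gamma>, 0) =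
          r *\<^sub>R right_field (velocity \<gamma>) y" for r
        using linear_cmul[OF has_derivative_linear[OF mu_has_derivative[OF origin_mu_domain(1)[OF y]]],
            of r "(velocity \<gamma>, 0)"]
        by (simp add: right_field_def)
      ultimately have "((\<lambda>r. (s, mu (\<phi> (\<gamma> r), y))) has_derivative
          (\<lambda>r. (0, r *\<^sub>R right_field (velocity \<gamma>) y))) (at 0)"
        by (intro has_derivative_Pair has_derivative_const) simp
      then have "((\<lambda>r. ?E (s, mu (\<phi> (\<gamma> r), y))) has_derivative
          (\<lambda>r. frechet_derivative ?E (at (s, y)) (0, r *\<^sub>R right_field (velocity \<gamma>) y))) (at 0)"
        by (rule has_derivative_compose)
          (simp add: curve(2) origin_def[symmetric] mu_origin[OF y] dE)
      then show ?thesis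
      proof (rule has_derivative_transform_within_open)
        show "open ((\<lambda>r. (r, y)) -` W)" by (intro open_vimage W continuous_intros)
        show "0 \<in> (\<lambda>r. (r, y)) -` W" using y one_in by (simp add: W_iff curve(2) param_in param_carrier)
        fix r assume "r \<in> (\<lambda>r. (r, y)) -` W"
        then have r: "\<gamma> r \<in> U" "\<gamma> r \<otimes>\<^bsub>N\<^esub> param y \<in> U" by (auto simp: W_iff)
        have "param (mu (\<phi> (\<gamma> r), y)) = \<gamma> r \<otimes>\<^bsub>N\<^esub> param y"
          using r by (simp add: mu_def param_chart)
        then have "\<Lambda> (s, mu (\<phi> (\<gamma> r), y)) = \<Lambda> (s + r, y)"
          using hom[of s r] carrier param_carrier[OF y] by (simp add: \<Lambda>_def m_assoc)
        then show "?E (s, mu (\<phi> (\<gamma> r), y)) = ?E (s + r, y)" by simp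
      qed
    qed
    ultimately have "(\<lambda>r. frechet_derivative ?E (at (s, y)) (r, 0)) =
        (\<lambda>r. frechet_derivative ?E (at (s, y)) (0, r *\<^sub>R right_field (velocity \<gamma>) y))"
      by (rule has_derivative_unique)
    from fun_cong[OF this, of 1]
    show "frechet_derivative (\<lambda>z. q (\<phi> (\<gamma> (fst z) \<otimes>\<^bsub>N\<^esub> param (snd z)))) (at (s, y)) (1, 0) =
      frechet_derivative (\<lambda>z. q (\<phi> (\<gamma> (fst z) \<otimes>\<^bsub>N\<^esub> param (snd z)))) (at (s, y)) (0, right_field (velocity \<gamma>) y)"
      by (simp add: \<Lambda>_def)
  qed
qed

end

context unitary_rep
begin

lemma exists_lipschitz_vector:
  assumes h0: "(h0 :: 'h) \<noteq> 0"
  obtains h where "h \<noteq> 0" "lipschitz_vector h"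
proof -
  define F where "F y = T (param y) h0" for y
  have contF: "continuous_on (\<phi> ` U) F"
    unfolding F_def[abs_def] by (rule rep_param_continuous)
  \<comment> \<open>Within half the norm of \<open>h0\<close> the pairing of the orbit with
    \<open>h0\<close> stays positive, which prevents the average from vanishing.\<close>
  have "open (\<phi> ` U \<inter> F -` ball h0 (norm h0 / 2))"
    by (rule continuous_open_preimage[OF contF open_range open_ball])
  moreover have "origin \<in> \<phi> ` U \<inter> F -` ball h0 (norm h0 / 2)"
    using origin_in h0 by (simp add: F_def param_origin rep_one)
  ultimately obtain a b where ab: "cbox a b \<subseteq> \<phi> ` U \<inter> F -` ball h0 (norm h0 / 2)" "origin \<in> box a b"
    using open_contains_cbox by metis
  have sub: "cbox a b \<subseteq> \<phi> ` U" using ab(1) by blast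
  obtain \<rho> where \<rho>: "\<rho> > 0" "cball origin \<rho> \<subseteq> box a b"
    using open_box ab(2) open_contains_cball by blast
  define \<psi> where "\<psi> = ball_bump origin \<rho>"
  have \<psi>_Ck: "Ck_on k S \<psi>" for k S
    unfolding \<psi>_def by (rule Ck_on_subset[OF Ck_on_ball_bump]) simp
  have cont\<psi>: "continuous_on S \<psi>" for S by (rule Ck_on_continuous[OF \<psi>_Ck[of 0]])
  have \<psi>0: "\<psi> y \<ge> 0" for y by (simp add: \<psi>_def ball_bump_nonneg)
  have contF': "continuous_on (cbox a b) F" using contF sub by (rule continuous_on_subset)
  define h where "h = integral (cbox a b) (\<lambda>y. \<psi> y *\<^sub>R F y)"
  have int_h: "(\<lambda>y. \<psi> y *\<^sub>R F y) integrable_on cbox a b"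
    by (intro integrable_continuous continuous_on_scaleR cont\<psi> contF')
  have inner_integral: "h \<bullet> x = integral (cbox a b) (\<lambda>y. \<psi> y * (F y \<bullet> x))" for x
    using integral_linear[OF int_h bounded_linear_inner_left[of x]] by (simp add: h_def o_def)
  have "h \<noteq> 0"
  proof
    assume "h = 0"
    have c: "continuous_on (cbox a b) (\<lambda>y. \<psi> y * (F y \<bullet> h0))"
      by (intro continuous_on_mult continuous_on_inner cont\<psi> contF' continuous_on_const)
    have pos: "F y \<bullet> h0 > 0" if "y \<in> cbox a b" for y
    proof -
      have "norm (h0 - F y) < norm h0 / 2" using ab(1) that by (auto simp: dist_norm)
      then have "norm (h0 - F y) * norm h0 < norm h0 / 2 * norm h0"
        using h0 by (intro mult_strict_right_mono) auto
      moreover have "(h0 - F y) \<bullet> h0 \<le> norm (h0 - F y) * norm h0" by (rule norm_cauchy_schwarz)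
      moreover have "(h0 - F y) \<bullet> h0 = norm h0 * norm h0 - F y \<bullet> h0"
        by (simp add: inner_diff_left power2_norm_eq_inner[symmetric] power2_eq_square)
      moreover have "norm h0 * norm h0 > 0" using h0 by simp
      ultimately show ?thesis by linarith
    qed
    \<comment> \<open>A nonnegative continuous integrand of integral zero vanishes at every point of
      the box.\<close>
    have "\<psi> origin * (F origin \<bullet> h0) = 0"
    proof (rule has_integral_0_cbox_imp_0[OF c])
      show "((\<lambda>y. \<psi> y * (F y \<bullet> h0)) has_integral 0) (cbox a b)"
        using integrable_integral[OF integrable_continuous[OF c]] inner_integral[of h0] \<open>h = 0\<close> by simp
      show "0 \<le> \<psi> y * (F y \<bullet> h0)" if "y \<in> box a b" for y
        using less_imp_le[OF pos[of y]] \<psi>0[of y] box_subset_cbox[of a b] that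
        by (intro mult_nonneg_nonneg) auto
      show "box a b \<noteq> {}" "origin \<in> cbox a b" using ab(2) box_subset_cbox by auto
    qed
    moreover have "\<psi> origin > 0" unfolding \<psi>_def using \<rho> by (intro ball_bump_pos) simp
    moreover have "F origin \<bullet> h0 > 0" using ab(2) box_subset_cbox by (intro pos) auto
    ultimately show False by simp
  qed
  moreover have "lipschitz_vector h"
  proof (rule lipschitz_vectorI)
    define C where "C = norm h0 *
      (\<Sum>i\<in>Basis. integral (cbox a b) (\<lambda>y. \<bar>divergence (\<lambda>y. \<psi> y *\<^sub>R right_field i y) y\<bar>))"
    fix \<gamma> assume \<gamma>: "one_parameter_subgroup N \<gamma>"
    let ?v = "velocity \<gamma>"
    define \<Lambda> where "\<Lambda> z = \<phi> (\<gamma> (fst z) \<otimes>\<^bsub>N\<^esub> param (snd z))" for z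
    define I where "I = integral (cbox a b) (\<lambda>y. \<bar>divergence (\<lambda>y. \<psi> y *\<^sub>R right_field ?v y) y\<bar>)"
    have "continuous_on (\<phi> ` U) (divergence (\<lambda>y. \<psi> y *\<^sub>R right_field ?v y))"
      by (intro continuous_on_divergence Ck_on_scaleR open_range \<psi>_Ck Ck_on_right_field)
    then have "(\<lambda>y. \<bar>divergence (\<lambda>y. \<psi> y *\<^sub>R right_field ?v y) y\<bar>) integrable_on cbox a b"
      by (intro integrable_continuous continuous_on_rabs) (rule continuous_on_subset[OF _ sub])
    then have I0: "I \<ge> 0" unfolding I_def by (rule integral_nonneg) simp
    obtain s0 W where s0: "s0 > 0" and W: "open W" "{0..s0} \<times> cbox a b \<subseteq> W"
      and \<Lambda>_cont: "continuous_on W \<Lambda>"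
      and \<Lambda>_in: "\<And>z. z \<in> W \<Longrightarrow> \<gamma> (fst z) \<otimes>\<^bsub>N\<^esub> param (snd z) \<in> U"
      and \<Lambda>_Ck: "\<And>q. Ck_on 1 UNIV q \<Longrightarrow> Ck_on 1 W (\<lambda>z. q (\<Lambda> z) :: real)"
      and transport: "\<And>q s y. Ck_on 1 UNIV q \<Longrightarrow> (s, y) \<in> W \<Longrightarrow>
        frechet_derivative (\<lambda>z. q (\<Lambda> z) :: real) (at (s, y)) (1, 0) =
        frechet_derivative (\<lambda>z. q (\<Lambda> z)) (at (s, y)) (0, right_field ?v y)"
    proof (rule left_flow_transport[OF \<gamma> compact_cbox sub, folded \<Lambda>_def], goal_cases)
      case (1 s0 W)
      show ?case by (rule 1(1)[OF 1(2-5)]) (rule 1(6-8); assumption)+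
    qed
    \<comment> \<open>A weak estimate, since a scalar coefficient can be approximated by
      polynomials; taking \<open>x\<close> to be the displacement recovers the norm
      afterwards.\<close>
    have bound: "\<bar>(T (\<gamma> s) h - h) \<bullet> x\<bar> \<le> s * (norm h0 * norm x * I)" if s: "s \<in> {0..s0}" for s x
    proof -
      define f where "f y = F y \<bullet> x" for y
      have f_bd: "\<bar>f y\<bar> \<le> norm h0 * norm x" if "y \<in> \<phi> ` U" for y
        unfolding f_def F_def using Cauchy_Schwarz_ineq2[of "T (param y) h0" x] rep_norm[OF param_carrier[OF that]] by simp
      have contf: "continuous_on (\<phi> ` U) f"
        unfolding f_def by (intro continuous_on_inner contF continuous_on_const)
      \<comment> \<open>The compact region swept out by the box; the polynomial has to be close to
        \<open>f\<close> only here.\<close>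
      define K where "K = \<Lambda> ` ({0..s0} \<times> cbox a b)"
      have K: "compact K" unfolding K_def
        by (intro compact_continuous_image continuous_on_subset[OF \<Lambda>_cont W(2)] compact_Times compact_Icc compact_cbox)
      have inW: "(t, y) \<in> W" if "t \<in> {0..s0}" "y \<in> cbox a b" for t y
        by (rule subsetD[OF W(2)]) (use that in simp)
      have inU: "\<Lambda> (t, y) \<in> \<phi> ` U" "\<Lambda> (t, y) \<in> K" if "t \<in> {0..s0}" "y \<in> cbox a b" for t y
      proof -
        show "\<Lambda> (t, y) \<in> \<phi> ` U" using \<Lambda>_in[OF inW[OF that]] by (simp add: \<Lambda>_def)
        show "\<Lambda> (t, y) \<in> K" unfolding K_def by (rule imageI) (use that in simp)
      qed
      have KU: "K \<subseteq> \<phi> ` U" using inU(1) by (auto simp: K_def)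
      define G where "G t = integral (cbox a b) (\<lambda>y. \<psi> y * f (\<Lambda> (t, y)))" for t
      have cont_sl: "continuous_on (cbox a b) (\<lambda>y. g (\<Lambda> (t, y)))"
        if "t \<in> {0..s0}" "continuous_on K g" for g :: "'a \<Rightarrow> real" and t
      proof (rule continuous_on_compose2[OF that(2)])
        show "continuous_on (cbox a b) (\<lambda>y. \<Lambda> (t, y))"
          using inW[OF that(1)] by (intro continuous_on_compose2[OF \<Lambda>_cont] continuous_intros) auto
      qed (use inU that in auto)
      have G_eq: "T (\<gamma> s) h \<bullet> x = G s"
      proof -
        have "T (\<gamma> s) h = integral (cbox a b) (\<lambda>y. \<psi> y *\<^sub>R T (\<gamma> s) (F y))"
          using integral_linear[OF int_h rep_bounded_linear[OF one_parameter_carrier[OF \<gamma>, of s]]]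
          by (simp add: h_def o_def rep_scaleR one_parameter_carrier[OF \<gamma>])
        also have "\<dots> = integral (cbox a b) (\<lambda>y. \<psi> y *\<^sub>R F (\<Lambda> (s, y)))"
        proof (rule integral_cong)
          fix y assume y: "y \<in> cbox a b"
          \<comment> \<open>Acting by \<open>\<gamma> s\<close> moves the orbit point of coordinate
            \<open>y\<close> to that of \<open>\<Lambda> (s, y)\<close>, so the group acts inside
            the integrand and the measure stays in place.\<close>
          have "T (\<gamma> s) (F y) = F (\<Lambda> (s, y))"
            using \<Lambda>_in[OF inW[OF s y]] y sub
            by (auto simp: F_def \<Lambda>_def param_chart rep_mult[symmetric] one_parameter_carrier[OF \<gamma>] param_carrier subset_iff)
          then show "\<psi> y *\<^sub>R T (\<gamma> s) (F y) = \<psi> y *\<^sub>R F (\<Lambda> (s, y))" by simp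
        qed
        finally have eq: "T (\<gamma> s) h = integral (cbox a b) (\<lambda>y. \<psi> y *\<^sub>R F (\<Lambda> (s, y)))" .
        have "continuous_on (cbox a b) (\<lambda>y. \<Lambda> (s, y))"
          using inW[OF s] by (intro continuous_on_compose2[OF \<Lambda>_cont] continuous_intros) auto
        then have "continuous_on (cbox a b) (\<lambda>y. F (\<Lambda> (s, y)))"
          by (rule continuous_on_compose2[OF contF]) (use inU s in auto)
        then have "(\<lambda>y. \<psi> y *\<^sub>R F (\<Lambda> (s, y))) integrable_on cbox a b"
          by (intro integrable_continuous continuous_on_scaleR cont\<psi>)
        from integral_linear[OF this bounded_linear_inner_left[of x]]
        show ?thesis by (simp add: eq G_def f_def o_def)
      qed
      have G0: "h \<bullet> x = G 0"
        unfolding G_def inner_integral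
        by (rule integral_cong)
          (use sub in \<open>auto simp: \<Lambda>_def f_def one_parameter_subgroup_zero[OF \<gamma>] param_carrier chart_param subset_iff\<close>)
      \<comment> \<open>The polynomial is bounded by \<open>norm h0 * norm x + e\<close>, which
        contributes \<open>e * (s * I)\<close>; putting it in place of \<open>f\<close> at the times
        \<open>s\<close> and \<open>0\<close> costs \<open>e\<close> times the integral of
        \<open>\<psi>\<close> twice.\<close>
      have approx: "\<bar>G s - G 0\<bar> \<le> s * (norm h0 * norm x * I) + e * (s * I + 2 * integral (cbox a b) \<psi>)"
        if e: "e > 0" for e
      proof -
        obtain q where q: "real_polynomial_function q" "\<And>z. z \<in> K \<Longrightarrow> \<bar>f z - q z\<bar> < e"
          using Stone_Weierstrass_real_polynomial_function[OF K continuous_on_subset[OF contf KU] e] by blast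
        have q_Ck: "Ck_on 1 UNIV q" by (rule Ck_on_real_polynomial_function[OF q(1)])
        define H where "H t = integral (cbox a b) (\<lambda>y. \<psi> y * q (\<Lambda> (t, y)))" for t
        have GH: "\<bar>G t - H t\<bar> \<le> e * integral (cbox a b) \<psi>" if t: "t \<in> {0..s0}" for t
        proof -
          have c1: "continuous_on (cbox a b) (\<lambda>y. \<psi> y * f (\<Lambda> (t, y)))"
            by (intro continuous_on_mult cont\<psi> cont_sl t continuous_on_subset[OF contf KU])
          have c2: "continuous_on (cbox a b) (\<lambda>y. \<psi> y * q (\<Lambda> (t, y)))"
            by (intro continuous_on_mult cont\<psi> cont_sl t continuous_on_subset[OF Ck_on_continuous[OF q_Ck]]) simp
          have "G t - H t = integral (cbox a b) (\<lambda>y. \<psi> y * f (\<Lambda> (t, y)) - \<psi> y * q (\<Lambda> (t, y)))"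
            unfolding G_def H_def by (rule integral_diff[symmetric]) (intro integrable_continuous c1 c2)+
          also have "norm \<dots> \<le> integral (cbox a b) (\<lambda>y. e * \<psi> y)"
          proof (rule integral_norm_bound_integral)
            fix y assume y: "y \<in> cbox a b"
            have "\<bar>f (\<Lambda> (t, y)) - q (\<Lambda> (t, y))\<bar> \<le> e" using q(2)[OF inU(2)[OF t y]] by simp
            from mult_left_mono[OF this \<psi>0[of y]]
            show "norm (\<psi> y * f (\<Lambda> (t, y)) - \<psi> y * q (\<Lambda> (t, y))) \<le> e * \<psi> y"
              using \<psi>0[of y] by (simp add: right_diff_distrib[symmetric] abs_mult mult.commute)
          qed (intro integrable_continuous continuous_on_diff continuous_on_mult continuous_on_const cont\<psi> c1 c2)+
          finally show ?thesis by simp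
        qed
        have "\<bar>H s - H 0\<bar> \<le> s * ((norm h0 * norm x + e) * I)"
          unfolding H_def I_def
        proof (rule flow_average_estimate[OF W(1) \<Lambda>_Ck[OF q_Ck] W(2) open_range sub Ck_on_right_field \<psi>_Ck closed_cball])
          show "cball origin \<rho> \<subseteq> cbox a b" using \<rho>(2) box_subset_cbox by blast
          show "\<psi> y = 0" if "y \<in> \<phi> ` U - cball origin \<rho>" for y
            unfolding \<psi>_def using that \<rho>(1) by (intro ball_bump_eq_0) auto
          show "\<bar>q (\<Lambda> (t, y))\<bar> \<le> norm h0 * norm x + e" if "t \<in> {0..s0}" "y \<in> cbox a b" for t y
            using q(2)[OF inU(2)[OF that]] f_bd[OF inU(1)[OF that]] by linarith
          show "frechet_derivative (\<lambda>z. q (\<Lambda> z)) (at (t, y)) (1, 0) =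
              frechet_derivative (\<lambda>z. q (\<Lambda> z)) (at (t, y)) (0, right_field ?v y)"
            if "t \<in> {0..s0}" "y \<in> cbox a b" for t y
            by (rule transport[OF q_Ck inW[OF that]])
        qed (rule s)
        moreover have "0 \<in> {0..s0}" using s0 by simp
        ultimately have "\<bar>G s - G 0\<bar> \<le> s * ((norm h0 * norm x + e) * I) + 2 * (e * integral (cbox a b) \<psi>)"
          using GH[OF s] GH[of 0] by linarith
        then show ?thesis by (simp add: algebra_simps)
      qed
      have "\<bar>G s - G 0\<bar> \<le> s * (norm h0 * norm x * I)"
        by (rule le_if_le_add_multiple) (rule approx)
      then show ?thesis by (simp add: inner_diff_left G_eq G0)
    qed
    have IC: "norm h0 * I \<le> C * norm ?v"
    proof -
      have "I \<le> (\<Sum>i\<in>Basis. integral (cbox a b) (\<lambda>y. \<bar>divergence (\<lambda>y. \<psi> y *\<^sub>R right_field i y) y\<bar>)) * norm ?v"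
        unfolding I_def
        by (rule integral_abs_divergence_sum_le[OF open_range sub])
          (auto intro!: Ck_on_scaleR open_range \<psi>_Ck Ck_on_right_field
            simp: right_field_sum[of _ ?v] scaleR_sum_right mult.commute simp del: Ck_on.simps One_nat_def)
      from mult_left_mono[OF this norm_ge_zero[of h0]] show ?thesis by (simp add: C_def mult.assoc)
    qed
    have "norm (T (\<gamma> s) h - h) \<le> s * (C * norm ?v)" if s: "0 < s" "s < s0" for s
    proof -
      let ?x = "T (\<gamma> s) h - h"
      have "norm ?x * norm ?x = ?x \<bullet> ?x" by (simp add: power2_norm_eq_inner[symmetric] power2_eq_square)
      also have "\<dots> \<le> s * (norm h0 * norm ?x * I)" using bound[of s ?x] s by simp
      also have "\<dots> = (s * (norm h0 * I)) * norm ?x" by (simp add: mult_ac)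
      finally have "norm ?x \<le> s * (norm h0 * I)"
        using s I0 by (cases "?x = 0") auto
      also have "\<dots> \<le> s * (C * norm ?v)" using IC s by (intro mult_left_mono) auto
      finally show ?thesis .
    qed
    then show "\<exists>\<epsilon>>0. \<forall>s. 0 < s \<longrightarrow> s < \<epsilon> \<longrightarrow> norm (T (\<gamma> s) h - h) \<le> s * (C * norm ?v)"
      using s0 by blast
  qed
  ultimately show ?thesis by (rule that)
qed

end


section \<open>Lipschitz vectors are almost invariant\<close>

text \<open>Up to \<open>1\<close> the factor \<open>r\<close> cancels the density of
  \<open>dstar\<close>, and the weight is at most \<open>1\<close> as \<open>u\<close> is positive;
  beyond, the bound \<open>M\<close> leaves the integral of the weight. A measurable majorant is
  introduced before splitting, since \<open>f\<close> carries no measurability assumption.\<close>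

lemma nn_integral_dstar_Lipschitz_finite:
  fixes f u :: "real \<Rightarrow> real"
  assumes u: "admissible_weight u"
    and f1: "\<And>r. 0 < r \<Longrightarrow> r \<le> 1 \<Longrightarrow> f r \<le> K * r"
    and f2: "\<And>r. 0 < r \<Longrightarrow> f r \<le> M" and "K \<ge> 0" "M \<ge> 0"
  shows "(\<integral>\<^sup>+r\<in>{0<..}. ennreal (f r * exp (- u r / 2)) \<partial>dstar) < \<infinity>"
proof -
  have u_pos: "u r > 0" if "r > 0" for r using u that by (simp add: admissible_weight_def)
  have fin: "(\<integral>\<^sup>+r\<in>{1..}. ennreal (exp (- u r / 2)) \<partial>dstar) < \<infinity>"
    using u unfolding admissible_weight_def by (meson zero_less_one)
  obtain D where D: "D 0 = u"
    "\<And>k x. x \<ge> 0 \<Longrightarrow> (D k has_real_derivative D (Suc k) x) (at x within {0..})"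
    using u by (auto simp: admissible_weight_def smooth_half_line_def)
  have "continuous_on {0..} u"
    using D(2)[of _ 0] by (auto simp: D(1) continuous_on_eq_continuous_within intro: DERIV_continuous)
  \<comment> \<open>\<open>u\<close> is known to be continuous only on the closed half-line;
    freezing it below \<open>1\<close> gives a Borel function that agrees with it on
    \<open>{1..}\<close>.\<close>
  then have "continuous_on UNIV (\<lambda>r. u (max 1 r))"
    by (rule continuous_on_compose2) (auto intro!: continuous_intros)
  then have um: "(\<lambda>r. u (max 1 r)) \<in> borel_measurable borel"
    by (rule borel_measurable_continuous_onI)
  define w where "w r = ennreal (exp (- u (max 1 r) / 2)) * indicator {1..} r" for r
  have w_meas: "w \<in> borel_measurable borel" unfolding w_def using um by measurable
  have "(\<integral>\<^sup>+r. w r \<partial>dstar) = (\<integral>\<^sup>+r\<in>{1..}. ennreal (exp (- u r / 2)) \<partial>dstar)"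
    by (intro nn_integral_cong) (auto simp: w_def indicator_def)
  then have w_fin: "(\<integral>\<^sup>+r. w r \<partial>dstar) < \<infinity>" using fin by simp
  define k where "k r = ennreal (K * r) * indicator {0<..1} r" for r
  have k_meas: "k \<in> borel_measurable borel" unfolding k_def by measurable
  have "(\<integral>\<^sup>+r. k r \<partial>dstar) = (\<integral>\<^sup>+r. ennreal (indicator {0<..} r / r) * k r \<partial>lborel)"
    unfolding dstar_def using k_meas by (intro nn_integral_density) auto
  also have "\<dots> = (\<integral>\<^sup>+(r::real). ennreal K * indicator {0<..1} r \<partial>lborel)"
    using \<open>K \<ge> 0\<close> by (intro nn_integral_cong) (auto simp: k_def indicator_def ennreal_mult'[symmetric])
  also have "\<dots> = ennreal K" by (subst nn_integral_cmult_indicator) auto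
  finally have k_fin: "(\<integral>\<^sup>+r. k r \<partial>dstar) < \<infinity>" by simp
  have "(\<integral>\<^sup>+r\<in>{0<..}. ennreal (f r * exp (- u r / 2)) \<partial>dstar) \<le> (\<integral>\<^sup>+r. k r + ennreal M * w r \<partial>dstar)"
  proof (rule nn_integral_mono)
    fix r :: real
    show "ennreal (f r * exp (- u r / 2)) * indicator {0<..} r \<le> k r + ennreal M * w r"
    proof (cases "r > 0")
      case True
      show ?thesis
      proof (cases "r \<le> 1")
        case le: True
        have "f r * exp (- u r / 2) \<le> K * r * exp (- u r / 2)"
          by (intro mult_right_mono f1 True le) simp
        also have "\<dots> \<le> K * r * 1"
          using u_pos[OF True] True \<open>K \<ge> 0\<close> by (intro mult_left_mono) auto
        finally have "ennreal (f r * exp (- u r / 2)) \<le> k r"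
          using True le by (auto simp: k_def intro: ennreal_leI)
        then show ?thesis using True by (simp add: add_increasing2)
      next
        case False
        have "f r * exp (- u r / 2) \<le> M * exp (- u r / 2)"
          by (intro mult_right_mono f2 True) simp
        then have "ennreal (f r * exp (- u r / 2)) \<le> ennreal M * w r"
          using False \<open>M \<ge> 0\<close> by (auto simp: w_def max_def ennreal_mult'[symmetric] intro: ennreal_leI)
        then show ?thesis using True by (simp add: add_increasing)
      qed
    qed simp
  qed
  also have "\<dots> = (\<integral>\<^sup>+r. k r \<partial>dstar) + ennreal M * (\<integral>\<^sup>+r. w r \<partial>dstar)"
    using k_meas w_meas by (subst nn_integral_add) (auto simp: dstar_def nn_integral_cmult)
  also have "\<dots> < \<infinity>" using k_fin w_fin by (simp add: ennreal_mult_less_top less_top)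
  finally show ?thesis .
qed

lemma lie_grading_sum_in:
  assumes "lie_grading br L n R" "\<And>k. k \<in> {1..n} \<Longrightarrow> a k \<in> R k"
  shows "(\<Sum>k=1..n. c k *\<^sub>R a k) \<in> L"
proof -
  have "L = {\<Sum>k=1..n. a k | a. \<forall>k\<in>{1..n}. a k \<in> R k}"
    using assms(1) by (simp add: lie_grading_def)
  moreover have "\<forall>k\<in>{1..n}. c k *\<^sub>R a k \<in> R k"
    using assms by (auto simp: lie_grading_def intro: subspace_scale)
  ultimately show ?thesis by blast
qed

lemma sum_fun_apply2:
  fixes c :: "'b \<Rightarrow> real" and a :: "'b \<Rightarrow> 'c \<Rightarrow> 'd \<Rightarrow> real"
  shows "(\<Sum>k\<in>I. c k *\<^sub>R a k) f x = (\<Sum>k\<in>I. c k * a k f x)"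
  by (induction I rule: infinite_finite_induct) (auto simp: scaleR_fun_def)

context unitary_rep
begin

lemma lipschitz_vector_almost_invariant:
  assumes h: "lipschitz_vector h" "h \<noteq> 0" and grading: "lie_grading lie_bracket (lie_algebra N) n R"
    and u: "admissible_weight u"
  shows "almost_invariant N n R u T h"
  unfolding almost_invariant_def
proof (intro conjI ballI allI impI)
  fix g a assume "canonical_coordinates N n R g a"
  then have a: "a k \<in> R k" if "k \<in> {1..n}" for k
    using that by (simp add: canonical_coordinates_def)
  obtain C where C: "\<And>\<gamma>. one_parameter_subgroup N \<gamma> \<Longrightarrow> norm (T (\<gamma> 1) h - h) \<le> C * norm (velocity \<gamma>)"
    using h(1) by (auto simp: lipschitz_vector_def)
  obtain \<beta> f where \<beta>: "\<beta> > 0" and probe: "\<And>c w. smooth_curve N c \<Longrightarrow> c 0 = \<one>\<^bsub>N\<^esub> \<Longrightarrow>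
       velocity_field N c (f w) \<one>\<^bsub>N\<^esub> = \<beta> * (velocity c \<bullet> w)"
    using exists_probe_function by metis
  \<comment> \<open>The probe for \<open>w\<close> returns \<open>\<beta>\<close> times the
    component of the velocity along \<open>w\<close>; the summands bound the contributions of the
    homogeneous parts, each divided by \<open>r\<close>, for \<open>r \<le> 1\<close>.\<close>
  define V where "V = (\<Sum>w\<in>Basis. \<Sum>k=1..n. \<bar>a k (f w) \<one>\<^bsub>N\<^esub>\<bar> / \<beta>)"
  have V: "V \<ge> 0" unfolding V_def using \<beta> by (intro sum_nonneg) auto
  have flow: "\<exists>\<gamma>. one_parameter_subgroup N \<gamma> \<and> canonical_point N n (dilate r a) = \<gamma> 1 \<and>
      (r \<le> 1 \<longrightarrow> norm (velocity \<gamma>) \<le> V * r)" if r: "0 < r" for r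
  proof -
    have X: "(\<Sum>k=1..n. dilate r a k) \<in> lie_algebra N"
      unfolding dilate_def by (rule lie_grading_sum_in[OF grading a])
    obtain \<gamma> where \<gamma>: "one_parameter_subgroup N \<gamma>" "velocity_field N \<gamma> = (\<Sum>k=1..n. dilate r a k)"
      "lie_exp N (\<Sum>k=1..n. dilate r a k) = \<gamma> 1"
      using lie_exp_one_parameter_subgroup[OF X] .
    have "norm (velocity \<gamma>) \<le> V * r" if "r \<le> 1"
    proof -
      \<comment> \<open>The probe lemma applies to the whole sum, which is a velocity field; the sum
        is then evaluated term by term as an operator.\<close>
      have "velocity \<gamma> \<bullet> w = (\<Sum>k=1..n. r ^ k * a k (f w) \<one>\<^bsub>N\<^esub>) / \<beta>" for w
        using probe[of \<gamma> w] \<gamma>(1) one_parameter_subgroup_zero[OF \<gamma>(1)] \<beta>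
        by (simp add: \<gamma>(2) dilate_def sum_fun_apply2 one_parameter_subgroup_def field_simps)
      then have "\<bar>velocity \<gamma> \<bullet> w\<bar> \<le> (\<Sum>k=1..n. \<bar>a k (f w) \<one>\<^bsub>N\<^esub>\<bar> / \<beta>) * r" for w
      proof -
        assume eq: "\<And>w. velocity \<gamma> \<bullet> w = (\<Sum>k=1..n. r ^ k * a k (f w) \<one>\<^bsub>N\<^esub>) / \<beta>"
        have "\<bar>velocity \<gamma> \<bullet> w\<bar> \<le> (\<Sum>k=1..n. \<bar>r ^ k * a k (f w) \<one>\<^bsub>N\<^esub>\<bar>) / \<beta>"
          using \<beta> by (simp add: eq abs_divide divide_right_mono sum_abs)
        also have "\<dots> \<le> (\<Sum>k=1..n. r * \<bar>a k (f w) \<one>\<^bsub>N\<^esub>\<bar>) / \<beta>"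
        proof (intro divide_right_mono sum_mono)
          fix k assume "k \<in> {1..n}"
          \<comment> \<open>Degrees start at \<open>1\<close>; this is the source of the first-order
            decay in \<open>r\<close>.\<close>
          then have "r ^ k \<le> r ^ 1" using r \<open>r \<le> 1\<close> by (intro power_decreasing) auto
          then show "\<bar>r ^ k * a k (f w) \<one>\<^bsub>N\<^esub>\<bar> \<le> r * \<bar>a k (f w) \<one>\<^bsub>N\<^esub>\<bar>"
            using r by (simp add: abs_mult mult_right_mono)
        qed (use \<beta> in simp)
        also have "\<dots> = (\<Sum>k=1..n. \<bar>a k (f w) \<one>\<^bsub>N\<^esub>\<bar> / \<beta>) * r"
          by (simp add: sum_distrib_left sum_divide_distrib mult.commute)
        finally show ?thesis .
      qed
      then have "(\<Sum>w\<in>Basis. \<bar>velocity \<gamma> \<bullet> w\<bar>) \<le> (\<Sum>w\<in>Basis. (\<Sum>k=1..n. \<bar>a k (f w) \<one>\<^bsub>N\<^esub>\<bar> / \<beta>) * r)"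
        by (intro sum_mono)
      then show ?thesis
        using norm_le_l1[of "velocity \<gamma>"] by (simp add: V_def sum_distrib_right)
    qed
    then show ?thesis using \<gamma>(1,3) by (auto simp: canonical_point_def)
  qed
  show "(\<integral>\<^sup>+r\<in>{0<..}. ennreal (norm (T (canonical_point N n (dilate r a)) h - h) * exp (- u r / 2)) \<partial>dstar) < \<infinity>"
  proof (rule nn_integral_dstar_Lipschitz_finite[OF u])
    fix r :: real assume r: "0 < r"
    then obtain \<gamma> where \<gamma>: "one_parameter_subgroup N \<gamma>" "canonical_point N n (dilate r a) = \<gamma> 1"
      "r \<le> 1 \<Longrightarrow> norm (velocity \<gamma>) \<le> V * r" using flow by blast
    \<comment> \<open>For \<open>r\<close> above \<open>1\<close> the velocity is left uncontrolled,
      and unitarity alone bounds the displacement.\<close>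
    show "norm (T (canonical_point N n (dilate r a)) h - h) \<le> 2 * norm h"
      using norm_triangle_ineq4[of "T (\<gamma> 1) h" h] by (simp add: \<gamma>(2) rep_norm one_parameter_carrier[OF \<gamma>(1)])
    assume "r \<le> 1"
    have "norm (T (\<gamma> 1) h - h) \<le> C * norm (velocity \<gamma>)" by (rule C[OF \<gamma>(1)])
    also have "\<dots> \<le> \<bar>C\<bar> * norm (velocity \<gamma>)" by (intro mult_right_mono) auto
    also have "\<dots> \<le> \<bar>C\<bar> * (V * r)" by (intro mult_left_mono \<gamma>(3) \<open>r \<le> 1\<close>) auto
    finally show "norm (T (canonical_point N n (dilate r a)) h - h) \<le> (\<bar>C\<bar> * V) * r"
      by (simp add: \<gamma>(2) mult.assoc)
  qed (use V in auto)
qed (rule h)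

end

theorem theorem7:
  fixes N :: "('g, 'a::euclidean_space) lie_group_data"
    and n :: nat
    and R :: "nat \<Rightarrow> 'g vfield set"
    and u :: "real \<Rightarrow> real"
    and T :: "'g \<Rightarrow> 'h \<Rightarrow> 'h::complex_hilbert_space"
  assumes "lie_group N"
    and "connected_space (mtop N)"
    and "simply_connected_space (mtop N)"
    and "nilpotent_of_class lie_bracket (lie_algebra N) n"
    and "lie_grading lie_bracket (lie_algebra N) n R"
    and "admissible_weight u"
    and "unitary_representation N T"
    and "\<exists>h::'h. h \<noteq> 0"
    and "\<forall>h. invariant_vector N T h \<longrightarrow> h = 0"
  shows "(\<forall>h\<in>garding_space N T. h \<noteq> 0 \<longrightarrow> almost_invariant N n R u T h) \<and>
    summable_representation N n R u T"
proof -
  interpret lie_group_charts N by unfold_locales (rule assms(1))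
  obtain U \<phi> where chart: "(U, \<phi>) \<in> charts N" "\<one>\<^bsub>N\<^esub> \<in> U"
    using chart_at[OF one_closed] .
  interpret unitary_rep N U \<phi> T by unfold_locales (use chart assms(7) in auto)
  \<comment> \<open>Averaging the orbit of any nonzero vector supplies the almost invariant vector
    that summability asks for.\<close>
  obtain h0 :: 'h where "h0 \<noteq> 0" using assms(8) by blast
  then obtain h where "h \<noteq> 0" "lipschitz_vector h" using exists_lipschitz_vector by blast
  then show ?thesis
    using assms(9) garding_lipschitz_vector lipschitz_vector_almost_invariant[OF _ _ assms(5,6)]
    by (auto simp: summable_representation_def)
qed

end
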